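(* Let $G$ be a connected $d$-regular multigraph without loops on vertex set $[g]$, with $d\ge 3$, and adjacency matrix $A$. Let $X_G$ be the number of perfect matchings in the random $n$-lift $L_n(G)$, and let $n\to\infty$ along the integers $n$ for which $G$ has a fractional perfect matching $f$ with $nf(e)\in\mathbb{Z}$ for all $e$. (i) If $G$ is non-bipartite, then \[\mathbb{E}X_G\sim\frac{2(d-1)^{(d-1)g/2}}{(d(d-2))^{dg/4-g/2}\sqrt{\det(A+dI)}}\Big(\frac{(d-1)^{d-1}}{d^{d-2}}\Big)^{gn/2}.\] (ii) If $G$ is bipartite, then \[\mathbb{E}X_G\sim\frac{(d-1)^{(d-1)g/2+1/2}}{(d(d-2))^{dg/4-g/2+1/2}\sqrt{\det(A'+dI)}}(2\pi n)^{1/2}\Big(\frac{(d-1)^{d-1}}{d^{d-2}}\Big)^{gn/2},\] where $A'$ is obtained from $A$ by deleting the last row and column.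
   Context: The random $n$-lift $L_n(G)$ of $G$ has vertex set $V_1\cup\dots\cup V_g$, pairwise disjoint sets of size $n$, and for each edge $e$ of $G$ with endpoints $i,j$ a uniformly random perfect matching (the fiber $F_e$) between $V_i$ and $V_j$, independently over the edges of $G$; $L_n(G)$ is the union of the fibers (fibers over parallel edges give distinct edges). A perfect matching of $L_n(G)$ is a set of its edges covering every vertex exactly once. A fractional perfect matching of $G$ is $f:E(G)\to[0,1]$ with $\sum_{e\ni v}f(e)=1$ for every vertex $v$. The adjacency matrix of a multigraph has entry $A_{ij}$ equal to the number of edges between $i$ and $j$. *)

theory Defs
  imports
    "HOL-Probability.Probability"
    "HOL-Library.Landau_Symbols"
    "Jordan_Normal_Form.Determinant"
begin

text \<open>
  A multigraph is given by a vertex set \<open>V\<close>, a set \<open>E\<close> of edge names, and a map \<open>ends\<close> sending an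
  edge name to its set of endpoints; parallel edges are distinct names with the same endpoints.
  Without loops every edge has exactly two endpoints.
\<close>

definition loopless_multigraph :: "'v set \<Rightarrow> 'e set \<Rightarrow> ('e \<Rightarrow> 'v set) \<Rightarrow> bool" where
  "loopless_multigraph V E ends \<longleftrightarrow>
     finite V \<and> finite E \<and> (\<forall>e\<in>E. ends e \<subseteq> V \<and> card (ends e) = 2)"

definition vertex_degree :: "'e set \<Rightarrow> ('e \<Rightarrow> 'v set) \<Rightarrow> 'v \<Rightarrow> nat" where
  "vertex_degree E ends v = card {e \<in> E. v \<in> ends e}"

definition regular :: "'v set \<Rightarrow> 'e set \<Rightarrow> ('e \<Rightarrow> 'v set) \<Rightarrow> nat \<Rightarrow> bool" where
  "regular V E ends d \<longleftrightarrow> (\<forall>v\<in>V. vertex_degree E ends v = d)"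

definition connected_multigraph :: "'v set \<Rightarrow> 'e set \<Rightarrow> ('e \<Rightarrow> 'v set) \<Rightarrow> bool" where
  "connected_multigraph V E ends \<longleftrightarrow>
     V \<noteq> {} \<and> (\<forall>u\<in>V. \<forall>v\<in>V. (u, v) \<in> {(x, y). \<exists>e\<in>E. ends e = {x, y}}\<^sup>*)"

definition bipartite :: "'v set \<Rightarrow> 'e set \<Rightarrow> ('e \<Rightarrow> 'v set) \<Rightarrow> bool" where
  "bipartite V E ends \<longleftrightarrow>
     (\<exists>L R. L \<union> R = V \<and> L \<inter> R = {} \<and> (\<forall>e\<in>E. \<exists>x\<in>L. \<exists>y\<in>R. ends e = {x, y}))"

definition perfect_matchings :: "'v set \<Rightarrow> 'e set \<Rightarrow> ('e \<Rightarrow> 'v set) \<Rightarrow> 'e set set" where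
  "perfect_matchings V E ends = {M. M \<subseteq> E \<and> (\<forall>v\<in>V. \<exists>!e. e \<in> M \<and> v \<in> ends e)}"

definition fractional_perfect_matching ::
    "'v set \<Rightarrow> 'e set \<Rightarrow> ('e \<Rightarrow> 'v set) \<Rightarrow> ('e \<Rightarrow> real) \<Rightarrow> bool" where
  "fractional_perfect_matching V E ends f \<longleftrightarrow>
     (\<forall>e\<in>E. 0 \<le> f e \<and> f e \<le> 1) \<and> (\<forall>v\<in>V. (\<Sum>e | e \<in> E \<and> v \<in> ends e. f e) = 1)"

definition admissible :: "'v set \<Rightarrow> 'e set \<Rightarrow> ('e \<Rightarrow> 'v set) \<Rightarrow> nat \<Rightarrow> bool" where
  "admissible V E ends n \<longleftrightarrow>
     (\<exists>f. fractional_perfect_matching V E ends f \<and> (\<forall>e\<in>E. real n * f e \<in> \<int>))"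

text \<open>Vertices are numbered from \<open>0\<close>, as matrix rows and columns are.\<close>

definition adjacency_matrix :: "nat \<Rightarrow> 'e set \<Rightarrow> ('e \<Rightarrow> nat set) \<Rightarrow> real mat" where
  "adjacency_matrix g E ends = mat g g (\<lambda>(i, j). real (card {e \<in> E. ends e = {i, j}}))"

text \<open>The set \<open>V\<^sub>i\<close> of vertices of the lift above \<open>i\<close>.\<close>

definition fiber_vertices :: "nat \<Rightarrow> 'v \<Rightarrow> ('v \<times> nat) set" where
  "fiber_vertices n i = {i} \<times> {..<n}"

definition bipartite_perfect_matchings :: "'a set \<Rightarrow> 'a set \<Rightarrow> 'a set set set" where
  "bipartite_perfect_matchings A B =
     perfect_matchings (A \<union> B) {{x, y} | x y. x \<in> A \<and> y \<in> B} (\<lambda>p. p)"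

text \<open>
  The possible fibers over an edge with endpoint set \<open>D = {i, j}\<close>; the two ways of writing \<open>D\<close>
  contribute the same matchings, because these consist of unordered pairs.
\<close>

definition fibers :: "nat \<Rightarrow> 'v set \<Rightarrow> ('v \<times> nat) set set set" where
  "fibers n D =
     {F. \<exists>i j. D = {i, j} \<and> F \<in> bipartite_perfect_matchings (fiber_vertices n i) (fiber_vertices n j)}"

text \<open>
  A sample \<open>F\<close> of the random lift assigns to each edge \<open>e\<close> of \<open>G\<close> its fiber \<open>F e\<close>; off \<open>E\<close> it takes the
  dummy value \<open>{}\<close>.
\<close>

definition random_lift ::
    "nat \<Rightarrow> 'e set \<Rightarrow> ('e \<Rightarrow> 'v set) \<Rightarrow> ('e \<Rightarrow> ('v \<times> nat) set set) pmf" where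
  "random_lift n E ends = Pi_pmf E {} (\<lambda>e. pmf_of_set (fibers n (ends e)))"

text \<open>
  An edge of the lift is a pair of an edge \<open>e\<close> of \<open>G\<close> and a member of \<open>F e\<close>, so that
  fibers over parallel edges are disjoint.
\<close>

definition lift_vertices :: "nat \<Rightarrow> 'v set \<Rightarrow> ('v \<times> nat) set" where
  "lift_vertices n V = (\<Union>i\<in>V. fiber_vertices n i)"

definition lift_edges ::
    "'e set \<Rightarrow> ('e \<Rightarrow> ('v \<times> nat) set set) \<Rightarrow> ('e \<times> ('v \<times> nat) set) set" where
  "lift_edges E F = (SIGMA e:E. F e)"

definition num_perfect_matchings ::
    "nat \<Rightarrow> 'v set \<Rightarrow> 'e set \<Rightarrow> ('e \<Rightarrow> ('v \<times> nat) set set) \<Rightarrow> nat" where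
  "num_perfect_matchings n V E F = card (perfect_matchings (lift_vertices n V) (lift_edges E F) snd)"

definition expected_perfect_matchings :: "'v set \<Rightarrow> 'e set \<Rightarrow> ('e \<Rightarrow> 'v set) \<Rightarrow> nat \<Rightarrow> real" where
  "expected_perfect_matchings V E ends n =
     measure_pmf.expectation (random_lift n E ends) (\<lambda>F. real (num_perfect_matchings n V E F))"

end

theory Submission
  imports Defs "HOL-Real_Asymp.Real_Asymp"
begin

text \<open>
  Each perfect matching of the lift colours every vertex of the lift by the edge of \<open>G\<close> above which it
  is matched. Counting colourings gives
  \<open>E X = (n!)\<^sup>g \<Sum>\<^sub>m \<Prod>\<^sub>e (n - m\<^sub>e)! / (m\<^sub>e! n!)\<close>, the sum over all integer \<open>m\<close>
  in which the edges at every vertex have total weight \<open>n\<close>. The terms concentrate around \<open>m\<^sub>e = n/d\<close>: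
  far away they are exponentially small because the Bethe entropy has a strict maximum on the
  simplex, and within distance \<open>n\<close> to the power \<open>3/5\<close> they agree, up to a factor depending only on
  \<open>n\<close>, with products of symmetric binomial weights of variance \<open>\<sigma>\<^sup>2 n\<close>, where
  \<open>\<sigma>\<^sup>2 = (d - 1) / (d (d - 2))\<close>. The constrained sum of the binomial weights is a Fourier integral of
  \<open>\<Prod>\<^sub>e cos ((\<theta>\<^sub>u + \<theta>\<^sub>v)/2)\<close> to the power \<open>4 \<sigma>\<^sup>2 n\<close> over one angle per vertex. If \<open>G\<close> is not bipartite,
  the modulus is maximal at exactly two points of the torus (all angles \<open>0\<close>, all angles \<open>\<pi>\<close>), whence the
  factor \<open>2\<close>. If \<open>G\<close> is bipartite, one constraint is redundant, and after
  dropping it there is a single maximum and one Gaussian dimension less.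
\<close>

section \<open>Expectation as a sum over edge multiplicities\<close>

text \<open>Symmetric binomial weights serve as the reference because their characteristic function
  is exactly a power of a cosine times a phase. Fourier inversion then treats the lattice
  constraints without error terms, and only ratios of factorials need Stirling's formula. The number
  \<open>edge_variance d\<close> is -1 divided by the second derivative of \<open>bethe\<close> at
  1/d; for d = 2 that derivative vanishes. First derivatives are not matched: the linear term has
  the same coefficient on every edge, and the deviations from n/d sum to zero over the edges. The
  entropy bound is local: a sum over edges is half the sum over vertices of the sums over incident
  edges, and each of the latter concerns one point of a simplex with d coordinates. Admissibility of
  n enters only through parity: it makes n g even, so that the two maxima of the non-bipartite case
  contribute equal integrals instead of cancelling.\<close>

lemma exists_permutes_image:
  assumes "finite A" "S \<subseteq> A" "T \<subseteq> A" "card S = card T"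
  obtains \<tau> where "\<tau> permutes A" "\<tau> ` S = T"
proof -
  have fin: "finite S" "finite T" using assms finite_subset by auto
  obtain f where f: "bij_betw f S T" using fin assms(4) by (metis finite_same_card_bij)
  have "card (A - S) = card (A - T)" using assms fin by (simp add: card_Diff_subset)
  then obtain h where h: "bij_betw h (A - S) (A - T)"
    using assms(1) by (metis finite_same_card_bij finite_Diff)
  define \<tau> where "\<tau> x = (if x \<in> S then f x else if x \<in> A then h x else x)" for x
  have 1: "bij_betw \<tau> S T" using f by (subst bij_betw_cong[where g = f]) (auto simp: \<tau>_def)
  have 2: "bij_betw \<tau> (A - S) (A - T)" using h by (subst bij_betw_cong[where g = h]) (auto simp: \<tau>_def)
  have "bij_betw \<tau> (S \<union> (A - S)) (T \<union> (A - T))" by (rule bij_betw_combine[OF 1 2]) auto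
  then have "bij_betw \<tau> A A" using assms by (simp add: Un_absorb1)
  then have "\<tau> permutes A" by (rule bij_imp_permutes) (use assms in \<open>auto simp: \<tau>_def\<close>)
  moreover have "\<tau> ` S = T" using 1 by (simp add: bij_betw_def)
  ultimately show ?thesis by (rule that)
qed

text \<open>Composition with a permutation carrying \<open>T\<close> to \<open>T'\<close> is a
  bijection between the two sets.\<close>

lemma card_permutes_image_indep:
  assumes "finite A" "T \<subseteq> A" "T' \<subseteq> A" "card T = card T'"
  shows "card {\<sigma>. \<sigma> permutes A \<and> \<sigma> ` S = T} = card {\<sigma>. \<sigma> permutes A \<and> \<sigma> ` S = T'}"
proof -
  obtain \<tau> where t: "\<tau> permutes A" "\<tau> ` T = T'" using exists_permutes_image[OF assms] by metis
  define \<tau>' where "\<tau>' = inv_into UNIV \<tau>"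
  have ti: "\<tau>' permutes A" "\<tau>' ` T' = T" 
    using t permutes_inv[OF t(1)] permutes_inj[OF t(1)] by (auto simp: \<tau>'_def image_inv_f_f)
  show ?thesis
  proof (rule bij_betw_same_card, rule bij_betw_byWitness[where f = "\<lambda>\<sigma>. \<tau> \<circ> \<sigma>" and f' = "\<lambda>\<sigma>. \<tau>' \<circ> \<sigma>"])
    show "\<forall>a\<in>{\<sigma>. \<sigma> permutes A \<and> \<sigma> ` S = T}. \<tau>' \<circ> (\<tau> \<circ> a) = a"
      using permutes_inv_o[OF t(1)] by (auto simp: o_assoc \<tau>'_def)
    show "\<forall>a\<in>{\<sigma>. \<sigma> permutes A \<and> \<sigma> ` S = T'}. \<tau> \<circ> (\<tau>' \<circ> a) = a"
      using permutes_inv_o[OF t(1)] by (auto simp: o_assoc \<tau>'_def)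
    show "(\<circ>) \<tau> ` {\<sigma>. \<sigma> permutes A \<and> \<sigma> ` S = T} \<subseteq> {\<sigma>. \<sigma> permutes A \<and> \<sigma> ` S = T'}"
      using t by (auto simp: permutes_compose image_comp[symmetric])
    show "(\<circ>) (\<tau>') ` {\<sigma>. \<sigma> permutes A \<and> \<sigma> ` S = T'} \<subseteq> {\<sigma>. \<sigma> permutes A \<and> \<sigma> ` S = T}"
      using ti by (auto simp: permutes_compose image_comp[symmetric])
  qed
qed

text \<open>Classifying all permutations of \<open>A\<close> by the image of \<open>S\<close> gives
  one class for each subset of size \<open>card S\<close>. The classes are equally large, so each
  has size (card A)! divided by the binomial coefficient.\<close>

lemma card_permutes_image:
  assumes "finite A" "S \<subseteq> A" "T \<subseteq> A"
  shows "card {\<sigma>. \<sigma> permutes A \<and> \<sigma> ` S = T} =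
    (if card S = card T then fact (card S) * fact (card A - card S) else 0)"
proof (cases "card S = card T")
  case False
  have "card (\<sigma> ` S) = card S" if "\<sigma> permutes A" for \<sigma>
    using that by (metis card_image permutes_inj_on)
  then have "{\<sigma>. \<sigma> permutes A \<and> \<sigma> ` S = T} = {}" using False by auto
  then show ?thesis using False by (metis card.empty)
next
  case True
  have le: "card S \<le> card A" using assms by (simp add: card_mono)
  have "fact (card A) = card {\<sigma>. \<sigma> permutes A}" using assms(1) card_permutations by metis
  also have "{\<sigma>. \<sigma> permutes A} = (\<Union>U\<in>{U. U \<subseteq> A \<and> card U = card S}. {\<sigma>. \<sigma> permutes A \<and> \<sigma> ` S = U})"
  proof -
    have "\<sigma> ` S \<subseteq> A \<and> card (\<sigma> ` S) = card S" if "\<sigma> permutes A" for \<sigma>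
      using that assms(2) by (metis card_image permutes_inj_on permutes_image image_mono)
    then show ?thesis by auto
  qed
  also have "card \<dots> = (\<Sum>U\<in>{U. U \<subseteq> A \<and> card U = card S}. card {\<sigma>. \<sigma> permutes A \<and> \<sigma> ` S = U})"
    by (rule card_UN_disjoint) (use assms in \<open>auto simp: finite_permutations\<close>)
  also have "\<dots> = (\<Sum>U\<in>{U. U \<subseteq> A \<and> card U = card S}. card {\<sigma>. \<sigma> permutes A \<and> \<sigma> ` S = T})"
    by (rule sum.cong[OF refl], rule card_permutes_image_indep) (use assms True in auto)
  also have "\<dots> = (card A choose card S) * card {\<sigma>. \<sigma> permutes A \<and> \<sigma> ` S = T}"
    using assms(1) by (simp add: n_subsets)
  finally have "(card A choose card S) * card {\<sigma>. \<sigma> permutes A \<and> \<sigma> ` S = T} = fact (card A)" ..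
  also have "\<dots> = (card A choose card S) * (fact (card S) * fact (card A - card S))"
    by (simp only: binomial_fact_lemma[OF le, symmetric] mult_ac)
  finally have "(card A choose card S) * card {\<sigma>. \<sigma> permutes A \<and> \<sigma> ` S = T}
     = (card A choose card S) * (fact (card S) * fact (card A - card S))" .
  then have "card {\<sigma>. \<sigma> permutes A \<and> \<sigma> ` S = T} = fact (card S) * fact (card A - card S)"
    using zero_less_binomial[OF le] by (simp only: mult_cancel1) simp
  then show ?thesis using True by simp
qed

text \<open>The multinomial coefficient, in multiplied form so that the induction stays in the
  natural numbers. Adding a value \<open>s\<close> splits a function into the preimage
  \<open>B\<close> of \<open>s\<close> and its restriction to \<open>A - B\<close>.\<close>

lemma card_funcs_with_fibre_sizes:
  assumes "finite S" "finite A" "(\<Sum>s\<in>S. k s) = card A"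
  shows "card {f \<in> A \<rightarrow>\<^sub>E S. \<forall>s\<in>S. card {a\<in>A. f a = s} = k s} * (\<Prod>s\<in>S. fact (k s)) = fact (card A)"
  using assms
proof (induction S arbitrary: A rule: finite_induct)
  case empty
  then have "A = {}" by simp
  then show ?case by simp
next
  case (insert s S)
  let ?N = "\<lambda>A S. {f \<in> A \<rightarrow>\<^sub>E S. \<forall>s\<in>S. card {a\<in>A. f a = s} = k s}"
  let ?Bs = "{B. B \<subseteq> A \<and> card B = k s}"
  have cA: "card A = k s + (\<Sum>s\<in>S. k s)" using insert by simp
  have finN: "finite (?N (A - B) S)" for B 
    by (rule finite_subset[of _ "(A - B) \<rightarrow>\<^sub>E S"]) (use insert in \<open>auto intro!: finite_PiE\<close>)
  have "card (?N A (insert s S)) = card (SIGMA B:?Bs. ?N (A - B) S)"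
  proof (rule bij_betw_same_card, rule bij_betw_byWitness[where 
        f = "\<lambda>f. ({a\<in>A. f a = s}, restrict f (A - {a\<in>A. f a = s}))" and
        f' = "\<lambda>(B, h). \<lambda>a\<in>A. if a \<in> B then s else h a"])
    show "\<forall>f\<in>?N A (insert s S). (case ({a \<in> A. f a = s}, restrict f (A - {a \<in> A. f a = s})) of
            (B, h) \<Rightarrow> \<lambda>a\<in>A. if a \<in> B then s else h a) = f"
      by (auto simp: fun_eq_iff PiE_def extensional_def restrict_def)
    show "\<forall>p\<in>SIGMA B:?Bs. ?N (A - B) S.
       ({a \<in> A. (case p of (B, h) \<Rightarrow> \<lambda>a\<in>A. if a \<in> B then s else h a) a = s},
        restrict (case p of (B, h) \<Rightarrow> \<lambda>a\<in>A. if a \<in> B then s else h a)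
         (A - {a \<in> A. (case p of (B, h) \<Rightarrow> \<lambda>a\<in>A. if a \<in> B then s else h a) a = s})) = p"
    proof clarify
      fix B h assume B: "B \<subseteq> A" "card B = k s" and h: "h \<in> (A - B) \<rightarrow>\<^sub>E S"
      have *: "{a \<in> A. (\<lambda>a\<in>A. if a \<in> B then s else h a) a = s} = B"
        using B h insert.hyps(2) by (auto split: if_splits dest: PiE_mem)
      have "restrict (\<lambda>a\<in>A. if a \<in> B then s else h a) (A - B) = h"
        using h by (auto simp: fun_eq_iff PiE_def extensional_def restrict_def)
      then show "{a \<in> A. (\<lambda>a\<in>A. if a \<in> B then s else h a) a = s} = B \<and>
         restrict (\<lambda>a\<in>A. if a \<in> B then s else h a) (A - {a \<in> A. (\<lambda>a\<in>A. if a \<in> B then s else h a) a = s}) = h"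
        by (simp only: *)
    qed
    show "(\<lambda>f. ({a \<in> A. f a = s}, restrict f (A - {a \<in> A. f a = s}))) ` ?N A (insert s S) \<subseteq> (SIGMA B:?Bs. ?N (A - B) S)"
    proof clarify
      fix f assume f: "f \<in> A \<rightarrow>\<^sub>E insert s S" and c: "\<forall>t\<in>insert s S. card {a \<in> A. f a = t} = k t"
      have "{a \<in> A - {a \<in> A. f a = s}. restrict f (A - {a \<in> A. f a = s}) a = t} = {a \<in> A. f a = t}" if "t \<in> S" for t
        using that insert.hyps(2) by (auto simp: restrict_def)
      then show "{a \<in> A. f a = s} \<in> ?Bs \<and> restrict f (A - {a \<in> A. f a = s}) \<in> ?N (A - {a \<in> A. f a = s}) S"
        using f c by (auto simp: PiE_def Pi_def)
    qed
    show "(\<lambda>(B, h). \<lambda>a\<in>A. if a \<in> B then s else h a) ` (SIGMA B:?Bs. ?N (A - B) S) \<subseteq> ?N A (insert s S)"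
    proof clarify
      fix B h assume B: "B \<subseteq> A" "card B = k s" and h: "h \<in> (A - B) \<rightarrow>\<^sub>E S"
         and c: "\<forall>t\<in>S. card {a \<in> A - B. h a = t} = k t"
      have "{a \<in> A. (\<lambda>a\<in>A. if a \<in> B then s else h a) a = s} = B"
        using B h insert.hyps(2) by (auto split: if_splits dest: PiE_mem)
      moreover have "{a \<in> A. (\<lambda>a\<in>A. if a \<in> B then s else h a) a = t} = {a \<in> A - B. h a = t}" if "t \<in> S" for t
        using that insert.hyps(2) by auto
      ultimately show "(\<lambda>a\<in>A. if a \<in> B then s else h a) \<in> A \<rightarrow>\<^sub>E insert s S \<and>
         (\<forall>t\<in>insert s S. card {a \<in> A. (\<lambda>a\<in>A. if a \<in> B then s else h a) a = t} = k t)"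
        using B h c by (auto simp: PiE_def Pi_def)
    qed
  qed
  also have "\<dots> = (\<Sum>B\<in>?Bs. card (?N (A - B) S))"
    by (rule card_SigmaI) (use insert finN in auto)
  finally have "card (?N A (insert s S)) * (\<Prod>t\<in>insert s S. fact (k t)) =
      (\<Sum>B\<in>?Bs. card (?N (A - B) S) * (\<Prod>t\<in>S. fact (k t)) * fact (k s))"
    using insert.hyps by (simp add: sum_distrib_left mult_ac)
  also have "\<dots> = (\<Sum>B\<in>?Bs. fact (card A - k s) * fact (k s))"
  proof (rule sum.cong[OF refl])
    fix B assume B: "B \<in> ?Bs"
    then have cB: "card (A - B) = card A - k s" using insert.prems by (auto simp: card_Diff_subset finite_subset)
    have "card (?N (A - B) S) * (\<Prod>t\<in>S. fact (k t)) = fact (card (A - B))"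
      by (rule insert.IH) (use insert.prems cA cB in auto)
    then show "card (?N (A - B) S) * (\<Prod>t\<in>S. fact (k t)) * fact (k s) = fact (card A - k s) * fact (k s)"
      using cB by simp
  qed
  also have "\<dots> = (card A choose k s) * (fact (k s) * fact (card A - k s))"
    using insert.prems by (simp add: n_subsets mult_ac)
  also have "\<dots> = fact (card A)" using binomial_fact_lemma[of "k s" "card A"] cA by (simp add: mult_ac)
  finally show ?case .
qed

section \<open>Fibers as permutations, perfect matchings as colourings\<close>

definition lift_fiber :: "nat \<Rightarrow> 'v \<Rightarrow> 'v \<Rightarrow> (nat \<Rightarrow> nat) \<Rightarrow> ('v \<times> nat) set set" where
  "lift_fiber n i j \<sigma> = (\<lambda>a. {(i, a), (j, \<sigma> a)}) ` {..<n}"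

lemma bipartite_perfect_matchings_commute:
  "bipartite_perfect_matchings A B = bipartite_perfect_matchings B A"
proof -
  have "{{x, y} |x y. x \<in> A \<and> y \<in> B} = {{x, y} |x y. x \<in> B \<and> y \<in> A}" by (auto simp: insert_commute)
  then show ?thesis by (simp add: bipartite_perfect_matchings_def Un_commute)
qed

lemma fibers_eq_bipartite_perfect_matchings:
  "fibers n {i, j} = bipartite_perfect_matchings (fiber_vertices n i) (fiber_vertices n j)"
  unfolding fibers_def doubleton_eq_iff using bipartite_perfect_matchings_commute by fastforce

text \<open>Since \<open>i\<close> and \<open>j\<close> differ, the two layers are disjoint and
  every matching edge has one end in each. Sending a point of the first layer to its partner is
  injective, hence a permutation of the finite index set.\<close>

lemma fibers_eq:
  assumes "i \<noteq> j"
  shows "fibers n {i, j} = lift_fiber n i j ` {\<sigma>. \<sigma> permutes {..<n}}"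
proof (intro equalityI subsetI)
  fix F assume "F \<in> lift_fiber n i j ` {\<sigma>. \<sigma> permutes {..<n}}"
  then obtain \<sigma> where s: "\<sigma> permutes {..<n}" and F: "F = lift_fiber n i j \<sigma>" by auto
  have lt: "\<sigma> a < n \<longleftrightarrow> a < n" for a using permutes_in_image[OF s, of a] by simp
  have inj: "\<sigma> a = \<sigma> b \<longleftrightarrow> a = b" for a b using permutes_inj[OF s] by (auto dest: injD)
  have "\<exists>!e. e \<in> F \<and> v \<in> e" if v: "v \<in> fiber_vertices n i \<union> fiber_vertices n j" for v
  proof (cases "v \<in> fiber_vertices n i")
    case True
    then obtain a where "v = (i, a)" "a < n" by (auto simp: fiber_vertices_def)
    then show ?thesis using assms by (intro ex1I[of _ "{(i, a), (j, \<sigma> a)}"]) (auto simp: F lift_fiber_def)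
  next
    case False
    then obtain b where b: "v = (j, b)" "b < n" using v by (auto simp: fiber_vertices_def)
    obtain a where a: "\<sigma> a = b" using permutes_surj[OF s] by (metis surjD)
    then show ?thesis using assms b inj lt
      by (intro ex1I[of _ "{(i, a), (j, \<sigma> a)}"]) (auto simp: F lift_fiber_def)
  qed
  moreover have "F \<subseteq> {{x, y} |x y. x \<in> fiber_vertices n i \<and> y \<in> fiber_vertices n j}"
    using lt by (auto simp: F lift_fiber_def fiber_vertices_def)
  ultimately show "F \<in> fibers n {i, j}"
    by (simp add: fibers_eq_bipartite_perfect_matchings bipartite_perfect_matchings_def perfect_matchings_def)
next
  fix F assume "F \<in> fibers n {i, j}"
  then have sub: "F \<subseteq> {{x, y} |x y. x \<in> fiber_vertices n i \<and> y \<in> fiber_vertices n j}"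
    and ex1: "\<And>v. v \<in> fiber_vertices n i \<union> fiber_vertices n j \<Longrightarrow> \<exists>!e. e \<in> F \<and> v \<in> e"
    by (auto simp: fibers_eq_bipartite_perfect_matchings bipartite_perfect_matchings_def perfect_matchings_def)
  have uniq: "e = e'" if "e \<in> F" "e' \<in> F" "v \<in> e" "v \<in> e'" "v \<in> fiber_vertices n i \<union> fiber_vertices n j" for e e' v
    using ex1[OF that(5)] that(1-4) by auto
  have form: "\<exists>a b. a < n \<and> b < n \<and> e = {(i, a), (j, b)}" if "e \<in> F" for e
    using sub that by (fastforce simp: fiber_vertices_def)
  have ex: "\<exists>b<n. {(i, a), (j, b)} \<in> F" if "a < n" for a
  proof -
    obtain e where e: "e \<in> F" "(i, a) \<in> e" using ex1[of "(i, a)"] \<open>a < n\<close> by (auto simp: fiber_vertices_def)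
    then show ?thesis using form[OF e(1)] assms by auto
  qed
  \<comment> \<open>Outside \<open>{..<n}\<close> the map is the identity, as
    \<open>permutes\<close> demands.\<close>
  define \<sigma> where "\<sigma> a = (if a < n then SOME b. b < n \<and> {(i, a), (j, b)} \<in> F else a)" for a
  have s: "\<sigma> a < n \<and> {(i, a), (j, \<sigma> a)} \<in> F" if "a < n" for a
    using someI_ex[OF ex[OF that]] that by (simp add: \<sigma>_def)
  have "inj_on \<sigma> {..<n}"
  proof (rule inj_onI)
    fix a b assume ab: "a \<in> {..<n}" "b \<in> {..<n}" "\<sigma> a = \<sigma> b"
    have "{(i, a), (j, \<sigma> a)} = {(i, b), (j, \<sigma> a)}"
      by (rule uniq[of _ _ "(j, \<sigma> a)"]) (use s[of a] s[of b] ab in \<open>auto simp: fiber_vertices_def\<close>)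
    then show "a = b" using assms by (auto simp: doubleton_eq_iff)
  qed
  moreover have "\<sigma> ` {..<n} \<subseteq> {..<n}" using s by auto
  ultimately have "bij_betw \<sigma> {..<n} {..<n}" by (simp add: bij_betw_def endo_inj_surj)
  then have perm: "\<sigma> permutes {..<n}" by (rule bij_imp_permutes) (auto simp: \<sigma>_def)
  have "F = lift_fiber n i j \<sigma>"
  proof (intro equalityI subsetI)
    fix e assume e: "e \<in> F"
    then obtain a b where ab: "a < n" "b < n" "e = {(i, a), (j, b)}" using form by blast
    have "e = {(i, a), (j, \<sigma> a)}"
      by (rule uniq[of _ _ "(i, a)"]) (use e s[OF ab(1)] ab in \<open>auto simp: fiber_vertices_def\<close>)
    then show "e \<in> lift_fiber n i j \<sigma>" using ab by (auto simp: lift_fiber_def)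
  next
    fix e assume "e \<in> lift_fiber n i j \<sigma>"
    then show "e \<in> F" using s by (auto simp: lift_fiber_def)
  qed
  then show "F \<in> lift_fiber n i j ` {\<sigma>. \<sigma> permutes {..<n}}" using perm by blast
qed

lemma inj_on_lift_fiber:
  assumes "i \<noteq> j"
  shows "inj_on (lift_fiber n i j) {\<sigma>. \<sigma> permutes {..<n}}"
proof (rule inj_onI, rule ext)
  fix \<sigma> \<tau> a assume s: "\<sigma> \<in> {\<sigma>. \<sigma> permutes {..<n}}" and t: "\<tau> \<in> {\<sigma>. \<sigma> permutes {..<n}}"
    and eq: "lift_fiber n i j \<sigma> = lift_fiber n i j \<tau>"
  show "\<sigma> a = \<tau> a"
  proof (cases "a < n")
    case True
    then have "{(i, a), (j, \<sigma> a)} \<in> lift_fiber n i j \<tau>" unfolding eq[symmetric] by (auto simp: lift_fiber_def)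
    then show ?thesis using assms by (auto simp: lift_fiber_def doubleton_eq_iff)
  next
    case False
    then show ?thesis using s t by (simp add: permutes_not_in)
  qed
qed

lemma finite_fibers: "i \<noteq> j \<Longrightarrow> finite (fibers n {i, j})"
  by (simp add: fibers_eq finite_permutations)

lemma fibers_nonempty: "i \<noteq> j \<Longrightarrow> fibers n {i, j} \<noteq> {}"
  by (auto simp: fibers_eq intro!: exI[of _ id] permutes_id)

text \<open>The colour of a lift vertex names the edge of the base graph above which it is matched.
  A fiber \<open>P\<close> over \<open>e\<close> can carry out this prescription iff no pair in it
  has exactly one end of colour \<open>e\<close>.\<close>

definition colour_compatible :: "'e \<Rightarrow> ('a \<Rightarrow> 'e) \<Rightarrow> 'a set set \<Rightarrow> bool" where
  "colour_compatible e c P \<longleftrightarrow> (\<forall>p\<in>P. \<forall>x\<in>p. \<forall>y\<in>p. c x = e \<longrightarrow> c y = e)"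

definition fiber_count :: "nat \<Rightarrow> ('v \<times> nat \<Rightarrow> 'e) \<Rightarrow> 'v \<Rightarrow> 'e \<Rightarrow> nat" where
  "fiber_count n c v e = card {a \<in> {..<n}. c (v, a) = e}"

text \<open>For the fiber of a permutation, compatibility says that the permutation maps the
  \<open>e\<close>-coloured points of one layer onto those of the other. With k points on both
  sides, k! (n - k)! of the n! permutations do so; with unequal numbers none does.\<close>

lemma expectation_colour_compatible:
  assumes "i \<noteq> j"
  shows "measure_pmf.expectation (pmf_of_set (fibers n {i, j})) (\<lambda>P. of_bool (colour_compatible e c P)) =
    (if fiber_count n c i e = fiber_count n c j e
     then fact (fiber_count n c i e) * fact (n - fiber_count n c i e) / fact n else (0::real))"
proof -
  let ?P = "{\<sigma>. \<sigma> permutes {..<n}}"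
  let ?S = "{a \<in> {..<n}. c (i, a) = e}" and ?T = "{a \<in> {..<n}. c (j, a) = e}"
  have cardf: "card (fibers n {i, j}) = fact n"
    using inj_on_lift_fiber[OF assms] by (simp add: fibers_eq[OF assms] card_image card_permutations)
  have iff: "colour_compatible e c (lift_fiber n i j \<sigma>) \<longleftrightarrow> \<sigma> ` ?S = ?T" if s: "\<sigma> permutes {..<n}" for \<sigma>
  proof -
    have lt: "\<sigma> a < n \<longleftrightarrow> a < n" for a using permutes_in_image[OF s, of a] by simp
    have inj: "\<sigma> a = \<sigma> b \<longleftrightarrow> a = b" for a b using permutes_inj[OF s] by (auto dest: injD)
    have "colour_compatible e c (lift_fiber n i j \<sigma>) \<longleftrightarrow> (\<forall>a<n. c (i, a) = e \<longleftrightarrow> c (j, \<sigma> a) = e)"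
      by (auto simp: colour_compatible_def lift_fiber_def)
    also have "\<dots> \<longleftrightarrow> \<sigma> ` ?S = ?T"
    proof
      assume *: "\<forall>a<n. c (i, a) = e \<longleftrightarrow> c (j, \<sigma> a) = e"
      show "\<sigma> ` ?S = ?T"
      proof (intro equalityI subsetI)
        fix b assume b: "b \<in> ?T"
        obtain a where "\<sigma> a = b" using permutes_surj[OF s] by (metis surjD)
        then show "b \<in> \<sigma> ` ?S" using b * lt by auto
      qed (use * lt in auto)
    next
      assume *: "\<sigma> ` ?S = ?T"
      show "\<forall>a<n. c (i, a) = e \<longleftrightarrow> c (j, \<sigma> a) = e"
      proof (intro allI impI iffI)
        fix a assume "a < n" "c (i, a) = e"
        then have "\<sigma> a \<in> \<sigma> ` ?S" by auto
        then show "c (j, \<sigma> a) = e" unfolding * by simp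
      next
        fix a assume "a < n" "c (j, \<sigma> a) = e"
        then have "\<sigma> a \<in> \<sigma> ` ?S" unfolding * using lt by simp
        then show "c (i, a) = e" using inj by auto
      qed
    qed
    finally show ?thesis .
  qed
  have "measure_pmf.expectation (pmf_of_set (fibers n {i, j})) (\<lambda>P. of_bool (colour_compatible e c P)) =
     (\<Sum>P\<in>fibers n {i, j}. of_bool (colour_compatible e c P) :: real) / fact n"
    by (simp add: integral_pmf_of_set[OF fibers_nonempty[OF assms] finite_fibers[OF assms]] cardf)
  also have "(\<Sum>P\<in>fibers n {i, j}. of_bool (colour_compatible e c P)) = (\<Sum>\<sigma>\<in>?P. of_bool (\<sigma> ` ?S = ?T) :: real)"
    unfolding fibers_eq[OF assms] by (subst sum.reindex[OF inj_on_lift_fiber[OF assms]]) (simp add: iff)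
  also have "\<dots> = real (card {\<sigma>. \<sigma> permutes {..<n} \<and> \<sigma> ` ?S = ?T})"
    by (simp add: finite_permutations Int_def)
  also have "\<dots> = (if fiber_count n c i e = fiber_count n c j e
     then fact (fiber_count n c i e) * fact (n - fiber_count n c i e) else (0::real))"
    by (subst card_permutes_image) (auto simp: fiber_count_def)
  finally show ?thesis by simp
qed

text \<open>A matching determines the colouring \<open>col M\<close>. Conversely, a vertex
  \<open>x\<close> of colour \<open>e\<close> lies in exactly one pair of \<open>F e\<close>, and
  compatibility gives the other end of this pair the same colour, so the monochromatic pairs cover
  each vertex exactly once.\<close>

lemma num_perfect_matchings_eq_card_colourings:
  fixes V :: "'v set" and E :: "'e set"
  assumes G: "loopless_multigraph V E ends" and F: "\<And>e. e \<in> E \<Longrightarrow> F e \<in> fibers n (ends e)"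
  shows "num_perfect_matchings n V E F =
    card {c \<in> (\<Pi>\<^sub>E x\<in>lift_vertices n V. {e \<in> E. fst x \<in> ends e}). \<forall>e\<in>E. colour_compatible e c (F e)}"
proof -
  let ?LV = "lift_vertices n V"
  let ?C = "{c \<in> (\<Pi>\<^sub>E x\<in>?LV. {e \<in> E. fst x \<in> ends e}). \<forall>e\<in>E. colour_compatible e c (F e)}"
  have LV: "x \<in> ?LV \<longleftrightarrow> fst x \<in> V \<and> snd x < n" for x :: "'v \<times> nat"
    by (cases x) (auto simp: lift_vertices_def fiber_vertices_def)
  have FV: "x \<in> fiber_vertices n i \<longleftrightarrow> fst x = i \<and> snd x < n" for x and i :: 'v
    by (cases x) (auto simp: fiber_vertices_def)
  have uniq: "\<exists>!p. p \<in> F e \<and> x \<in> p" if e: "e \<in> E" and x: "x \<in> ?LV" "fst x \<in> ends e" for e x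
  proof -
    obtain i j where ij: "ends e = {i, j}" "F e \<in> bipartite_perfect_matchings (fiber_vertices n i) (fiber_vertices n j)"
      using F[OF e] unfolding fibers_def by blast
    have "x \<in> fiber_vertices n i \<union> fiber_vertices n j"
      using x ij(1) by (auto simp: LV FV)
    with ij(2) show ?thesis
      unfolding bipartite_perfect_matchings_def perfect_matchings_def mem_Collect_eq by (metis (no_types, lifting))
  qed
  have mem: "x \<in> ?LV \<and> fst x \<in> ends e" if e: "e \<in> E" and that': "p \<in> F e" "x \<in> p" for e p x
  proof -
    obtain i j where ij: "ends e = {i, j}" "F e \<in> bipartite_perfect_matchings (fiber_vertices n i) (fiber_vertices n j)"
      using F[OF e] by (auto simp: fibers_def)
    then have "{i, j} \<subseteq> V" using G e by (auto simp: loopless_multigraph_def)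
    then show ?thesis using ij e that'
      by (auto simp: bipartite_perfect_matchings_def perfect_matchings_def lift_vertices_def fiber_vertices_def)
  qed
  \<comment> \<open>A member of the pair reveals, through its colour, the edge above which the pair
    lies; this recovers \<open>M\<close> from \<open>col M\<close>.\<close>
  have ne: "p \<noteq> {}" if "e \<in> E" "p \<in> F e" for e p
    using F[OF that(1)] that(2) by (auto simp: fibers_def bipartite_perfect_matchings_def perfect_matchings_def)
  define q where "q M x = (THE r. r \<in> M \<and> x \<in> snd r)" for M :: "('e \<times> ('v \<times> nat) set) set" and x
  have q: "q M x \<in> M \<and> x \<in> snd (q M x)" and q_eq: "r \<in> M \<Longrightarrow> x \<in> snd r \<Longrightarrow> q M x = r"
    if "M \<in> perfect_matchings ?LV (lift_edges E F) snd" "x \<in> ?LV" for M x r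
  proof -
    have "\<exists>!r. r \<in> M \<and> x \<in> snd r" using that by (auto simp: perfect_matchings_def)
    then show "q M x \<in> M \<and> x \<in> snd (q M x)" "r \<in> M \<Longrightarrow> x \<in> snd r \<Longrightarrow> q M x = r"
      unfolding q_def by (rule theI', auto intro!: the1_equality)
  qed
  have edge: "fst r \<in> E \<and> snd r \<in> F (fst r)" if "M \<in> perfect_matchings ?LV (lift_edges E F) snd" "r \<in> M" for M r
    using that by (auto simp: perfect_matchings_def lift_edges_def)
  define col where "col M = (\<lambda>x\<in>?LV. fst (q M x))" for M
  \<comment> \<open>The inverse of \<open>col\<close>: keep the pairs all of whose ends carry the
    colour of their own edge.\<close>
  define mat where "mat c = {(e, p). e \<in> E \<and> p \<in> F e \<and> (\<forall>x\<in>p. c x = e)}" for c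
  have col: "col M \<in> ?C" if M: "M \<in> perfect_matchings ?LV (lift_edges E F) snd" for M
  proof -
    have "fst (q M x) \<in> {e \<in> E. fst x \<in> ends e}" if "x \<in> ?LV" for x
      using q[OF M that] edge[OF M] mem by blast
    moreover have "colour_compatible e (col M) (F e)" if e: "e \<in> E" for e
      unfolding colour_compatible_def
    proof (intro ballI impI)
      fix p x y assume p: "p \<in> F e" "x \<in> p" "y \<in> p" "col M x = e"
      have xy: "x \<in> ?LV" "y \<in> ?LV" "fst x \<in> ends e" using mem[OF e p(1)] p by auto
      have "snd (q M x) = p"
        using uniq[OF e xy(1,3)] q[OF M xy(1)] edge[OF M, of "q M x"] p xy(1) by (auto simp: col_def)
      then have "q M y = q M x" using q_eq[OF M xy(2)] q[OF M xy(1)] p by auto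
      then show "col M y = e" using p xy by (simp add: col_def)
    qed
    ultimately show ?thesis by (auto simp: col_def)
  qed
  have mat_ex1: "\<exists>!r. r \<in> mat c \<and> x \<in> snd r" "x \<in> ?LV \<Longrightarrow> r \<in> mat c \<Longrightarrow> x \<in> snd r \<Longrightarrow> fst r = c x" 
    if c: "c \<in> ?C" and x: "x \<in> ?LV" for c x r
  proof -
    obtain e where e: "c x = e" by simp
    have "c x \<in> {e \<in> E. fst x \<in> ends e}" using c x by (blast dest: PiE_mem)
    then have cx: "e \<in> E" "fst x \<in> ends e" by (auto simp: e)
    obtain p where p: "p \<in> F e" "x \<in> p" and pu: "\<And>p'. p' \<in> F e \<Longrightarrow> x \<in> p' \<Longrightarrow> p' = p"
      using uniq[OF cx(1) x cx(2)] by blast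
    have "colour_compatible e c (F e)" using c cx(1) by blast
    then have "\<forall>y\<in>p. c y = e" using p e unfolding colour_compatible_def by blast
    then have "(e, p) \<in> mat c \<and> x \<in> snd (e, p)" using cx p by (simp add: mat_def)
    moreover have "r = (e, p)" if "r \<in> mat c \<and> x \<in> snd r" for r
    proof -
      obtain e' p' where r: "r = (e', p')" by (cases r)
      then have "e' = e" "p' \<in> F e'" "x \<in> p'" using that e by (auto simp: mat_def)
      then show ?thesis using pu r by blast
    qed
    ultimately show "\<exists>!r. r \<in> mat c \<and> x \<in> snd r" by (rule ex1I)
    show "x \<in> ?LV \<Longrightarrow> r \<in> mat c \<Longrightarrow> x \<in> snd r \<Longrightarrow> fst r = c x" by (auto simp: mat_def)
  qed
  have mat: "mat c \<in> perfect_matchings ?LV (lift_edges E F) snd" if c: "c \<in> ?C" for c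
    unfolding perfect_matchings_def using mat_ex1(1)[OF c] by (auto simp: mat_def lift_edges_def)
  have "bij_betw col (perfect_matchings ?LV (lift_edges E F) snd) ?C"
  proof (rule bij_betw_byWitness[where f' = mat])
    show "\<forall>M\<in>perfect_matchings ?LV (lift_edges E F) snd. mat (col M) = M"
    proof
      fix M assume M: "M \<in> perfect_matchings ?LV (lift_edges E F) snd"
      show "mat (col M) = M"
      proof (intro equalityI subsetI)
        fix r assume "r \<in> mat (col M)"
        then obtain e p where r: "r = (e, p)" "e \<in> E" "p \<in> F e" "\<forall>x\<in>p. col M x = e" by (auto simp: mat_def)
        obtain x where x: "x \<in> p" using ne r by blast
        have xV: "x \<in> ?LV" "fst x \<in> ends e" using mem r x by auto
        have "fst (q M x) = e" using r x xV by (auto simp: col_def)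
        moreover have "snd (q M x) = p"
          using uniq[OF r(2) xV] q[OF M xV(1)] edge[OF M, of "q M x"] r x calculation by auto
        ultimately have "q M x = r" using r by (auto simp: prod_eq_iff)
        then show "r \<in> M" using q[OF M xV(1)] by auto
      next
        fix r assume r: "r \<in> M"
        have "col M x = fst r" if "x \<in> snd r" for x
          using q_eq[OF M _ r that] mem[of "fst r" "snd r" x] that edge[OF M r] by (simp add: col_def)
        then show "r \<in> mat (col M)" using edge[OF M r] by (auto simp: mat_def)
      qed
    qed
    show "\<forall>c\<in>?C. col (mat c) = c"
    proof
      fix c assume c: "c \<in> ?C"
      have "fst (q (mat c) x) = c x" if "x \<in> ?LV" for x
        using q[OF mat[OF c] that] mat_ex1(2)[OF c that that] by blast
      then show "col (mat c) = c" using c by (auto simp: col_def fun_eq_iff PiE_def extensional_def)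
    qed
  qed (use col mat in auto)
  then show ?thesis unfolding num_perfect_matchings_def by (rule bij_betw_same_card)
qed

text \<open>The prescribed counts constrain each layer separately, so the number is a product over
  the vertices of multinomial coefficients. Each factorial of \<open>m e\<close> appears at both
  endpoints of \<open>e\<close>, whence the square.\<close>

lemma card_colourings_with_counts:
  assumes G: "loopless_multigraph V E ends"
    and m: "\<And>v. v \<in> V \<Longrightarrow> (\<Sum>e | e \<in> E \<and> v \<in> ends e. m e) = n"
  shows "real (card {c \<in> (\<Pi>\<^sub>E x\<in>lift_vertices n V. {e \<in> E. fst x \<in> ends e}).
       \<forall>e\<in>E. \<forall>v\<in>ends e. fiber_count n c v e = m e}) = fact n ^ card V / (\<Prod>e\<in>E. fact (m e) ^ 2)"
proof -
  have fin: "finite V" "finite E" and sub: "\<And>e. e \<in> E \<Longrightarrow> ends e \<subseteq> V" and c2: "\<And>e. e \<in> E \<Longrightarrow> card (ends e) = 2"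
    using G by (auto simp: loopless_multigraph_def)
  let ?Ev = "\<lambda>v. {e \<in> E. v \<in> ends e}"
  let ?C = "{c \<in> (\<Pi>\<^sub>E x\<in>lift_vertices n V. ?Ev (fst x)). \<forall>e\<in>E. \<forall>v\<in>ends e. fiber_count n c v e = m e}"
  let ?D = "\<lambda>v. {f \<in> {..<n} \<rightarrow>\<^sub>E ?Ev v. \<forall>e\<in>?Ev v. card {a \<in> {..<n}. f a = e} = m e}"
  have LV: "x \<in> lift_vertices n V \<longleftrightarrow> fst x \<in> V \<and> snd x < n" for x
    by (cases x) (auto simp: lift_vertices_def fiber_vertices_def)
  have "bij_betw (\<lambda>c. \<lambda>v\<in>V. \<lambda>a\<in>{..<n}. c (v, a)) ?C (Pi\<^sub>E V ?D)"
  proof (rule bij_betw_byWitness[where f' = "\<lambda>h. \<lambda>x\<in>lift_vertices n V. h (fst x) (snd x)"])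
    show "\<forall>c\<in>?C. (\<lambda>x\<in>lift_vertices n V. (\<lambda>v\<in>V. \<lambda>a\<in>{..<n}. c (v, a)) (fst x) (snd x)) = c"
      by (auto simp: fun_eq_iff PiE_def extensional_def LV)
    show "\<forall>h\<in>Pi\<^sub>E V ?D. (\<lambda>v\<in>V. \<lambda>a\<in>{..<n}. (\<lambda>x\<in>lift_vertices n V. h (fst x) (snd x)) (v, a)) = h"
      by (auto simp: fun_eq_iff PiE_def Pi_def extensional_def LV restrict_def)
    show "(\<lambda>c. \<lambda>v\<in>V. \<lambda>a\<in>{..<n}. c (v, a)) ` ?C \<subseteq> Pi\<^sub>E V ?D"
    proof clarify
      fix c assume c: "c \<in> (\<Pi>\<^sub>E x\<in>lift_vertices n V. ?Ev (fst x))" 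
        and k: "\<forall>e\<in>E. \<forall>v\<in>ends e. fiber_count n c v e = m e"
      have "(\<lambda>a\<in>{..<n}. c (v, a)) \<in> ?D v" if v: "v \<in> V" for v
      proof -
        have "{a \<in> {..<n}. (\<lambda>a\<in>{..<n}. c (v, a)) a = e} = {a \<in> {..<n}. c (v, a) = e}" for e by auto
        moreover have "c (v, a) \<in> ?Ev v" if "a < n" for a using PiE_mem[OF c, of "(v, a)"] v that by (auto simp: LV)
        ultimately show ?thesis using k by (auto simp: fiber_count_def)
      qed
      then show "(\<lambda>v\<in>V. \<lambda>a\<in>{..<n}. c (v, a)) \<in> Pi\<^sub>E V ?D" by (simp add: restrict_PiE_iff)
    qed
    show "(\<lambda>h. \<lambda>x\<in>lift_vertices n V. h (fst x) (snd x)) ` Pi\<^sub>E V ?D \<subseteq> ?C"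
    proof (rule image_subsetI)
      fix h assume h: "h \<in> Pi\<^sub>E V ?D"
      have hv: "h v \<in> ?D v" if "v \<in> V" for v using PiE_mem[OF h that] .
      let ?c = "\<lambda>x\<in>lift_vertices n V. h (fst x) (snd x)"
      have "h (fst x) (snd x) \<in> ?Ev (fst x)" if "x \<in> lift_vertices n V" for x
        using hv[of "fst x"] that unfolding LV by (auto simp: PiE_def Pi_def)
      then have "?c \<in> (\<Pi>\<^sub>E x\<in>lift_vertices n V. ?Ev (fst x))" by (simp add: restrict_PiE_iff)
      moreover have "fiber_count n ?c v e = m e" if "e \<in> E" "v \<in> ends e" for e v
      proof -
        have v: "v \<in> V" using sub that by auto
        then have "{a \<in> {..<n}. ?c (v, a) = e} = {a \<in> {..<n}. h v a = e}" by (auto simp: LV)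
        then show ?thesis using hv[OF v] that by (auto simp: fiber_count_def)
      qed
      ultimately show "?c \<in> ?C" by simp
    qed
  qed
  then have "card ?C = card (Pi\<^sub>E V ?D)" by (rule bij_betw_same_card)
  also have "\<dots> = (\<Prod>v\<in>V. card (?D v))" using fin by (simp add: card_PiE)
  finally have "real (card ?C) = (\<Prod>v\<in>V. real (card (?D v)))" by simp
  also have "\<dots> = (\<Prod>v\<in>V. fact n / (\<Prod>e\<in>?Ev v. fact (m e)))"
  proof (rule prod.cong[OF refl])
    fix v assume "v \<in> V"
    then have "card (?D v) * (\<Prod>e\<in>?Ev v. fact (m e)) = fact (card {..<n})"
      using fin m by (intro card_funcs_with_fibre_sizes) auto
    then have "real (card (?D v) * (\<Prod>e\<in>?Ev v. fact (m e))) = real (fact n)" by simp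
    then have "real (card (?D v)) * (\<Prod>e\<in>?Ev v. fact (m e)) = fact n" by (simp only: of_nat_mult of_nat_prod of_nat_fact)
    moreover have "(\<Prod>e\<in>?Ev v. fact (m e) :: real) \<noteq> 0" using fin by simp
    ultimately show "real (card (?D v)) = fact n / (\<Prod>e\<in>?Ev v. fact (m e))" by (simp add: field_simps)
  qed
  also have "\<dots> = fact n ^ card V / (\<Prod>v\<in>V. \<Prod>e\<in>?Ev v. fact (m e))" by (simp add: prod_dividef)
  also have "(\<Prod>v\<in>V. \<Prod>e\<in>?Ev v. fact (m e)) = (\<Prod>e\<in>E. \<Prod>v\<in>{v \<in> V. v \<in> ends e}. fact (m e) :: real)"
    using fin by (rule prod.swap_restrict)
  also have "\<dots> = (\<Prod>e\<in>E. fact (m e) ^ 2)"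
  proof (rule prod.cong[OF refl])
    fix e assume "e \<in> E"
    then have "{v \<in> V. v \<in> ends e} = ends e" using sub by auto
    then show "(\<Prod>v\<in>{v \<in> V. v \<in> ends e}. fact (m e) :: real) = fact (m e) ^ 2" using c2[OF \<open>e \<in> E\<close>] by simp
  qed
  finally show ?thesis .
qed

text \<open>The integral points among the multiples n f of the fractional perfect matchings f; the
  extensional function space makes the set finite.\<close>

definition balanced_weights :: "nat \<Rightarrow> 'v set \<Rightarrow> 'e set \<Rightarrow> ('e \<Rightarrow> 'v set) \<Rightarrow> ('e \<Rightarrow> nat) set" where
  "balanced_weights n V E ends =
     {m \<in> E \<rightarrow>\<^sub>E {..n}. \<forall>v\<in>V. (\<Sum>e | e \<in> E \<and> v \<in> ends e. m e) = n}"

text \<open>Linearity over colourings and independence of the fibers give a product of probabilities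
  for each colouring. This product depends only on the numbers of vertices of each colour per layer,
  so the colourings are grouped by these numbers and each group is counted.\<close>

lemma expected_perfect_matchings_eq:
  assumes G: "loopless_multigraph V E ends"
  shows "expected_perfect_matchings V E ends n =
    fact n ^ card V * (\<Sum>m\<in>balanced_weights n V E ends. \<Prod>e\<in>E. fact (n - m e) / (fact (m e) * fact n))"
proof -
  have fin: "finite V" "finite E" and sub: "\<And>e. e \<in> E \<Longrightarrow> ends e \<subseteq> V"
    using G by (auto simp: loopless_multigraph_def)
  have ends2: "\<exists>i j. i \<noteq> j \<and> ends e = {i, j}" if "e \<in> E" for e
    using G that unfolding loopless_multigraph_def card_2_iff by blast
  let ?C0 = "\<Pi>\<^sub>E x\<in>lift_vertices n V. {e \<in> E. fst x \<in> ends e}"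
  let ?M = "balanced_weights n V E ends"
  let ?typ = "\<lambda>c m. \<forall>e\<in>E. \<forall>v\<in>ends e. fiber_count n c v e = m e"
  let ?p = "\<lambda>e. pmf_of_set (fibers n (ends e))"
  let ?w = "\<lambda>m. \<Prod>e\<in>E. fact (m e) * fact (n - m e) / fact n :: real"
  have finLV: "finite (lift_vertices n V)" using fin by (auto simp: lift_vertices_def fiber_vertices_def)
  have finC0: "finite ?C0" using fin finLV by (intro finite_PiE) auto
  have finM: "finite ?M" unfolding balanced_weights_def
    by (rule finite_subset[of _ "E \<rightarrow>\<^sub>E {..n}"]) (use fin in \<open>auto intro: finite_PiE\<close>)
  have fib: "finite (fibers n (ends e))" "fibers n (ends e) \<noteq> {}" if "e \<in> E" for e
    using ends2[OF that] finite_fibers fibers_nonempty by metis+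
  have finsup: "finite (set_pmf (?p e))" if "e \<in> E" for e using fib[OF that] by simp
  have "expected_perfect_matchings V E ends n =
    measure_pmf.expectation (random_lift n E ends) (\<lambda>F. \<Sum>c\<in>?C0. \<Prod>e\<in>E. of_bool (colour_compatible e c (F e)))"
    unfolding expected_perfect_matchings_def
  proof (rule integral_cong_AE)
    have "real (num_perfect_matchings n V E F) = (\<Sum>c\<in>?C0. \<Prod>e\<in>E. of_bool (colour_compatible e c (F e)))"
      if "F \<in> set_pmf (random_lift n E ends)" for F
    proof -
      have "F e \<in> fibers n (ends e)" if e: "e \<in> E" for e
      proof -
        have "F e \<in> set_pmf (?p e)"
          using \<open>F \<in> _\<close> e fin by (auto simp: random_lift_def set_Pi_pmf PiE_dflt_def)
        then show ?thesis using set_pmf_of_set[OF fib(2)[OF e] fib(1)[OF e]] by simp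
      qed
      then have "num_perfect_matchings n V E F = card {c \<in> ?C0. \<forall>e\<in>E. colour_compatible e c (F e)}"
        by (rule num_perfect_matchings_eq_card_colourings[OF G])
      also have "real \<dots> = (\<Sum>c\<in>?C0. of_bool (\<forall>e\<in>E. colour_compatible e c (F e)))"
        using finC0 by (simp add: Int_def)
      also have "\<dots> = (\<Sum>c\<in>?C0. \<Prod>e\<in>E. of_bool (colour_compatible e c (F e)))"
        using fin by (intro sum.cong refl) (auto simp: prod_zero_iff)
      finally show ?thesis .
    qed
    then show "AE F in random_lift n E ends. real (num_perfect_matchings n V E F) = (\<Sum>c\<in>?C0. \<Prod>e\<in>E. of_bool (colour_compatible e c (F e)))"
      by (auto intro: AE_pmfI)
  qed auto
  also have "\<dots> = (\<Sum>c\<in>?C0. measure_pmf.expectation (random_lift n E ends) (\<lambda>F. \<Prod>e\<in>E. of_bool (colour_compatible e c (F e))))"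
    by (intro Bochner_Integration.integral_sum measure_pmf.integrable_const_bound[where B = 1])
       (auto intro!: AE_pmfI prod_le_1 simp: abs_prod)
  also have "\<dots> = (\<Sum>c\<in>?C0. \<Prod>e\<in>E. measure_pmf.expectation (?p e) (\<lambda>P. of_bool (colour_compatible e c P)))"
    unfolding random_lift_def using fin finsup
    by (intro sum.cong refl expectation_prod_Pi_pmf) (auto intro: integrable_measure_pmf_finite)
  \<comment> \<open>A colouring has at most one type \<open>m\<close>, namely its colour counts when
    these agree at both ends of every edge. If they disagree at some edge, the factor of that edge
    is zero.\<close>
  also have "\<dots> = (\<Sum>c\<in>?C0. \<Sum>m\<in>?M. of_bool (?typ c m) * ?w m)"
  proof (rule sum.cong[OF refl])
    fix c assume c: "c \<in> ?C0"
    show "(\<Prod>e\<in>E. measure_pmf.expectation (?p e) (\<lambda>P. of_bool (colour_compatible e c P))) = (\<Sum>m\<in>?M. of_bool (?typ c m) * ?w m)"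
    proof (cases "\<exists>m. ?typ c m")
      case False
      then have zero: "(\<Sum>m\<in>?M. of_bool (?typ c m) * ?w m) = 0" by (auto intro!: sum.neutral)
      have "\<exists>e\<in>E. \<nexists>k. \<forall>v\<in>ends e. fiber_count n c v e = k"
      proof (rule ccontr)
        assume "\<not> ?thesis"
        then have "\<forall>e\<in>E. \<exists>k. \<forall>v\<in>ends e. fiber_count n c v e = k" by blast
        then have "\<exists>m. \<forall>e\<in>E. \<forall>v\<in>ends e. fiber_count n c v e = m e" by (rule bchoice)
        then show False using False by blast
      qed
      then obtain e where e: "e \<in> E" "\<nexists>k. \<forall>v\<in>ends e. fiber_count n c v e = k" by blast
      obtain i j where ij: "i \<noteq> j" "ends e = {i, j}" using ends2[OF e(1)] by blast
      then have "fiber_count n c i e \<noteq> fiber_count n c j e" using e by auto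
      then have "measure_pmf.expectation (?p e) (\<lambda>P. of_bool (colour_compatible e c P)) = (0::real)"
        unfolding ij(2) by (simp add: expectation_colour_compatible[OF ij(1)])
      then show ?thesis unfolding zero using fin e(1) by (auto intro: prod_zero)
    next
      case True
      then obtain m where "?typ c m" by blast
      then have m: "?typ c (restrict m E)" by simp
      have mM: "restrict m E \<in> ?M"
      proof -
        have "(\<Sum>e | e \<in> E \<and> v \<in> ends e. restrict m E e) = n" if v: "v \<in> V" for v
        proof -
          have "(\<Sum>e | e \<in> E \<and> v \<in> ends e. restrict m E e) = (\<Sum>e | e \<in> E \<and> v \<in> ends e. card {a \<in> {..<n}. c (v, a) = e})"
            using m by (intro sum.cong) (auto simp: fiber_count_def)
          also have "\<dots> = card {..<n}"
          proof (subst card_UN_disjoint[symmetric])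
            have "c (v, a) \<in> {e \<in> E. v \<in> ends e}" if "a < n" for a
              using PiE_mem[OF c, of "(v, a)"] v that by (auto simp: lift_vertices_def fiber_vertices_def)
            then have "(\<Union>e\<in>{e \<in> E. v \<in> ends e}. {a \<in> {..<n}. c (v, a) = e}) = {..<n}" by auto
            then show "card (\<Union>e\<in>{e \<in> E. v \<in> ends e}. {a \<in> {..<n}. c (v, a) = e}) = card {..<n}" by simp
          qed (use fin in auto)
          finally show ?thesis by simp
        qed
        moreover have "m e \<le> n" if e: "e \<in> E" for e
        proof -
          obtain i where "i \<in> ends e" using ends2[OF e] by auto
          then have "m e = fiber_count n c i e" using m e by auto
          also have "\<dots> \<le> card {..<n}" unfolding fiber_count_def by (rule card_mono) auto
          finally show ?thesis by simp
        qed
        ultimately show ?thesis by (auto simp: balanced_weights_def)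
      qed
      have un: "m' = restrict m E" if "m' \<in> ?M" "?typ c m'" for m'
      proof (rule PiE_ext)
        show "m' \<in> E \<rightarrow>\<^sub>E {..n}" "restrict m E \<in> E \<rightarrow>\<^sub>E {..n}" using that(1) mM by (auto simp: balanced_weights_def)
        fix e assume e: "e \<in> E"
        obtain i where "i \<in> ends e" using ends2[OF e] by auto
        then show "m' e = restrict m E e" using m that(2) e by force
      qed
      have "(\<Sum>m\<in>?M. of_bool (?typ c m) * ?w m) = (\<Sum>m'\<in>{restrict m E}. of_bool (?typ c m') * ?w m')"
        by (rule sum.mono_neutral_right) (use finM mM un in auto)
      also have "\<dots> = ?w (restrict m E)" using m by simp
      also have "\<dots> = (\<Prod>e\<in>E. measure_pmf.expectation (?p e) (\<lambda>P. of_bool (colour_compatible e c P)))"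
      proof (rule prod.cong[OF refl])
        fix e assume e: "e \<in> E"
        obtain i j where ij: "i \<noteq> j" "ends e = {i, j}" using ends2[OF e] by blast
        show "fact (restrict m E e) * fact (n - restrict m E e) / (fact n :: real) = measure_pmf.expectation (?p e) (\<lambda>P. of_bool (colour_compatible e c P))"
        proof -
          have "fiber_count n c i e = restrict m E e" "fiber_count n c j e = restrict m E e" using m e ij by auto
          then show ?thesis using expectation_colour_compatible[OF ij(1), of n e c] by (simp add: ij(2))
        qed
      qed
      finally show ?thesis by simp
    qed
  qed
  also have "\<dots> = (\<Sum>m\<in>?M. \<Sum>c\<in>?C0. of_bool (?typ c m) * ?w m)" by (rule sum.swap)
  also have "\<dots> = (\<Sum>m\<in>?M. real (card {c \<in> ?C0. ?typ c m}) * ?w m)"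
    using finC0 by (simp add: sum_distrib_right[symmetric] Int_def)
  also have "\<dots> = (\<Sum>m\<in>?M. fact n ^ card V / (\<Prod>e\<in>E. fact (m e) ^ 2) * ?w m)"
    by (intro sum.cong refl, subst card_colourings_with_counts[OF G]) (auto simp: balanced_weights_def)
  also have "\<dots> = (\<Sum>m\<in>?M. fact n ^ card V * (\<Prod>e\<in>E. fact (n - m e) / (fact (m e) * fact n)))"
  proof (rule sum.cong[OF refl])
    fix m
    have "?w m = (\<Prod>e\<in>E. fact (m e) ^ 2) * (\<Prod>e\<in>E. fact (n - m e) / (fact (m e) * fact n))"
      unfolding prod.distrib[symmetric] by (intro prod.cong refl) (simp add: power2_eq_square)
    moreover have "(\<Prod>e\<in>E. fact (m e) ^ 2 :: real) \<noteq> 0" using fin by simp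
    ultimately show "fact n ^ card V / (\<Prod>e\<in>E. fact (m e) ^ 2) * ?w m = fact n ^ card V * (\<Prod>e\<in>E. fact (n - m e) / (fact (m e) * fact n))"
      by simp
  qed
  finally show ?thesis by (simp add: sum_distrib_left)
qed

section \<open>The Bethe entropy on the simplex\<close>

text \<open>The rate, per unit of n, of the logarithm of an edge factor at m = n x, apart from terms
  linear in x and terms of lower order. At 0 and 1 the products vanish, in agreement with the
  continuous extension.\<close>

definition bethe :: "real \<Rightarrow> real" where
  "bethe x = (1 - x) * ln (1 - x) - x * ln x"

lemma continuous_on_x_ln_x: "continuous_on {0..} (\<lambda>x::real. x * ln x)"
proof -
  have "continuous (at x within {0..}) (\<lambda>x::real. x * ln x)" if "x \<ge> 0" for x
  proof (cases "x = 0")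
    case True
    have "((\<lambda>x::real. x * ln x) \<longlongrightarrow> 0) (at_right 0)" by real_asymp
    then have "((\<lambda>x::real. x * ln x) \<longlongrightarrow> 0) (at 0 within {0..})"
      by (simp add: at_within_Ici_at_right)
    then show ?thesis using True by (simp add: continuous_within)
  next
    case False
    then show ?thesis using that by (intro continuous_intros) auto
  qed
  then show ?thesis by (simp add: continuous_on_eq_continuous_within)
qed

lemma continuous_on_bethe: "continuous_on {0..1} bethe"
proof -
  have "continuous_on {0..1} (\<lambda>x::real. (1 - x) * ln (1 - x))"
    by (rule continuous_on_compose2[OF continuous_on_x_ln_x, of _ "\<lambda>x. 1 - x"]) (auto intro: continuous_intros)
  moreover have "continuous_on {0..1} (\<lambda>x::real. x * ln x)"
    by (rule continuous_on_subset[OF continuous_on_x_ln_x]) auto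
  ultimately show ?thesis unfolding bethe_def by (intro continuous_on_diff)
qed

lemma bethe_has_derivative:
  assumes "0 < x" "x < 1"
  shows "(bethe has_real_derivative - ln (x * (1 - x)) - 2) (at x)"
proof -
  have "ln (x * (1 - x)) = ln x + ln (1 - x)" using assms by (simp add: ln_mult)
  then show ?thesis
    unfolding bethe_def[abs_def] using assms by (auto intro!: derivative_eq_intros)
qed

text \<open>The derivative -ln (x (1 - x)) - 2 decreases on [0, 1/2], so \<open>bethe\<close> lies
  below its tangents there. \<open>T\<close> is the tangent at \<open>b\<close> minus
  \<open>bethe\<close>, up to a constant, and is minimal at \<open>b\<close>.\<close>

lemma bethe_le_tangent:
  assumes b: "0 < b" "b \<le> 1/2" and x: "0 \<le> x" "x \<le> 1/2"
  shows "bethe x \<le> bethe b + (- ln (b * (1 - b)) - 2) * (x - b)"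
proof -
  define T where "T x = (- ln (b * (1 - b)) - 2) * (x - b) - bethe x" for x
  have der: "(T has_real_derivative ln (x * (1 - x)) - ln (b * (1 - b))) (at x)" if "0 < x" "x < 1" for x
    unfolding T_def[abs_def] using that by (auto intro!: derivative_eq_intros bethe_has_derivative)
  have mono: "u * (1 - u) \<le> v * (1 - v)" if "u \<le> v" "v \<le> 1/2" for u v :: real
  proof -
    have "0 \<le> (v - u) * (1 - u - v)" using that by (intro mult_nonneg_nonneg) auto
    then show ?thesis by (simp add: algebra_simps)
  qed
  have contT: "continuous_on {0..1} T" unfolding T_def by (intro continuous_intros continuous_on_bethe)
  have "T b \<le> T x"
  proof (cases "x \<le> b")
    case True
    have "- T x \<le> - T b"
    proof (rule DERIV_nonneg_imp_increasing_open[OF True])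
      fix u assume u: "x < u" "u < b"
      then have "0 < u" "u < 1" using b x by auto
      moreover have "ln (u * (1 - u)) \<le> ln (b * (1 - b))"
        using mono[of u b] u b x by (subst ln_le_cancel_iff) auto
      ultimately show "\<exists>y. ((\<lambda>x. - T x) has_real_derivative y) (at u) \<and> 0 \<le> y"
        by (intro exI[of _ "- (ln (u * (1 - u)) - ln (b * (1 - b)))"] conjI DERIV_minus der) auto
    qed (use contT b x in \<open>auto intro!: continuous_on_minus elim: continuous_on_subset\<close>)
    then show ?thesis by simp
  next
    case False
    then have "b \<le> x" by simp
    then show ?thesis
    proof (rule DERIV_nonneg_imp_increasing_open)
      fix u assume u: "b < u" "u < x"
      then have "0 < u" "u < 1" using b x by auto
      moreover have "ln (b * (1 - b)) \<le> ln (u * (1 - u))"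
        using mono[of b u] u b x by (subst ln_le_cancel_iff) auto
      ultimately show "\<exists>y. (T has_real_derivative y) (at u) \<and> 0 \<le> y"
        by (intro exI[of _ "ln (u * (1 - u)) - ln (b * (1 - b))"] conjI der) auto
    qed (use contT b x in \<open>auto elim: continuous_on_subset\<close>)
  qed
  then show ?thesis by (simp add: T_def)
qed

text \<open>This is the entropy of the point of the simplex with one coordinate 1 - y and d - 1
  equal ones. The restriction on y says that the single coordinate is at least 1/d.\<close>

lemma bethe_two_level:
  fixes d :: nat and y :: real
  assumes d: "d \<ge> 3" and y: "0 \<le> y" "y \<le> 1 - 1 / d"
  shows "bethe (1 - y) + (real d - 1) * bethe (y / (real d - 1)) \<le> d * bethe (1 / d) - (1 - 1 / d - y)\<^sup>2 / 4"
proof -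
  define r where "r = real d"
  have r: "r \<ge> 3" using d by (simp add: r_def)
  define ys where "ys = 1 - 1 / r"
  have ys: "0 < ys" "ys < 1" "ys / (r - 1) = 1 / r" "1 - ys = 1 / r" using r by (auto simp: ys_def field_simps)
  \<comment> \<open>The quadratic deficit is added to the entropy, so that monotonicity of
    \<open>K\<close> up to the uniform point \<open>ys\<close> yields the maximum together with a
    rate.\<close>
  define K where "K y = bethe (1 - y) + (r - 1) * bethe (y / (r - 1)) + (y - ys)\<^sup>2 / 4" for y
  have "K y \<le> K ys"
  proof (rule DERIV_nonneg_imp_increasing_open[where f = K])
    show "y \<le> ys" using y by (simp add: ys_def r_def)
    have "continuous_on {0..1} (\<lambda>y. bethe (1 - y))"
      by (rule continuous_on_compose2[OF continuous_on_bethe, of _ "\<lambda>x. 1 - x"]) (auto intro: continuous_intros)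
    moreover have "continuous_on {0..1} (\<lambda>y. bethe (y / (r - 1)))"
      by (rule continuous_on_compose2[OF continuous_on_bethe, of _ "\<lambda>y. y / (r - 1)"])
         (use r in \<open>auto intro!: continuous_intros simp: field_simps\<close>)
    ultimately have "continuous_on {0..1} K" unfolding K_def by (intro continuous_intros) auto
    then show "continuous_on {y..ys} K" using y ys by (auto elim: continuous_on_subset)
    fix u assume "y < u" "u < ys"
    then have u: "0 < u" "u < ys" "u < 1" using y ys by auto
    define b where "b = u / (r - 1)"
    have b: "0 < b" "b < 1" using u r by (auto simp: b_def field_simps)
    have D: "(K has_real_derivative (ln (u * (1 - u)) - ln (b * (1 - b)) + (u - ys) / 2)) (at u)"
    proof -
      have D1: "((\<lambda>y. bethe (1 - y)) has_real_derivative (- ln ((1 - u) * (1 - (1 - u))) - 2) * (- 1)) (at u)"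
        by (rule DERIV_chain2[OF bethe_has_derivative]) (use u in \<open>auto intro!: derivative_eq_intros\<close>)
      have D2: "((\<lambda>y. bethe (y / (r - 1))) has_real_derivative (- ln (b * (1 - b)) - 2) * (1 / (r - 1))) (at u)"
        by (rule DERIV_chain2[where f = bethe and g = "\<lambda>y. y / (r - 1)"])
           (use b r in \<open>auto intro!: derivative_eq_intros bethe_has_derivative simp: b_def[symmetric]\<close>)
      have D3: "((\<lambda>y. (y - ys)\<^sup>2 / 4) has_real_derivative (u - ys) / 2) (at u)"
        by (auto intro!: derivative_eq_intros)
      show ?thesis
        unfolding K_def[abs_def]
        by (rule DERIV_cong[OF DERIV_add[OF DERIV_add[OF D1 DERIV_cmult[OF D2]] D3]])
           (use r in \<open>simp add: mult.commute field_simps\<close>)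
    qed
    define z where "z = (1 - u) * (r - 1)\<^sup>2 / (r - 1 - u)"
    have pos: "r - 1 - u > 0" "(1 - u) * (r - 1)\<^sup>2 > 0" using u r by auto
    have z: "z > 0" unfolding z_def using pos by simp
    have "ln (u * (1 - u)) - ln (b * (1 - b)) = ln (u * (1 - u) / (b * (1 - b)))"
      using u b by (subst ln_div) auto
    also have "u * (1 - u) / (b * (1 - b)) = z"
    proof -
      have "1 - b = (r - 1 - u) / (r - 1)" using r by (simp add: b_def field_simps)
      then have "u * (1 - u) / (b * (1 - b)) = u * (1 - u) / (u / (r - 1) * ((r - 1 - u) / (r - 1)))"
        by (simp add: b_def)
      also have "\<dots> = z"
      proof -
        have "u * v / (u / q * (w / q)) = v * q\<^sup>2 / w" if "q \<noteq> 0" "w \<noteq> 0" for v q w :: real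
          using that u(1) by (simp add: power2_eq_square)
        from this[of "r - 1" "r - 1 - u" "1 - u"] show ?thesis using r pos by (simp add: z_def)
      qed
      finally show ?thesis .
    qed
    \<comment> \<open>This replaces the logarithm by a rational function whose numerator has the
      factor \<open>ys - u\<close>, which can absorb the linear term coming from the
      deficit.\<close>
    also have "ln z \<ge> 1 - 1 / z"
      using ln_le_minus_one[of "1 / z"] z by (simp add: ln_div)
    also have "1 - 1 / z = r * (r - 2) * (ys - u) / ((1 - u) * (r - 1)\<^sup>2)"
    proof -
      have "1 - 1 / z = ((1 - u) * (r - 1)\<^sup>2 - (r - 1 - u)) / ((1 - u) * (r - 1)\<^sup>2)"
        using pos u r by (simp add: z_def diff_divide_distrib)
      also have "(1 - u) * (r - 1)\<^sup>2 - (r - 1 - u) = r * (r - 2) * (ys - u)"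
        using r by (simp add: ys_def power2_eq_square field_simps)
      finally show ?thesis .
    qed
    finally have 1: "r * (r - 2) * (ys - u) / ((1 - u) * (r - 1)\<^sup>2) \<le> ln (u * (1 - u)) - ln (b * (1 - b))" .
    have "(ys - u) / 2 * ((1 - u) * (r - 1)\<^sup>2) \<le> (ys - u) / 2 * (1 * (r - 1)\<^sup>2)"
      using u by (intro mult_left_mono mult_right_mono) auto
    also have "\<dots> \<le> (ys - u) / 2 * (2 * (r * (r - 2)))"
    proof -
      have "(r - 1)\<^sup>2 = r * (r - 2) + 1" by (simp add: power2_eq_square algebra_simps)
      moreover have "3 * 1 \<le> r * (r - 2)" using r by (intro mult_mono) auto
      ultimately show ?thesis using u by (intro mult_left_mono) auto
    qed
    also have "\<dots> = r * (r - 2) * (ys - u)" by simp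
    finally have "(ys - u) / 2 \<le> r * (r - 2) * (ys - u) / ((1 - u) * (r - 1)\<^sup>2)"
      using pos by (simp add: pos_le_divide_eq)
    also note 1
    finally have "(ys - u) / 2 \<le> ln (u * (1 - u)) - ln (b * (1 - b))" .
    moreover have "(u - ys) / 2 = - ((ys - u) / 2)" by (simp add: minus_divide_left)
    ultimately have "0 \<le> ln (u * (1 - u)) - ln (b * (1 - b)) + (u - ys) / 2"
      by (simp only: diff_conv_add_uminus[symmetric] diff_ge_0_iff_ge)
    then show "\<exists>y. (K has_real_derivative y) (at u) \<and> 0 \<le> y" using D by blast
  qed
  also have "K ys = r * bethe (1 / r)" unfolding K_def ys(3,4) by (simp add: algebra_simps)
  finally have "K y \<le> r * bethe (1 / r)" .
  moreover have "(y - ys)\<^sup>2 = (ys - y)\<^sup>2" by (rule power2_commute)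
  ultimately show ?thesis by (simp add: K_def r_def ys_def)
qed

text \<open>
  The function \<^const>\<open>bethe\<close> is not concave, but the only part where concavity fails is
  \<open>x > 1/2\<close>, which a single coordinate of a point of the simplex can reach. Averaging the
  other coordinates reduces the claim to one variable.
\<close>

lemma sum_bethe_le:
  fixes x :: "'a \<Rightarrow> real"
  assumes I: "finite I" "card I = d" "d \<ge> 3" and x: "\<And>i. i \<in> I \<Longrightarrow> 0 \<le> x i" "(\<Sum>i\<in>I. x i) = 1"
    and i0: "i0 \<in> I" "\<bar>x i0 - 1 / d\<bar> \<ge> \<delta>" and \<delta>: "\<delta> \<ge> 0"
  shows "(\<Sum>i\<in>I. bethe (x i)) \<le> d * bethe (1 / d) - (\<delta> / d)\<^sup>2 / 4"
proof -
  define M where "M = Max (x ` I)"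
  have "I \<noteq> {}" using I by auto
  then have "M \<in> x ` I" using I by (auto simp: M_def intro: Max_in)
  then obtain k where k: "k \<in> I" "x k = M" by auto
  have le: "x i \<le> x k" if "i \<in> I" for i using that I(1) by (simp add: k M_def)
  define y where "y = 1 - x k"
  define r where "r = real d"
  have r: "r \<ge> 3" using I by (simp add: r_def)
  have cI: "real (card (I - {k})) = r - 1" using I k by (simp add: r_def of_nat_diff)
  have sy: "(\<Sum>i\<in>I - {k}. x i) = y" using x(2) I(1) k(1) by (simp add: y_def sum_diff1)
  have y0: "0 \<le> y" unfolding sy[symmetric] by (intro sum_nonneg) (use x in auto)
  \<comment> \<open>If the coordinate at \<open>i0\<close> is too small by \<open>\<delta>\<close>,
    that mass is spread over d - 1 other coordinates, so the largest one exceeds 1/d by at least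
    \<open>\<delta>\<close> / d.\<close>
  have dev: "\<delta> / r \<le> x k - 1 / r"
  proof (cases "x i0 \<ge> 1 / r")
    case True
    then have "\<delta> \<le> x i0 - 1 / r" using i0 by (simp add: r_def)
    moreover have "\<delta> / r \<le> \<delta>" using r \<delta> by (simp add: divide_le_eq mult_le_cancel_left1)
    ultimately show ?thesis using le[OF i0(1)] by simp
  next
    case False
    then have a: "\<delta> \<le> 1 / r - x i0" using i0 by (simp add: r_def)
    have "1 = (\<Sum>i\<in>I - {i0}. x i) + x i0" using x(2) I(1) i0(1) by (simp add: sum_diff1)
    also have "(\<Sum>i\<in>I - {i0}. x i) \<le> (\<Sum>i\<in>I - {i0}. x k)" by (intro sum_mono le) auto
    also have "\<dots> = (r - 1) * x k" using I i0 by (simp add: r_def of_nat_diff)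
    finally have "1 \<le> (r - 1) * x k + 1 / r - \<delta>" using a by simp
    then have "\<delta> \<le> (r - 1) * (x k - 1 / r)" using r by (simp add: field_simps)
    moreover have "0 \<le> x k - 1 / r"
    proof (rule ccontr)
      assume "\<not> ?thesis"
      then have "(r - 1) * (x k - 1 / r) < 0" using r by (intro mult_pos_neg) auto
      then show False using calculation \<delta> by linarith
    qed
    then have "(r - 1) * (x k - 1 / r) \<le> r * (x k - 1 / r)" by (intro mult_right_mono) auto
    ultimately have "\<delta> \<le> r * (x k - 1 / r)" by linarith
    then show ?thesis using r by (simp add: divide_le_eq mult.commute)
  qed
  have ys: "y \<le> 1 - 1 / r" 
  proof -
    have "0 \<le> \<delta> / r" using \<delta> r by simp
    then show ?thesis using dev by (simp add: y_def)
  qed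
  define b where "b = y / (r - 1)"
  have others: "(\<Sum>i\<in>I - {k}. bethe (x i)) \<le> (r - 1) * bethe b"
  \<comment> \<open>At \<open>b = 0\<close> the tangent would be vertical; then all other
    coordinates vanish.\<close>
  proof (cases "y = 0")
    case True
    then have "\<forall>i\<in>I - {k}. x i = 0" using sum_nonneg_eq_0_iff[of "I - {k}" x] sy I x(1) by auto
    then have "(\<Sum>i\<in>I - {k}. bethe (x i)) = 0" by (intro sum.neutral) (auto simp: bethe_def)
    then show ?thesis using True by (simp add: b_def bethe_def)
  next
    case False
    have "y / (r - 1) \<le> (1 - 1 / r) / (r - 1)" using ys r by (intro divide_right_mono) auto
    also have "\<dots> = 1 / r" using r by (simp add: field_simps)
    also have "\<dots> \<le> 1 / 2" using r by simp
    finally have b: "0 < b" "b \<le> 1/2" using False y0 r by (auto simp: b_def)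
    have "(\<Sum>i\<in>I - {k}. bethe (x i)) \<le> (\<Sum>i\<in>I - {k}. bethe b + (- ln (b * (1 - b)) - 2) * (x i - b))"
    proof (rule sum_mono)
      fix i assume i: "i \<in> I - {k}"
      \<comment> \<open>Two coordinates sum to at most 1 and \<open>x k\<close> is the larger, which
        puts \<open>x i\<close> into the range of concavity.\<close>
      have "x i + x k = (\<Sum>j\<in>{i, k}. x j)" using i by auto
      also have "\<dots> \<le> (\<Sum>j\<in>I. x j)" by (rule sum_mono2) (use I i k x in auto)
      finally have "x i \<le> 1/2" using le[of i] i x(2) by auto
      then show "bethe (x i) \<le> bethe b + (- ln (b * (1 - b)) - 2) * (x i - b)"
        using i x(1) b by (intro bethe_le_tangent) auto
    qed
    also have "\<dots> = (r - 1) * bethe b + (- ln (b * (1 - b)) - 2) * ((\<Sum>i\<in>I - {k}. x i) - (r - 1) * b)"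
      by (simp add: sum.distrib cI sum_subtractf sum_distrib_left[symmetric])
    \<comment> \<open>The linear term of the tangent disappears because \<open>b\<close> is the mean
      of these coordinates.\<close>
    also have "(\<Sum>i\<in>I - {k}. x i) - (r - 1) * b = 0" using sy r by (simp add: b_def)
    finally show ?thesis by simp
  qed
  have "(\<Sum>i\<in>I. bethe (x i)) = bethe (1 - y) + (\<Sum>i\<in>I - {k}. bethe (x i))"
    using I k by (simp add: y_def sum.remove)
  also have "\<dots> \<le> bethe (1 - y) + (r - 1) * bethe (y / (r - 1))" using others by (simp add: b_def)
  also have "\<dots> \<le> d * bethe (1 / d) - (1 - 1 / d - y)\<^sup>2 / 4"
    using bethe_two_level[of d y] I y0 ys by (simp add: r_def)
  also have "(\<delta> / d)\<^sup>2 \<le> (1 - 1 / d - y)\<^sup>2"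
    using dev \<delta> by (intro power_mono) (auto simp: y_def r_def)
  then have "d * bethe (1 / d) - (1 - 1 / d - y)\<^sup>2 / 4 \<le> d * bethe (1 / d) - (\<delta> / d)\<^sup>2 / 4" by simp
  finally show ?thesis .
qed

section \<open>Stirling's formula\<close>

definition stirling_seq :: "nat \<Rightarrow> real" where
  "stirling_seq n = ln (fact n) - (real n + 1/2) * ln (real n) + real n"

lemma stirling_seq_diff:
  assumes "n \<ge> 1"
  shows "stirling_seq n - stirling_seq (Suc n) = (real n + 1/2) * (ln (real n + 1) - ln (real n)) - 1"
proof -
  have "ln (fact (Suc n)) = ln (real (Suc n)) + ln (fact n :: real)"
    by (simp only: fact_Suc, subst ln_mult) (auto simp: add.commute)
  then show ?thesis by (simp add: stirling_seq_def algebra_simps)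
qed

text \<open>By convexity the integral of 1/x over [n, n + 1] is at least the value at the midpoint n
  + 1/2.\<close>

lemma stirling_seq_decreasing:
  assumes "n \<ge> 1"
  shows "stirling_seq (Suc n) \<le> stirling_seq n"
proof -
  have "ln (real n + 1) - ln (real n) \<ge> 2 * (real n + 1 - real n) / (real n + (real n + 1))"
    by (rule ln_inverse_approx_ge) (use assms in auto)
  then have "(real n + 1/2) * (ln (real n + 1) - ln (real n)) \<ge> (real n + 1/2) * (2 / (2 * real n + 1))"
    by (intro mult_left_mono) auto
  also have "(real n + 1/2) * (2 / (2 * real n + 1)) = 1" by (simp add: field_simps)
  finally show ?thesis using stirling_seq_diff[OF assms] by simp
qed

text \<open>The trapezoidal upper bound for the same integral; its excess over the midpoint value,
  multiplied by n + 1/2, is the telescoping difference 1/(4n) - 1/(4(n + 1)).\<close>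

lemma stirling_seq_step:
  assumes "n \<ge> 1"
  shows "stirling_seq n - 1 / (4 * real n) \<le> stirling_seq (Suc n) - 1 / (4 * real (Suc n))"
proof -
  have n: "real n > 0" using assms by simp
  have "ln (real n + 1) - ln (real n) \<le> 1 * (inverse (real n) + inverse (real n + 1)) / 2"
    by (rule ln_inverse_approx_le) (use assms in auto)
  then have "(real n + 1/2) * (ln (real n + 1) - ln (real n)) \<le> (real n + 1/2) * ((inverse (real n) + inverse (real n + 1)) / 2)"
    by (intro mult_left_mono) auto
  also have "\<dots> = 1 + 1 / (4 * real n) - 1 / (4 * real (Suc n))"
    using n by (simp add: divide_simps) (simp add: algebra_simps)
  finally show ?thesis using stirling_seq_diff[OF assms] by simp
qed

lemma stirling_seq_bounds:
  assumes "n \<ge> 1"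
  shows "3/4 \<le> stirling_seq n" "stirling_seq n \<le> 1"
proof -
  \<comment> \<open>The sequence starts at 1, and 3/4 is 1 minus the first correction 1/4.\<close>
  have "3/4 \<le> stirling_seq n - 1 / (4 * real n)"
    using assms
  proof (induction n rule: dec_induct)
    case base
    show ?case by (simp add: stirling_seq_def)
  next
    case (step n)
    then show ?case using stirling_seq_step[of n] by simp
  qed
  moreover have "1 / (4 * real n) \<ge> 0" by simp
  ultimately show "3/4 \<le> stirling_seq n" by linarith
  show "stirling_seq n \<le> 1"
    using assms
  proof (induction n rule: dec_induct)
    case base
    show ?case by (simp add: stirling_seq_def)
  next
    case (step n)
    then show ?case using stirling_seq_decreasing[of n] by simp
  qed
qed

lemma wallis_prod_eq:
  "(\<Prod>k=1..n. (4 * real k ^ 2) / (4 * real k ^ 2 - 1)) = (2 ^ n * fact n) ^ 4 / ((fact (2 * n))\<^sup>2 * (2 * real n + 1))"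
proof (induction n)
  case (Suc n)
  have f: "fact (2 * Suc n) = (2 * real n + 2) * (2 * real n + 1) * fact (2 * n)" by (simp add: algebra_simps)
  have g: "fact (Suc n) = (real n + 1) * fact n" by (simp add: algebra_simps)
  have p: "(fact (2 * n) :: real) > 0" "(fact n :: real) > 0" "2 * real n + 1 > 0" "2 * real n + 3 > 0" "real n + 1 > 0" by auto
  have "4 * real (Suc n) ^ 2 - 1 = (2 * real n + 1) * (2 * real n + 3)" "4 * real (Suc n) ^ 2 = 4 * (real n + 1)^2"
    by (simp_all add: power2_eq_square algebra_simps)
  then have "(\<Prod>k=1..Suc n. (4 * real k ^ 2) / (4 * real k ^ 2 - 1)) =
     (2 ^ n * fact n) ^ 4 / ((fact (2 * n))\<^sup>2 * (2 * real n + 1)) * (4 * (real n + 1)^2 / ((2 * real n + 1) * (2 * real n + 3)))"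
    using Suc by simp
  also have "\<dots> = (2 ^ Suc n * ((real n + 1) * fact n)) ^ 4 / (((2 * real n + 2) * (2 * real n + 1) * fact (2 * n))\<^sup>2 * (2 * real n + 3))"
  proof -
    define N where "N = real n + 1"
    define P where "P = 2 * real n + 1"
    define Q where "Q = 2 * real n + 3"
    have pp: "N > 0" "P > 0" "Q > 0" using p by (auto simp: N_def P_def Q_def)
    have "2 * real n + 2 = 2 * N" by (simp add: N_def)
    then show ?thesis unfolding N_def[symmetric] P_def[symmetric] Q_def[symmetric] using pp p(1)
      by (simp add: field_simps power2_eq_square power4_eq_xxxx)
  qed
  finally show ?case unfolding f g by (simp add: add_ac)
qed simp

text \<open>Monotonicity and boundedness give a limit a. The Wallis product, written with factorials
  of n and 2n, turns into 4a - 2a - 2 ln 2 = ln (pi/2), which determines a.\<close>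

theorem stirling_seq_LIMSEQ: "stirling_seq \<longlonglongrightarrow> ln (2 * pi) / 2"
proof -
  have "decseq (\<lambda>n. stirling_seq (Suc n))"
    by (rule decseq_SucI) (rule stirling_seq_decreasing, simp)
  moreover have "Bseq (\<lambda>n. stirling_seq (Suc n))"
  proof (rule BseqI'[of _ 1])
    fix n show "norm (stirling_seq (Suc n)) \<le> 1" using stirling_seq_bounds[of "Suc n"] by simp
  qed
  ultimately have "convergent (\<lambda>n. stirling_seq (Suc n))"
    by (simp add: Bseq_monoseq_convergent decseq_imp_monoseq)
  then obtain a where "(\<lambda>n. stirling_seq (Suc n)) \<longlonglongrightarrow> a" by (auto simp: convergent_def)
  then have a: "stirling_seq \<longlonglongrightarrow> a" by (rule LIMSEQ_imp_Suc)
  then have a2: "(\<lambda>n. stirling_seq (2 * n)) \<longlonglongrightarrow> a"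
    by (rule filterlim_compose) real_asymp
  have "(\<lambda>n. ln (\<Prod>k=1..n. (4 * real k ^ 2) / (4 * real k ^ 2 - 1))) \<longlonglongrightarrow> ln (pi / 2)"
    by (intro tendsto_ln wallis) auto
  moreover have "eventually (\<lambda>n. ln (\<Prod>k=1..n. (4 * real k ^ 2) / (4 * real k ^ 2 - 1)) =
      4 * stirling_seq n - 2 * stirling_seq (2 * n) + (- ln 2 + (ln (real n) - ln (2 * real n + 1)))) sequentially"
    using eventually_gt_at_top[of 0]
  proof eventually_elim
    case (elim n)
    have "ln ((2 ^ n * fact n) ^ 4 / ((fact (2 * n))\<^sup>2 * (2 * real n + 1))) =
       4 * (n * ln 2 + ln (fact n)) - (2 * ln (fact (2 * n)) + ln (2 * real n + 1))"
      by (simp add: ln_div ln_mult ln_realpow)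
    moreover have "ln (real (2 * n)) = ln 2 + ln (real n)" using elim by (simp add: ln_mult)
    ultimately show ?case unfolding wallis_prod_eq stirling_seq_def by (simp add: algebra_simps)
  qed
  ultimately have "(\<lambda>n. 4 * stirling_seq n - 2 * stirling_seq (2 * n) + (- ln 2 + (ln (real n) - ln (2 * real n + 1)))) \<longlonglongrightarrow> ln (pi / 2)"
    by (rule Lim_transform_eventually)
  moreover have "(\<lambda>n. 4 * stirling_seq n - 2 * stirling_seq (2 * n) + (- ln 2 + (ln (real n) - ln (2 * real n + 1)))) \<longlonglongrightarrow>
      4 * a - 2 * a + (- ln 2 + - ln 2)"
    by (intro tendsto_intros a a2) real_asymp
  ultimately have "ln (pi / 2) = 4 * a - 2 * a + (- ln 2 + - ln 2)" by (rule LIMSEQ_unique)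
  then have "a = ln (2 * pi) / 2" by (simp add: ln_div ln_mult)
  with a show ?thesis by blast
qed

lemma ln_fact_bounds:
  shows "real n * ln (real n) - real n \<le> ln (fact n)"
    and "ln (fact n) \<le> real n * ln (real n) - real n + ln (real n + 1) + 1"
proof -
  have "real n * ln (real n) - real n \<le> ln (fact n) \<and> ln (fact n) \<le> real n * ln (real n) - real n + ln (real n + 1) + 1"
  proof (cases "n = 0")
    case False
    then have n: "n \<ge> 1" by simp
    have "0 \<le> ln (real n)" using n by simp
    moreover have "ln (real n) \<le> ln (real n + 1)" using n by simp
    ultimately show ?thesis using stirling_seq_bounds[OF n] by (simp add: stirling_seq_def algebra_simps)
  qed simp
  then show "real n * ln (real n) - real n \<le> ln (fact n)"
    "ln (fact n) \<le> real n * ln (real n) - real n + ln (real n + 1) + 1" by auto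
qed

text \<open>The function vanishes at 0 and has derivative ln (1 + x) - x, which is at most 2 x^2 in
  modulus; the mean value inequality adds one more power.\<close>

lemma abs_one_plus_ln_Taylor:
  fixes u :: real
  assumes "\<bar>u\<bar> \<le> 1/2"
  shows "\<bar>(1 + u) * ln (1 + u) - u - u\<^sup>2 / 2\<bar> \<le> 2 * \<bar>u\<bar> ^ 3"
proof -
  define f where "f u = (1 + u) * ln (1 + u) - u - u\<^sup>2 / 2" for u :: real
  have "norm (f u - f 0) \<le> (2 * u\<^sup>2) * norm (u - 0)"
  proof (rule field_differentiable_bound[where S = "closed_segment 0 u" and f' = "\<lambda>x. ln (1 + x) - x"])
    fix x assume x: "x \<in> closed_segment 0 u"
    then have xu: "\<bar>x\<bar> \<le> \<bar>u\<bar>" by (auto simp: closed_segment_eq_real_ivl split: if_splits)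
    then have "1 + x > 0" using assms by linarith
    then have "(f has_real_derivative ln (1 + x) - x) (at x)"
      unfolding f_def[abs_def] by (auto intro!: derivative_eq_intros)
    then show "(f has_field_derivative ln (1 + x) - x) (at x within closed_segment 0 u)"
      by (rule has_field_derivative_at_within)
    have "\<bar>ln (1 + x) - x\<bar> \<le> 2 * x\<^sup>2" by (rule abs_ln_one_plus_x_minus_x_bound) (use xu assms in linarith)
    also have "x\<^sup>2 \<le> u\<^sup>2" using xu by (simp add: abs_le_square_iff)
    finally show "norm (ln (1 + x) - x) \<le> 2 * u\<^sup>2" by simp
  qed auto
  then show ?thesis by (simp add: f_def power2_eq_square power3_eq_cube abs_mult)
qed

text \<open>
  The exponent \<open>5/8\<close> leaves room for deviations of order \<open>A\<close> to the power \<open>3/5\<close> about centres that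
  differ by a bounded amount, while the cubic term stays negligible.
\<close>

lemma ln_fact_near:
  fixes \<epsilon> :: real
  assumes "\<epsilon> > 0"
  shows "\<exists>A0>0. \<forall>A\<ge>A0. \<forall>y m. A + y = real m \<longrightarrow> \<bar>y\<bar> \<le> A powr (5/8) \<longrightarrow>
    \<bar>ln (fact m) - (A * ln A - A + ln (2 * pi * A) / 2 + y * ln A + y\<^sup>2 / (2 * A))\<bar> \<le> \<epsilon>"
proof -
  have "eventually (\<lambda>m. \<bar>stirling_seq m - ln (2 * pi) / 2\<bar> < \<epsilon> / 3) sequentially"
    using tendstoD[OF stirling_seq_LIMSEQ, of "\<epsilon> / 3"] assms by (simp add: dist_real_def)
  then obtain M where M: "\<And>m. m \<ge> M \<Longrightarrow> \<bar>stirling_seq m - ln (2 * pi) / 2\<bar> < \<epsilon> / 3"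
    by (auto simp: eventually_sequentially)
  have "eventually (\<lambda>A::real. A powr (-3/8) < \<epsilon> / 3) at_top"
    by (rule order_tendstoD(2)[where y = 0]) (real_asymp, use assms in simp)
  moreover have "eventually (\<lambda>A::real. 2 * A powr (-1/8) < \<epsilon> / 3) at_top"
    by (rule order_tendstoD(2)[where y = 0]) (real_asymp, use assms in simp)
  moreover have "eventually (\<lambda>A::real. A powr (-3/8) < 1/2) at_top" by real_asymp
  moreover have "eventually (\<lambda>A::real. A > 2 * real M \<and> A > 2) at_top" by (intro eventually_conj eventually_gt_at_top)
  ultimately have "eventually (\<lambda>A::real. A powr (-3/8) < \<epsilon> / 3 \<and> 2 * A powr (-1/8) < \<epsilon> / 3 \<and> A powr (-3/8) < 1/2 \<and> A > 2 * real M \<and> A > 2) at_top"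
    by eventually_elim auto
  then obtain A0 where A0: "\<And>A::real. A \<ge> A0 \<Longrightarrow> A powr (-3/8) < \<epsilon> / 3 \<and> 2 * A powr (-1/8) < \<epsilon> / 3 \<and> A powr (-3/8) < 1/2 \<and> A > 2 * real M \<and> A > 2"
    by (auto simp: eventually_at_top_linorder)
  show ?thesis
  proof (intro exI[of _ "max A0 1"] conjI allI impI)
    show "max A0 1 > 0" by simp
    fix A y :: real and m :: nat
    assume A: "max A0 1 \<le> A" and m: "A + y = real m" and y: "\<bar>y\<bar> \<le> A powr (5/8)"
    have AA: "A powr (-3/8) < \<epsilon> / 3" "2 * A powr (-1/8) < \<epsilon> / 3" "A powr (-3/8) < 1/2" "A > 2 * real M" "A > 2"
      using A0[of A] A by auto
    \<comment> \<open>The relative deviation is at most A^(-3/8), so the cubic error A u^3 is of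
      order A^(-1/8) and the contribution of the half logarithm is of order A^(-3/8).\<close>
    define u where "u = y / A"
    have y_eq: "y = A * u" using AA by (simp add: u_def)
    have u: "\<bar>u\<bar> \<le> A powr (-3/8)"
    proof -
      have "\<bar>u\<bar> \<le> A powr (5/8) / A" using y AA unfolding u_def abs_divide by (simp add: divide_right_mono)
      also have "\<dots> = A powr (5/8) / A powr 1" using AA by simp
      also have "\<dots> = A powr (-3/8)" by (subst powr_diff[symmetric]) simp
      finally show ?thesis .
    qed
    have u2: "\<bar>u\<bar> \<le> 1/2" using u AA by linarith
    have mA: "real m = A * (1 + u)" using m y_eq by (simp add: algebra_simps)
    have "A * (1 + u) \<ge> A * (1/2)" using u2 AA by (intro mult_left_mono) auto
    then have "real M < real m" "1 < real m" using AA by (simp_all add: mA[symmetric])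
    then have m1: "m \<ge> M" "m \<ge> 1" by simp_all
    define L where "L = ln (1 + u)"
    have lnm: "ln (real m) = ln A + L" using mA AA u2 by (simp add: L_def ln_mult)
    have "ln (fact m) = (real m + 1/2) * ln (real m) - real m + stirling_seq m" by (simp add: stirling_seq_def)
    also have "\<dots> = (A * (1 + u) + 1/2) * (ln A + L) - A * (1 + u) + stirling_seq m" using mA lnm by simp
    finally have "ln (fact m) - (A * ln A - A + ln (2 * pi * A) / 2 + y * ln A + y\<^sup>2 / (2 * A)) =
       A * ((1 + u) * L - u - u\<^sup>2 / 2) + L / 2 + (stirling_seq m - ln (2 * pi) / 2)"
      using AA by (simp add: y_eq ln_mult power2_eq_square add_divide_distrib algebra_simps)
    moreover have "\<bar>A * ((1 + u) * L - u - u\<^sup>2 / 2)\<bar> \<le> \<epsilon> / 3"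
    proof -
      have "\<bar>A * ((1 + u) * L - u - u\<^sup>2 / 2)\<bar> \<le> A * (2 * \<bar>u\<bar> ^ 3)"
        using abs_one_plus_ln_Taylor[OF u2] AA unfolding abs_mult L_def by (intro mult_mono) auto
      also have "\<dots> \<le> A * (2 * (A powr (-3/8)) ^ 3)" using u AA by (intro mult_left_mono power_mono) auto
      also have "(A powr (-3/8)) ^ 3 = A powr (-9/8)" using AA by (subst powr_realpow[symmetric]) (auto simp: powr_powr)
      also have "A * (2 * A powr (-9/8)) = 2 * (A powr 1 * A powr (-9/8))" using AA by simp
      also have "A powr 1 * A powr (-9/8) = A powr (-1/8)" by (subst powr_add[symmetric]) simp
      finally show ?thesis using AA by linarith
    qed
    moreover have "\<bar>L / 2\<bar> \<le> \<epsilon> / 3"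
    proof -
      have "\<bar>L - u\<bar> \<le> 2 * u\<^sup>2" unfolding L_def by (rule abs_ln_one_plus_x_minus_x_bound[OF u2])
      also have "\<dots> = 2 * \<bar>u\<bar> * \<bar>u\<bar>" by (simp add: power2_eq_square)
      also have "\<dots> \<le> 1 * \<bar>u\<bar>" using u2 by (intro mult_right_mono) auto
      finally show ?thesis using u AA by linarith
    qed
    moreover have "\<bar>stirling_seq m - ln (2 * pi) / 2\<bar> \<le> \<epsilon> / 3" using M[OF m1(1)] by simp
    ultimately show "\<bar>ln (fact m) - (A * ln A - A + ln (2 * pi * A) / 2 + y * ln A + y\<^sup>2 / (2 * A))\<bar> \<le> \<epsilon>"
      by linarith
  qed
qed

section \<open>Gaussian integrals\<close>

definition quad_form :: "nat \<Rightarrow> (nat \<Rightarrow> nat \<Rightarrow> real) \<Rightarrow> (nat \<Rightarrow> real) \<Rightarrow> real" where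
  "quad_form k S x = (\<Sum>i<k. \<Sum>j<k. S i j * x i * x j)"

lemma nn_integral_exp_neg_square:
  fixes s b :: real
  assumes "s > 0"
  shows "(\<integral>\<^sup>+y. ennreal (exp (- (s * (y + b)\<^sup>2) / 2)) \<partial>lborel) = ennreal (sqrt (2 * pi / s))"
proof -
  let ?\<sigma> = "1 / sqrt s"
  have \<sigma>: "?\<sigma> > 0" "?\<sigma>\<^sup>2 = 1 / s" using assms by (auto simp: power_divide)
  have eq: "exp (- (s * (y + b)\<^sup>2) / 2) = sqrt (2 * pi / s) * normal_density (- b) ?\<sigma> y" for y
    using assms by (simp add: normal_density_def \<sigma>(2) field_simps)
  have "(\<integral>\<^sup>+y. ennreal (exp (- (s * (y + b)\<^sup>2) / 2)) \<partial>lborel) =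
      ennreal (sqrt (2 * pi / s)) * (\<integral>\<^sup>+y. ennreal (normal_density (- b) ?\<sigma> y) \<partial>lborel)"
    unfolding eq using assms by (subst nn_integral_cmult[symmetric]) (auto simp: ennreal_mult)
  also have "(\<integral>\<^sup>+y. ennreal (normal_density (- b) ?\<sigma> y) \<partial>lborel) = 1"
    using \<sigma>(1) by (subst nn_integral_eq_integral) (auto simp: integrable_normal_density integral_normal_density)
  finally show ?thesis by simp
qed

text \<open>Multiplication from the right by the unit lower triangular \<open>?L\<close> performs
  the column operations that clear the last row to the left of the pivot
  \<open>S k k\<close>.\<close>

lemma det_Schur_complement:
  fixes S :: "nat \<Rightarrow> nat \<Rightarrow> real"
  assumes "S k k \<noteq> 0"
  shows "det (mat (Suc k) (Suc k) (\<lambda>(i, j). S i j)) =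
    det (mat k k (\<lambda>(i, j). S i j - S i k * S k j / S k k)) * S k k"
proof -
  let ?A = "mat (Suc k) (Suc k) (\<lambda>(i, j). S i j)"
  let ?L = "mat (Suc k) (Suc k) (\<lambda>(i, j). if i = j then 1 else if i = k then - S k j / S k k else 0)"
  let ?S' = "mat k k (\<lambda>(i, j). S i j - S i k * S k j / S k k)"
  let ?B = "four_block_mat ?S' (mat k 1 (\<lambda>(i, j). S i k)) (0\<^sub>m 1 k) (mat 1 1 (\<lambda>_. S k k))"
  have "?A * ?L = ?B"
  proof (rule eq_matI)
    fix i j assume "i < dim_row ?B" "j < dim_col ?B"
    then have ij: "i < Suc k" "j < Suc k" by auto
    have "(?A * ?L) $$ (i, j) = (\<Sum>l<Suc k. S i l * (if l = j then 1 else if l = k then - S k j / S k k else 0))"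
      using ij by (simp add: scalar_prod_def atLeast0LessThan)
    also have "\<dots> = (if j = k then S i k else S i j - S i k * S k j / S k k)"
    proof (cases "j = k")
      case True
      then have "(\<Sum>l<k. S i l * (if l = j then 1 else if l = k then - S k j / S k k else 0)) = 0"
        by (intro sum.neutral) auto
      then show ?thesis using True by simp
    next
      case False
      then have "(\<Sum>l<k. S i l * (if l = j then 1 else if l = k then - S k j / S k k else 0)) = (\<Sum>l<k. if l = j then S i l else 0)"
        by (intro sum.cong) auto
      also have "\<dots> = S i j" using False ij by simp
      finally show ?thesis using False by simp
    qed
    also have "\<dots> = ?B $$ (i, j)" using ij assms by (auto simp: less_Suc_eq)
    finally show "(?A * ?L) $$ (i, j) = ?B $$ (i, j)" .
  qed auto
  then have "det ?A * det ?L = det ?B"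
    using det_mult[of ?A "Suc k" ?L] by simp
  moreover have "det ?L = 1"
  proof -
    have "det ?L = prod_list (diag_mat ?L)" by (rule det_lower_triangular[of "Suc k"]) auto
    also have "diag_mat ?L = map (\<lambda>_. 1) [0..<Suc k]" unfolding diag_mat_def by (intro map_cong) auto
    also have "prod_list \<dots> = (1::real)" by (induction k) auto
    finally show ?thesis .
  qed
  moreover have "det ?B = det ?S' * S k k"
    by (subst det_four_block_mat_lower_left_zero) (auto simp: det_single)
  ultimately show ?thesis by simp
qed

text \<open>Completing the square in the last variable leaves the form of the Schur complement, the
  same matrix as in the determinant recursion.\<close>

lemma quad_form_Suc:
  assumes sym: "\<And>i j. i < Suc k \<Longrightarrow> j < Suc k \<Longrightarrow> S i j = S j i" and "S k k \<noteq> 0"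
  shows "quad_form (Suc k) S x = quad_form k (\<lambda>i j. S i j - S i k * S k j / S k k) x
     + S k k * (x k + (\<Sum>i<k. S i k * x i) / S k k)\<^sup>2"
proof -
  let ?b = "\<Sum>i<k. S i k * x i"
  have b': "(\<Sum>j<k. S k j * x j) = ?b" using sym by (intro sum.cong) auto
  have "quad_form (Suc k) S x = quad_form k S x + (\<Sum>i<k. S i k * x i) * x k + (x k * (\<Sum>j<k. S k j * x j) + S k k * x k * x k)"
    by (simp add: quad_form_def sum.distrib sum_distrib_left sum_distrib_right mult_ac)
  moreover have "quad_form k (\<lambda>i j. S i j - S i k * S k j / S k k) x = quad_form k S x - ?b * ?b / S k k"
  proof -
    have "?b * ?b / S k k = ?b * (\<Sum>j<k. S k j * x j) / S k k" using b' by simp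
    also have "\<dots> = (\<Sum>i<k. \<Sum>j<k. (S i k * x i) * (S k j * x j) / S k k)"
      by (simp add: sum_product sum_divide_distrib)
    finally show ?thesis unfolding quad_form_def
      by (simp add: sum_subtractf[symmetric] algebra_simps)
  qed
  moreover have "S k k * (x k + ?b / S k k)\<^sup>2 = S k k * x k * x k + 2 * ?b * x k + ?b * ?b / S k k"
    using assms(2) by (simp add: field_simps power2_eq_square)
  ultimately show ?thesis using b' by (simp add: algebra_simps)
qed

lemma quad_form_cong: "(\<And>i. i < k \<Longrightarrow> x i = y i) \<Longrightarrow> quad_form k S x = quad_form k S y"
  by (simp add: quad_form_def)

lemma measurable_quad_form [measurable]:
  "{..<k} \<subseteq> I \<Longrightarrow> quad_form k S \<in> borel_measurable (Pi\<^sub>M I (\<lambda>_. lborel))"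
  unfolding quad_form_def by measurable auto

text \<open>The last variable is integrated out: after completion of the square, the inner integral
  is a shifted one-dimensional Gaussian independent of the shift, and the outer one belongs to the
  Schur complement, whose determinant differs by the factor \<open>S k k\<close>.\<close>

lemma gaussian_integral_PiM:
  assumes "\<And>i j. i < k \<Longrightarrow> j < k \<Longrightarrow> S i j = S j i"
    and "\<And>x. \<exists>i<k. x i \<noteq> 0 \<Longrightarrow> quad_form k S x > 0"
  shows "det (mat k k (\<lambda>(i, j). S i j)) > 0"
    and "(\<integral>\<^sup>+x. ennreal (exp (- quad_form k S x / 2)) \<partial>Pi\<^sub>M {..<k} (\<lambda>_. lborel)) =
       ennreal (sqrt ((2 * pi) ^ k / det (mat k k (\<lambda>(i, j). S i j))))"
  using assms
proof (induction k arbitrary: S)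
  case 0
  have "mat 0 0 (\<lambda>(i, j). S i j) = 1\<^sub>m 0" by (intro eq_matI) auto
  then have d: "det (mat 0 0 (\<lambda>(i, j). S i j)) = 1" by simp
  { case 1 show ?case using d by simp next
    case 2 show ?case using d by (simp add: quad_form_def PiM_empty nn_integral_count_space_finite) }
next
  case (Suc k)
  have *: "det (mat (Suc k) (Suc k) (\<lambda>(i, j). S i j)) > 0 \<and>
    (\<integral>\<^sup>+x. ennreal (exp (- quad_form (Suc k) S x / 2)) \<partial>Pi\<^sub>M {..<Suc k} (\<lambda>_. lborel)) =
       ennreal (sqrt ((2 * pi) ^ Suc k / det (mat (Suc k) (Suc k) (\<lambda>(i, j). S i j))))"
    if sym: "\<And>i j. i < Suc k \<Longrightarrow> j < Suc k \<Longrightarrow> S i j = S j i"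
    and pd: "\<And>x. \<exists>i<Suc k. x i \<noteq> 0 \<Longrightarrow> quad_form (Suc k) S x > 0"
    for S
  proof -
    have "quad_form (Suc k) S (\<lambda>i. if i = k then 1 else 0) > 0" by (rule pd) auto
    then have s: "S k k > 0" by (simp add: quad_form_def)
    define S' where "S' = (\<lambda>i j. S i j - S i k * S k j / S k k)"
    have split: "quad_form (Suc k) S x = quad_form k S' x + S k k * (x k + (\<Sum>i<k. S i k * x i) / S k k)\<^sup>2" for x
      unfolding S'_def using sym s by (intro quad_form_Suc) auto
    have sym': "S' i j = S' j i" if "i < k" "j < k" for i j
      using that sym[of i j] sym[of i k] sym[of k j] by (simp add: S'_def)
    have pd': "quad_form k S' x > 0" if x: "\<exists>i<k. x i \<noteq> 0" for x
    proof -
      \<comment> \<open>The last coordinate is chosen to make the completed square vanish, so that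
        positive definiteness passes to the Schur complement.\<close>
      define y where "y = x(k := - (\<Sum>i<k. S i k * x i) / S k k)"
      have "quad_form (Suc k) S y > 0" by (rule pd) (use x in \<open>auto simp: y_def\<close>)
      moreover have "quad_form k S' y = quad_form k S' x" by (rule quad_form_cong) (simp add: y_def)
      moreover have "(\<Sum>i<k. S i k * y i) = (\<Sum>i<k. S i k * x i)" by (intro sum.cong) (auto simp: y_def)
      moreover have "y k = - (\<Sum>i<k. S i k * x i) / S k k" by (simp add: y_def)
      ultimately show ?thesis unfolding split by simp
    qed
    let ?D' = "det (mat k k (\<lambda>(i, j). S' i j))"
    have D: "det (mat (Suc k) (Suc k) (\<lambda>(i, j). S i j)) = ?D' * S k k"
      unfolding S'_def using s by (intro det_Schur_complement) auto
    have D': "?D' > 0" by (rule Suc.IH(1)[OF sym' pd'])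
    interpret product_sigma_finite "\<lambda>_. lborel :: real measure" by standard
    have "(\<integral>\<^sup>+x. ennreal (exp (- quad_form (Suc k) S x / 2)) \<partial>Pi\<^sub>M {..<Suc k} (\<lambda>_. lborel)) =
      (\<integral>\<^sup>+x. \<integral>\<^sup>+y. ennreal (exp (- quad_form (Suc k) S (x(k := y)) / 2)) \<partial>lborel \<partial>Pi\<^sub>M {..<k} (\<lambda>_. lborel))"
      unfolding lessThan_Suc by (rule product_nn_integral_insert) (auto simp: lessThan_Suc[symmetric])
    also have "\<dots> = (\<integral>\<^sup>+x. ennreal (exp (- quad_form k S' x / 2)) * ennreal (sqrt (2 * pi / S k k)) \<partial>Pi\<^sub>M {..<k} (\<lambda>_. lborel))"
    proof (rule nn_integral_cong)
      fix x :: "nat \<Rightarrow> real"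
      let ?b = "(\<Sum>i<k. S i k * x i) / S k k"
      have "quad_form (Suc k) S (x(k := y)) = quad_form k S' x + S k k * (y + ?b)\<^sup>2" for y
        unfolding split using quad_form_cong[of k "x(k := y)" x S'] by simp
      then have "exp (- quad_form (Suc k) S (x(k := y)) / 2) = exp (- quad_form k S' x / 2) * exp (- (S k k * (y + ?b)\<^sup>2) / 2)" for y
        by (simp add: exp_add[symmetric] field_simps)
      then have "(\<integral>\<^sup>+y. ennreal (exp (- quad_form (Suc k) S (x(k := y)) / 2)) \<partial>lborel) =
          ennreal (exp (- quad_form k S' x / 2)) * (\<integral>\<^sup>+y. ennreal (exp (- (S k k * (y + ?b)\<^sup>2) / 2)) \<partial>lborel)"
        by (simp add: ennreal_mult nn_integral_cmult)
      then show "(\<integral>\<^sup>+y. ennreal (exp (- quad_form (Suc k) S (x(k := y)) / 2)) \<partial>lborel) =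
          ennreal (exp (- quad_form k S' x / 2)) * ennreal (sqrt (2 * pi / S k k))"
        unfolding nn_integral_exp_neg_square[OF s] .
    qed
    also have "\<dots> = (\<integral>\<^sup>+x. ennreal (exp (- quad_form k S' x / 2)) \<partial>Pi\<^sub>M {..<k} (\<lambda>_. lborel)) * ennreal (sqrt (2 * pi / S k k))"
      by (rule nn_integral_multc) measurable
    also have "(\<integral>\<^sup>+x. ennreal (exp (- quad_form k S' x / 2)) \<partial>Pi\<^sub>M {..<k} (\<lambda>_. lborel)) = ennreal (sqrt ((2 * pi) ^ k / ?D'))"
      by (rule Suc.IH(2)[OF sym' pd'])
    also have "ennreal (sqrt ((2 * pi) ^ k / ?D')) * ennreal (sqrt (2 * pi / S k k)) = ennreal (sqrt ((2 * pi) ^ Suc k / (?D' * S k k)))"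
    proof -
      have "(2 * pi) ^ Suc k / (?D' * S k k) = (2 * pi) ^ k / ?D' * (2 * pi / S k k)" by simp
      then have "sqrt ((2 * pi) ^ Suc k / (?D' * S k k)) = sqrt ((2 * pi) ^ k / ?D') * sqrt (2 * pi / S k k)"
        by (simp only: real_sqrt_mult)
      then show ?thesis using s D' by (simp only:, subst ennreal_mult) auto
    qed
    finally have int: "(\<integral>\<^sup>+x. ennreal (exp (- quad_form (Suc k) S x / 2)) \<partial>Pi\<^sub>M {..<Suc k} (\<lambda>_. lborel)) =
      ennreal (sqrt ((2 * pi) ^ Suc k / (?D' * S k k)))" .
    have "?D' * S k k > 0" using D' s by (rule mult_pos_pos)
    then show ?thesis unfolding D using int by (rule conjI)
  qed
  {
    case 1
    show ?case by (rule conjunct1[OF *[OF 1(1) 1(2)]])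
  next
    case 2
    show ?case by (rule conjunct2[OF *[OF 2(1) 2(2)]])
  }
qed

section \<open>Fourier inversion\<close>

lemma integral_cis_Icc:
  fixes a L :: real
  assumes "L \<ge> 0"
  shows "(\<integral>x. indicator {-L..L} x *\<^sub>R cis (a * x) \<partial>lborel) = (if a = 0 then 2 * L else 2 * sin (a * L) / a)"
proof (cases "a = 0")
  case True
  then show ?thesis using assms by (simp add: scaleR_conv_of_real)
next
  case False
  have "(\<integral>x. indicator {-L..L} x *\<^sub>R cis (a * x) \<partial>lborel) = cis (a * L) / (\<i> * a) - cis (a * (- L)) / (\<i> * a)"
  proof (rule integral_FTC_Icc)
    show "continuous_on {-L..L} (\<lambda>x. cis (a * x))" by (intro continuous_intros)
    fix x
    have "((\<lambda>x. cis (a * x)) has_vector_derivative (\<i> * a * cis (a * x))) (at x within {-L..L})"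
      unfolding cis_conv_exp
      by (auto intro!: derivative_eq_intros has_vector_derivative_real_field simp: field_simps)
    then have "((\<lambda>x. cis (a * x) / (\<i> * a)) has_vector_derivative (\<i> * a * cis (a * x)) / (\<i> * a)) (at x within {-L..L})"
      by (rule has_vector_derivative_divide)
    then show "((\<lambda>x. cis (a * x) / (\<i> * a)) has_vector_derivative cis (a * x)) (at x within {-L..L})"
      using False by simp
  qed (use assms in auto)
  also have "\<dots> = (cis (a * L) - cis (- (a * L))) / (\<i> * a)" by (simp add: diff_divide_distrib)
  also have "cis (a * L) - cis (- (a * L)) = 2 * \<i> * sin (a * L)" by (simp add: complex_eq_iff)
  finally show ?thesis using False by simp
qed

lemma integrable_indicator_cis:
  "integrable lborel (\<lambda>x. indicator {-L..L} x *\<^sub>R cis (a * x + b))"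
  by (rule integrableI_bounded_set_indicator[where B = 1])
     (auto simp: emeasure_lborel_Icc_eq intro!: borel_measurable_continuous_onI continuous_intros)

text \<open>
  Splitting the circle into two half circles leaves at most one point of each product of
  half circles where the characteristic function has modulus one, and this point is the centre.
\<close>

lemma fourier_delta:
  fixes c :: real and j :: int
  assumes "c > 0"
  shows "(\<Sum>\<epsilon><2::nat. \<integral>x. indicator {-(pi * c / 2)..pi * c / 2} x *\<^sub>R cis (j * (x / c + pi * \<epsilon>)) \<partial>lborel) =
    (if j = 0 then 2 * pi * c else 0)"
proof -
  let ?L = "pi * c / 2"
  let ?J = "\<integral>x. indicator {-?L..?L} x *\<^sub>R cis (j / c * x) \<partial>lborel"
  have eq: "indicator {-?L..?L} x *\<^sub>R cis (j * (x / c + pi * \<epsilon>)) = cis (j * pi * \<epsilon>) * (indicator {-?L..?L} x *\<^sub>R cis (j / c * x))" for x and \<epsilon> :: nat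
    by (simp add: cis_mult algebra_simps)
  \<comment> \<open>The second half circle is shifted by pi and contributes a further factor cis (pi
    j) = +-1. For odd j the two cancel; for even nonzero j each integral is zero.\<close>
  have "(\<Sum>\<epsilon><2::nat. \<integral>x. indicator {-?L..?L} x *\<^sub>R cis (j * (x / c + pi * \<epsilon>)) \<partial>lborel) = (1 + cis (pi * j)) * ?J"
    unfolding eq integral_mult_right_zero by (simp add: numeral_2_eq_2 algebra_simps)
  also have "\<dots> = (if j = 0 then 2 * pi * c else 0)"
  proof (cases "even j")
    case True
    then obtain l where l: "j = 2 * l" by blast
    have "j / c * ?L = pi * l" using assms by (simp add: l)
    then have "sin (j / c * ?L) = 0" using sin_npi_int[of l] by (simp add: mult.commute)
    then show ?thesis using assms by (subst integral_cis_Icc) (auto simp: cis_conv_exp)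
  next
    case False
    then obtain l where l: "j = 2 * l + 1" using oddE by blast
    have "pi * j = 2 * pi * l + pi" by (simp add: l algebra_simps)
    then have "cis (pi * j) = cis (2 * pi * l) * cis pi" by (simp only: cis_mult)
    also have "cis (2 * pi * l) = 1" by (rule cis_multiple_2pi) auto
    finally show ?thesis using False by auto
  qed
  finally show ?thesis .
qed

text \<open>The Fourier variable conjugate to the weight of \<open>e\<close>. Endpoints with index
  at least \<open>k\<close> carry no variable, since no constraint is imposed there.\<close>

definition edge_angle :: "nat \<Rightarrow> ('e \<Rightarrow> nat set) \<Rightarrow> (nat \<Rightarrow> real) \<Rightarrow> 'e \<Rightarrow> real" where
  "edge_angle k ends \<theta> e = (\<Sum>v | v < k \<and> v \<in> ends e. \<theta> v)"

lemma prod_cis: "(\<Prod>i\<in>A. cis (f i)) = cis (\<Sum>i\<in>A. f i)"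
  by (induction A rule: infinite_finite_induct) (auto simp: cis_mult)

lemma sum_incident_swap:
  assumes "finite E"
  shows "(\<Sum>v<k. (\<Sum>e | e \<in> E \<and> v \<in> ends e. m e) * \<theta> v) = (\<Sum>e\<in>E. m e * edge_angle k ends \<theta> e)"
proof -
  have "(\<Sum>v<k. (\<Sum>e | e \<in> E \<and> v \<in> ends e. m e) * \<theta> v) = (\<Sum>v<k. \<Sum>e | e \<in> E \<and> v \<in> ends e. m e * \<theta> v)"
    by (simp add: sum_distrib_right)
  also have "\<dots> = (\<Sum>e\<in>E. \<Sum>v | v \<in> {..<k} \<and> v \<in> ends e. m e * \<theta> v)"
    using assms by (intro sum.swap_restrict) auto
  finally show ?thesis by (simp add: edge_angle_def sum_distrib_left)
qed

text \<open>One copy of \<open>fourier_delta\<close> per vertex detects that vertex's constraint.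
  Exchanging the incidence sums turns the total phase into a sum over edges, so the sum over
  \<open>m\<close> factors into one characteristic function per edge. The scale \<open>c\<close> is
  left free for the later choice sqrt n.\<close>

lemma constrained_sum_fourier:
  fixes b :: "int \<Rightarrow> real" and n :: int and c :: real
  assumes fin: "finite E" "finite B" and c: "c > 0"
  defines "L \<equiv> pi * c / 2"
  shows "of_real (\<Sum>m | m \<in> E \<rightarrow>\<^sub>E B \<and> (\<forall>v<k. (\<Sum>e | e \<in> E \<and> v \<in> ends e. m e) = n). \<Prod>e\<in>E. b (m e)) * of_real (2 * pi * c) ^ k =
    (\<Sum>\<epsilon>\<in>{..<k} \<rightarrow>\<^sub>E {..<2::nat}. \<integral>x. (\<Prod>v<k. indicator {-L..L} (x v)) *\<^sub>R
       (cis (- (n * (\<Sum>v<k. x v / c + pi * \<epsilon> v))) *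
         (\<Prod>e\<in>E. \<Sum>j\<in>B. of_real (b j) * cis (j * edge_angle k ends (\<lambda>v. x v / c + pi * \<epsilon> v) e)))
       \<partial>Pi\<^sub>M {..<k} (\<lambda>_. lborel))"
proof -
  interpret product_sigma_finite "\<lambda>_. lborel :: real measure" by standard
  let ?P = "Pi\<^sub>M {..<k} (\<lambda>_. lborel :: real measure)"
  let ?X = "E \<rightarrow>\<^sub>E B"
  have finX: "finite ?X" using fin by (intro finite_PiE) auto
  define s where "s m v = (\<Sum>e | e \<in> E \<and> v \<in> ends e. m e) - n" for m v
  define ang where "ang \<epsilon> x v = x v / c + pi * real (\<epsilon> v)" for \<epsilon> :: "nat \<Rightarrow> nat" and x v
  have int1: "integrable lborel (\<lambda>x. indicator {-L..L} x *\<^sub>R cis (j * (x / c + pi * real l)))" for j :: int and l :: nat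
    using integrable_indicator_cis[of L "j / c" "j * pi * real l"] by (simp add: algebra_simps)
  have intP: "integrable ?P (\<lambda>x. \<Prod>v<k. indicator {-L..L} (x v) *\<^sub>R cis (s m v * (x v / c + pi * real (\<epsilon> v))))" for m and \<epsilon> :: "nat \<Rightarrow> nat"
    by (rule product_integrable_prod) (auto intro: int1)
  have prod_eq: "(\<Prod>v<k. indicator {-L..L} (x v) *\<^sub>R cis (s m v * (x v / c + pi * real (\<epsilon> v)))) =
     (\<Prod>v<k. indicator {-L..L} (x v)) *\<^sub>R (cis (- (n * (\<Sum>v<k. ang \<epsilon> x v))) * (\<Prod>e\<in>E. cis (m e * edge_angle k ends (ang \<epsilon> x) e)))"
    for x m and \<epsilon> :: "nat \<Rightarrow> nat"
  proof -
    have "(\<Prod>v<k. indicator {-L..L} (x v) *\<^sub>R cis (s m v * (x v / c + pi * real (\<epsilon> v)))) =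
      (\<Prod>v<k. indicator {-L..L} (x v)) *\<^sub>R cis (\<Sum>v<k. s m v * ang \<epsilon> x v)"
      by (simp add: scaleR_conv_of_real prod.distrib prod_cis ang_def)
    also have "(\<Sum>v<k. s m v * ang \<epsilon> x v) = - (n * (\<Sum>v<k. ang \<epsilon> x v)) + (\<Sum>v<k. (\<Sum>e | e \<in> E \<and> v \<in> ends e. real_of_int (m e)) * ang \<epsilon> x v)"
      by (simp add: s_def left_diff_distrib sum_subtractf sum_distrib_left)
    also have "(\<Sum>v<k. (\<Sum>e | e \<in> E \<and> v \<in> ends e. real_of_int (m e)) * ang \<epsilon> x v) = (\<Sum>e\<in>E. m e * edge_angle k ends (ang \<epsilon> x) e)"
      using fin(1) by (rule sum_incident_swap)
    finally show ?thesis by (simp add: cis_mult prod_cis)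
  qed
  have delta: "(\<Sum>\<epsilon>\<in>{..<k} \<rightarrow>\<^sub>E {..<2::nat}. \<integral>x. (\<Prod>v<k. indicator {-L..L} (x v) *\<^sub>R cis (s m v * (x v / c + pi * real (\<epsilon> v)))) \<partial>?P) =
     of_bool (\<forall>v<k. s m v = 0) * of_real (2 * pi * c) ^ k" for m
  proof -
    have "(\<Sum>\<epsilon>\<in>{..<k} \<rightarrow>\<^sub>E {..<2::nat}. \<integral>x. (\<Prod>v<k. indicator {-L..L} (x v) *\<^sub>R cis (s m v * (x v / c + pi * real (\<epsilon> v)))) \<partial>?P) =
      (\<Sum>\<epsilon>\<in>{..<k} \<rightarrow>\<^sub>E {..<2::nat}. \<Prod>v<k. \<integral>x. indicator {-L..L} x *\<^sub>R cis (s m v * (x / c + pi * real (\<epsilon> v))) \<partial>lborel)"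
      by (intro sum.cong refl product_integral_prod int1) auto
    also have "\<dots> = (\<Prod>v<k. \<Sum>\<epsilon><2::nat. \<integral>x. indicator {-L..L} x *\<^sub>R cis (s m v * (x / c + pi * real \<epsilon>)) \<partial>lborel)"
      by (rule prod_sum_PiE[symmetric]) auto
    also have "\<dots> = (\<Prod>v<k. of_bool (s m v = 0) * of_real (2 * pi * c))"
      unfolding L_def fourier_delta[OF c] by (intro prod.cong) auto
    also have "\<dots> = of_bool (\<forall>v<k. s m v = 0) * of_real (2 * pi * c) ^ k"
      by (auto simp: prod.distrib prod_zero_iff)
    finally show ?thesis .
  qed
  have "of_real (\<Sum>m | m \<in> ?X \<and> (\<forall>v<k. (\<Sum>e | e \<in> E \<and> v \<in> ends e. m e) = n). \<Prod>e\<in>E. b (m e)) * of_real (2 * pi * c) ^ k =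
     (\<Sum>m\<in>?X. of_real (\<Prod>e\<in>E. b (m e)) * (of_bool (\<forall>v<k. s m v = 0) * of_real (2 * pi * c) ^ k :: complex))"
    (is "?lhs = _")
  proof -
    have "(\<Sum>m | m \<in> ?X \<and> (\<forall>v<k. (\<Sum>e | e \<in> E \<and> v \<in> ends e. m e) = n). \<Prod>e\<in>E. b (m e)) = (\<Sum>m\<in>?X. if \<forall>v<k. s m v = 0 then \<Prod>e\<in>E. b (m e) else 0)"
      using finX by (subst sum.inter_filter[symmetric]) (auto simp: s_def)
    then show ?thesis by (simp add: sum_distrib_right of_real_sum) (intro sum.cong refl, auto)
  qed
  also have "\<dots> = (\<Sum>m\<in>?X. \<Sum>\<epsilon>\<in>{..<k} \<rightarrow>\<^sub>E {..<2::nat}. \<integral>x. of_real (\<Prod>e\<in>E. b (m e)) *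
      (\<Prod>v<k. indicator {-L..L} (x v) *\<^sub>R cis (s m v * (x v / c + pi * real (\<epsilon> v)))) \<partial>?P)"
    unfolding delta[symmetric] by (simp add: sum_distrib_left)
  also have "\<dots> = (\<Sum>\<epsilon>\<in>{..<k} \<rightarrow>\<^sub>E {..<2::nat}. \<Sum>m\<in>?X. \<integral>x. of_real (\<Prod>e\<in>E. b (m e)) *
      (\<Prod>v<k. indicator {-L..L} (x v) *\<^sub>R cis (s m v * (x v / c + pi * real (\<epsilon> v)))) \<partial>?P)"
    by (rule sum.swap)
  also have "\<dots> = (\<Sum>\<epsilon>\<in>{..<k} \<rightarrow>\<^sub>E {..<2::nat}. \<integral>x. (\<Sum>m\<in>?X. of_real (\<Prod>e\<in>E. b (m e)) *
      (\<Prod>v<k. indicator {-L..L} (x v) *\<^sub>R cis (s m v * (x v / c + pi * real (\<epsilon> v))))) \<partial>?P)"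
    by (intro sum.cong refl Bochner_Integration.integral_sum[symmetric] integrable_mult_right intP)
  also have "\<dots> = (\<Sum>\<epsilon>\<in>{..<k} \<rightarrow>\<^sub>E {..<2::nat}. \<integral>x. (\<Prod>v<k. indicator {-L..L} (x v)) *\<^sub>R
       (cis (- (n * (\<Sum>v<k. ang \<epsilon> x v))) * (\<Prod>e\<in>E. \<Sum>j\<in>B. of_real (b j) * cis (j * edge_angle k ends (ang \<epsilon> x) e)))
       \<partial>?P)"
  proof (intro sum.cong refl Bochner_Integration.integral_cong)
    fix \<epsilon> :: "nat \<Rightarrow> nat" and x :: "nat \<Rightarrow> real"
    have "(\<Prod>e\<in>E. \<Sum>j\<in>B. of_real (b j) * cis (j * edge_angle k ends (ang \<epsilon> x) e)) =
      (\<Sum>m\<in>?X. \<Prod>e\<in>E. of_real (b (m e)) * cis (m e * edge_angle k ends (ang \<epsilon> x) e))"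
      using fin by (intro prod_sum_PiE) auto
    also have "\<dots> = (\<Sum>m\<in>?X. of_real (\<Prod>e\<in>E. b (m e)) * (\<Prod>e\<in>E. cis (m e * edge_angle k ends (ang \<epsilon> x) e)))"
      by (simp add: prod.distrib)
    finally show "(\<Sum>m\<in>?X. of_real (\<Prod>e\<in>E. b (m e)) *
      (\<Prod>v<k. indicator {-L..L} (x v) *\<^sub>R cis (s m v * (x v / c + pi * real (\<epsilon> v))))) =
      (\<Prod>v<k. indicator {-L..L} (x v)) *\<^sub>R
       (cis (- (n * (\<Sum>v<k. ang \<epsilon> x v))) * (\<Prod>e\<in>E. \<Sum>j\<in>B. of_real (b j) * cis (j * edge_angle k ends (ang \<epsilon> x) e)))"
      unfolding prod_eq by (simp add: sum_distrib_left scaleR_conv_of_real mult_ac)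
  qed
  finally show ?thesis unfolding ang_def .
qed

section \<open>Constrained sums of binomial weights\<close>

text \<open>The distribution of 2H fair trials, recentred at \<open>c\<close>; an even number of
  trials makes the centre an integer. For j < c - H the conversion \<open>nat\<close> truncates and
  the formula is no longer a binomial weight, so sums run over c - H to c + H.\<close>

definition shifted_binomial :: "nat \<Rightarrow> int \<Rightarrow> int \<Rightarrow> real" where
  "shifted_binomial H c j = real ((2 * H) choose nat (j - c + int H)) / 4 ^ H"

text \<open>By the binomial theorem the sum is a power of 1 + cis phi = 2 cos (phi/2) cis (phi/2).
  Its 2H half phases cancel the recentring by H, and 2^(2H) cancels 4^H.\<close>

lemma shifted_binomial_characteristic:
  fixes \<phi> :: real
  shows "(\<Sum>j\<in>{c - int H..c + int H}. of_real (shifted_binomial H c j) * cis (j * \<phi>)) =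
    of_real (cos (\<phi> / 2) ^ (2 * H)) * cis (c * \<phi>)"
proof -
  have half: "1 + cis \<phi> = 2 * of_real (cos (\<phi> / 2)) * cis (\<phi> / 2)"
  proof -
    have "sin \<phi> = 2 * sin (\<phi> / 2) * cos (\<phi> / 2)" "cos \<phi> = 2 * cos (\<phi> / 2) ^ 2 - 1"
      using sin_double[of "\<phi> / 2"] cos_double_cos[of "\<phi> / 2"] by simp_all
    then show ?thesis by (simp add: complex_eq_iff power2_eq_square)
  qed
  have "(\<Sum>j\<in>{c - int H..c + int H}. of_real (shifted_binomial H c j) * cis (j * \<phi>)) =
      (\<Sum>l\<le>2 * H. of_real (real ((2 * H) choose l) / 4 ^ H) * cis ((of_int c - of_nat H + of_nat l) * \<phi>))"
    by (rule sum.reindex_bij_witness[where i = "\<lambda>l. c - int H + int l" and j = "\<lambda>j. nat (j - c + int H)"])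
       (auto simp: shifted_binomial_def)
  also have "\<dots> = (\<Sum>l\<le>2 * H. of_nat ((2 * H) choose l) * cis \<phi> ^ l * 1 ^ (2 * H - l)) * cis ((of_int c - of_nat H) * \<phi>) / 4 ^ H"
    unfolding sum_distrib_right sum_divide_distrib
  proof (intro sum.cong refl)
    fix l
    have "cis ((of_int c - of_nat H + of_nat l) * \<phi>) = cis \<phi> ^ l * cis ((of_int c - of_nat H) * \<phi>)"
      by (simp only: Complex.DeMoivre cis_mult) (simp add: algebra_simps)
    then show "of_real (real ((2 * H) choose l) / 4 ^ H) * cis ((of_int c - of_nat H + of_nat l) * \<phi>) =
        of_nat ((2 * H) choose l) * cis \<phi> ^ l * 1 ^ (2 * H - l) * cis ((of_int c - of_nat H) * \<phi>) / 4 ^ H"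
      by simp
  qed
  also have "(\<Sum>l\<le>2 * H. of_nat ((2 * H) choose l) * cis \<phi> ^ l * 1 ^ (2 * H - l)) = (1 + cis \<phi>) ^ (2 * H)"
    unfolding binomial_ring[symmetric] by (simp add: add.commute)
  also have "\<dots> = 4 ^ H * of_real (cos (\<phi> / 2) ^ (2 * H)) * cis (H * \<phi>)"
  proof -
    have "(2 ^ H)\<^sup>2 = (4 :: complex) ^ H"
      by (simp only: power_mult[symmetric] mult.commute[of H]) (simp add: power_mult)
    then show ?thesis
      unfolding half by (simp add: power_mult_distrib power_mult Complex.DeMoivre algebra_simps)
  qed
  finally show ?thesis by (simp add: cis_mult algebra_simps)
qed

text \<open>The characteristic function of the recentred binomial relative to n/d;
  \<open>\<delta>\<close> is the distance from n/d to the integer centre.\<close>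

definition wave :: "nat \<Rightarrow> real \<Rightarrow> real \<Rightarrow> complex" where
  "wave H \<delta> \<phi> = of_real (cos (\<phi> / 2) ^ (2 * H)) * cis (\<delta> * \<phi>)"

lemma measurable_cis [measurable]: "cis \<in> borel_measurable borel"
  by (intro borel_measurable_continuous_onI continuous_intros)

lemma measurable_wave [measurable]: "wave H \<delta> \<in> borel_measurable borel"
  unfolding wave_def by measurable

text \<open>The squared cosine is 1 - sin^2, at most exp (-sin^2). The exponent has the form in
  which the coercivity estimates bound the vertex angles.\<close>

lemma norm_wave_le: "norm (wave H \<delta> \<phi>) \<le> exp (- (real H * (sin (\<phi> / 2))\<^sup>2))"
proof -
  have "norm (wave H \<delta> \<phi>) = ((cos (\<phi> / 2))\<^sup>2) ^ H"
    unfolding wave_def norm_mult norm_of_real norm_cis by (simp add: power_mult)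
  also have "\<dots> = (1 - (sin (\<phi> / 2))\<^sup>2) ^ H" by (simp only: cos_squared_eq)
  also have "\<dots> \<le> exp (- ((sin (\<phi> / 2))\<^sup>2)) ^ H"
  proof (rule power_mono)
    show "1 - (sin (\<phi> / 2))\<^sup>2 \<le> exp (- (sin (\<phi> / 2))\<^sup>2)" using exp_ge_add_one_self[of "- (sin (\<phi> / 2))\<^sup>2"] by simp
    show "0 \<le> 1 - (sin (\<phi> / 2))\<^sup>2" by (simp add: cos_squared_eq[symmetric])
  qed
  also have "\<dots> = exp (- (real H * (sin (\<phi> / 2))\<^sup>2))" by (simp add: exp_of_nat_mult[symmetric])
  finally show ?thesis .
qed

text \<open>A weak form of Jordan's inequality. Up to pi/3 the cosine is at least 1/2; beyond it the
  sine is at least 2/3, while t/3 < 2/3.\<close>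

lemma abs_sin_ge:
  assumes "\<bar>t\<bar> \<le> pi / 2"
  shows "\<bar>t\<bar> / 3 \<le> \<bar>sin t\<bar>"
proof -
  have pos: "t / 3 \<le> sin t" if t: "0 \<le> t" "t \<le> pi / 2" for t :: real
  proof (cases "t \<le> pi / 3")
    case True
    have "(\<lambda>t. sin t - t / 3) 0 \<le> (\<lambda>t. sin t - t / 3) t"
    proof (rule DERIV_nonneg_imp_nondecreasing[OF t(1)])
      fix x assume x: "0 \<le> x" "x \<le> t"
      have "cos (pi / 3) \<le> cos x" using x True by (intro cos_monotone_0_pi_le) auto
      then have "1/3 \<le> cos x" by (simp add: cos_60)
      then show "\<exists>y. ((\<lambda>t. sin t - t / 3) has_real_derivative y) (at x) \<and> 0 \<le> y"
        by (intro exI[of _ "cos x - 1/3"]) (auto intro!: derivative_eq_intros)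
    qed
    then show ?thesis by simp
  next
    case False
    have "sin (pi / 3) \<le> sin t" using False t by (intro sin_monotone_2pi_le) auto
    moreover have "sin (pi / 3) \<ge> 4 / 6"
    proof -
      have "4 / 3 = sqrt ((4/3)\<^sup>2)" by simp
      also have "\<dots> \<le> sqrt 3" by (intro real_sqrt_le_mono) (simp add: power2_eq_square)
      finally show ?thesis by (simp add: sin_60)
    qed
    moreover have "t / 3 \<le> 4 / 6" using t pi_less_4 by simp
    ultimately show ?thesis by linarith
  qed
  show ?thesis
  proof (cases "t \<ge> 0")
    case True
    then show ?thesis using pos[of t] assms by auto
  next
    case False
    then show ?thesis using pos[of "- t"] assms by auto
  qed
qed

text \<open>The modulus converges because 2n ln cos (x / (2 sqrt n)) tends to -x^2/4; the phase
  tends to 1 because the offset stays bounded.\<close>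

lemma wave_LIMSEQ:
  assumes H: "(\<lambda>n. real (H n) / real n) \<longlonglongrightarrow> \<tau>" and \<delta>: "\<And>n. \<bar>\<delta> n\<bar> \<le> 1"
  shows "(\<lambda>n. wave (H n) (\<delta> n) (x / sqrt (real n))) \<longlonglongrightarrow> of_real (exp (- (\<tau> * x\<^sup>2 / 4)))"
proof -
  have lim: "(\<lambda>n. 2 * real n * ln (cos (\<bar>x\<bar> / sqrt (real n) / 2))) \<longlonglongrightarrow> - \<bar>x\<bar>\<^sup>2 / 4"
  proof (cases "x = 0")
    case False
    then have "\<bar>x\<bar> > 0" by simp
    then show ?thesis by real_asymp (simp add: power2_eq_square)
  qed simp
  have ev: "eventually (\<lambda>n. cos (\<bar>x\<bar> / sqrt (real n) / 2) > 0) sequentially"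
  proof -
    have "(\<lambda>n. cos (\<bar>x\<bar> / sqrt (real n) / 2)) \<longlonglongrightarrow> cos 0"
      by (intro tendsto_cos) real_asymp
    then show ?thesis by (rule order_tendstoD) simp
  qed
  have "(\<lambda>n. exp (real (H n) / real n * (2 * real n * ln (cos (\<bar>x\<bar> / sqrt (real n) / 2))))) \<longlonglongrightarrow> exp (\<tau> * (- \<bar>x\<bar>\<^sup>2 / 4))"
    by (intro tendsto_exp tendsto_mult H lim)
  moreover have "eventually (\<lambda>n. exp (real (H n) / real n * (2 * real n * ln (cos (\<bar>x\<bar> / sqrt (real n) / 2)))) =
      cos (x / sqrt (real n) / 2) ^ (2 * H n)) sequentially"
    using ev eventually_gt_at_top[of 0]
  proof eventually_elim
    case (elim n)
    have "cos (x / sqrt (real n) / 2) = cos \<bar>x / sqrt (real n) / 2\<bar>" by (rule cos_abs_real[symmetric])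
    also have "\<bar>x / sqrt (real n) / 2\<bar> = \<bar>x\<bar> / sqrt (real n) / 2" by simp
    finally have c: "cos (x / sqrt (real n) / 2) = cos (\<bar>x\<bar> / sqrt (real n) / 2)" .
    have "cos (\<bar>x\<bar> / sqrt (real n) / 2) ^ (2 * H n) = exp (ln (cos (\<bar>x\<bar> / sqrt (real n) / 2))) ^ (2 * H n)"
      using elim by simp
    also have "\<dots> = exp (real (2 * H n) * ln (cos (\<bar>x\<bar> / sqrt (real n) / 2)))" by (simp only: exp_of_nat_mult)
    also have "real (2 * H n) * ln (cos (\<bar>x\<bar> / sqrt (real n) / 2)) = real (H n) / real n * (2 * real n * ln (cos (\<bar>x\<bar> / sqrt (real n) / 2)))"
      using elim by simp
    finally show ?case unfolding c by simp
  qed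
  ultimately have 1: "(\<lambda>n. cos (x / sqrt (real n) / 2) ^ (2 * H n)) \<longlonglongrightarrow> exp (\<tau> * (- \<bar>x\<bar>\<^sup>2 / 4))"
    by (rule Lim_transform_eventually)
  have "(\<lambda>n. \<delta> n * (x / sqrt (real n))) \<longlonglongrightarrow> 0"
  proof (rule Lim_null_comparison)
    show "eventually (\<lambda>n. norm (\<delta> n * (x / sqrt (real n))) \<le> \<bar>x\<bar> / sqrt (real n)) sequentially"
    proof (rule always_eventually, rule allI)
      fix n
      have "\<bar>\<delta> n\<bar> * \<bar>x / sqrt (real n)\<bar> \<le> 1 * \<bar>x / sqrt (real n)\<bar>" by (intro mult_right_mono \<delta>) auto
      then show "norm (\<delta> n * (x / sqrt (real n))) \<le> \<bar>x\<bar> / sqrt (real n)" by (simp add: abs_mult)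
    qed
    show "(\<lambda>n. \<bar>x\<bar> / sqrt (real n)) \<longlonglongrightarrow> 0" by real_asymp
  qed
  then have "(\<lambda>n. exp (\<i> * of_real (\<delta> n * (x / sqrt (real n))))) \<longlonglongrightarrow> exp (\<i> * of_real 0)"
    by (intro tendsto_intros)
  then have "(\<lambda>n. cis (\<delta> n * (x / sqrt (real n)))) \<longlonglongrightarrow> cis 0"
    by (simp only: cis_conv_exp)
  then have "(\<lambda>n. wave (H n) (\<delta> n) (x / sqrt (real n))) \<longlonglongrightarrow> of_real (exp (\<tau> * (- \<bar>x\<bar>\<^sup>2 / 4))) * cis 0"
    unfolding wave_def by (intro tendsto_mult tendsto_of_real 1)
  then show ?thesis by simp
qed

section \<open>Fourier integrals: domination and limits on the half circles\<close>

lemma edge_angle_shift: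
  "edge_angle k ends (\<lambda>v. x v / s + pi * real (\<epsilon> v)) e = edge_angle k ends x e / s + pi * real (\<Sum>v | v < k \<and> v \<in> ends e. \<epsilon> v)"
  by (simp add: edge_angle_def sum.distrib sum_divide_distrib sum_distrib_left)

lemma measurable_edge_angle [measurable]:
  "(\<lambda>x. edge_angle k ends x e) \<in> borel_measurable (Pi\<^sub>M {..<k} (\<lambda>_. lborel))"
  unfolding edge_angle_def by measurable

text \<open>
  The half circle around \<open>\<epsilon>\<^sub>v \<pi>\<close> is used for the angle at \<open>v\<close>, and angles are measured in units
  of \<open>1 / sqrt n\<close>.
\<close>

definition fourier_integrand ::
    "nat \<Rightarrow> 'e set \<Rightarrow> ('e \<Rightarrow> nat set) \<Rightarrow> nat \<Rightarrow> real \<Rightarrow> nat \<Rightarrow> (nat \<Rightarrow> nat) \<Rightarrow> (nat \<Rightarrow> real) \<Rightarrow> complex" where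
  "fourier_integrand k E ends H \<delta> n \<epsilon> x = (\<Prod>v<k. indicator {-(pi * sqrt (real n) / 2)..pi * sqrt (real n) / 2} (x v)) *\<^sub>R
     (\<Prod>e\<in>E. wave H \<delta> (edge_angle k ends x e / sqrt (real n) + pi * real (\<Sum>v | v < k \<and> v \<in> ends e. \<epsilon> v)))"

lemma measurable_fourier_integrand [measurable]:
  "fourier_integrand k E ends H \<delta> n \<epsilon> \<in> borel_measurable (Pi\<^sub>M {..<k} (\<lambda>_. lborel))"
  unfolding fourier_integrand_def by measurable

text \<open>All k constrained vertices have degree d, so the sum of the edge angles is d times the
  sum of the vertex angles. The phase of the right-hand side n is thereby shared out as n/d per
  edge, which turns the centre \<open>c\<close> into the bounded offset c - n/d.\<close>

lemma constrained_sum_eq_fourier_integrals: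
  fixes c :: int and n :: nat
  assumes fin: "finite E" and n: "n > 0" and d: "d > 0"
    and deg: "\<And>v. v < k \<Longrightarrow> card {e \<in> E. v \<in> ends e} = d"
  shows "of_real (\<Sum>m | m \<in> E \<rightarrow>\<^sub>E {c - int H..c + int H} \<and> (\<forall>v<k. (\<Sum>e | e \<in> E \<and> v \<in> ends e. m e) = int n).
       \<Prod>e\<in>E. shifted_binomial H c (m e)) * of_real (2 * pi * sqrt (real n)) ^ k =
    (\<Sum>\<epsilon>\<in>{..<k} \<rightarrow>\<^sub>E {..<2::nat}. \<integral>x. fourier_integrand k E ends H (real_of_int c - real n / real d) n \<epsilon> x \<partial>Pi\<^sub>M {..<k} (\<lambda>_. lborel))"
proof -
  let ?s = "sqrt (real n)" and ?\<delta> = "real_of_int c - real n / real d"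
  have "cis (- (real_of_int (int n) * (\<Sum>v<k. x v / ?s + pi * real (\<epsilon> v)))) *
         (\<Prod>e\<in>E. \<Sum>j\<in>{c - int H..c + int H}. of_real (shifted_binomial H c j) * cis (j * edge_angle k ends (\<lambda>v. x v / ?s + pi * \<epsilon> v) e)) =
     (\<Prod>e\<in>E. wave H ?\<delta> (edge_angle k ends x e / ?s + pi * real (\<Sum>v | v < k \<and> v \<in> ends e. \<epsilon> v)))"
    for x and \<epsilon> :: "nat \<Rightarrow> nat"
  proof -
    let ?ang = "\<lambda>v. x v / ?s + pi * real (\<epsilon> v)"
    let ?\<Phi> = "edge_angle k ends ?ang"
    have "(\<Sum>v<k. (\<Sum>e | e \<in> E \<and> v \<in> ends e. 1) * ?ang v) = (\<Sum>e\<in>E. 1 * ?\<Phi> e)"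
      using fin by (rule sum_incident_swap)
    then have "real d * (\<Sum>v<k. ?ang v) = (\<Sum>e\<in>E. ?\<Phi> e)" using deg by (simp add: sum_distrib_left)
    then have "(\<Sum>v<k. ?ang v) = (\<Sum>e\<in>E. ?\<Phi> e) / real d" using d by (simp add: field_simps)
    then have "- (real_of_int (int n) * (\<Sum>v<k. ?ang v)) = (\<Sum>e\<in>E. - (real n / real d) * ?\<Phi> e)"
      by (simp only: sum_distrib_left[symmetric]) simp
    then have "cis (- (real_of_int (int n) * (\<Sum>v<k. ?ang v))) = (\<Prod>e\<in>E. cis (- (real n / real d) * ?\<Phi> e))"
      by (simp only: prod_cis)
    then have "cis (- (real_of_int (int n) * (\<Sum>v<k. ?ang v))) *
         (\<Prod>e\<in>E. \<Sum>j\<in>{c - int H..c + int H}. of_real (shifted_binomial H c j) * cis (j * ?\<Phi> e)) =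
      (\<Prod>e\<in>E. cis (- (real n / real d) * ?\<Phi> e) * (of_real (cos (?\<Phi> e / 2) ^ (2 * H)) * cis (c * ?\<Phi> e)))"
      by (simp only: shifted_binomial_characteristic prod.distrib)
    also have "\<dots> = (\<Prod>e\<in>E. wave H ?\<delta> (?\<Phi> e))"
      unfolding wave_def by (intro prod.cong refl) (simp add: cis_mult algebra_simps)
    finally show ?thesis unfolding edge_angle_shift .
  qed
  note eq = this
  show ?thesis
    by (subst constrained_sum_fourier) (use fin n in \<open>auto simp only: eq fourier_integrand_def[abs_def] of_nat_0_less_iff real_sqrt_gt_0_iff finite_atLeastAtMost_int\<close>)
qed

text \<open>A Gaussian bound independent of n. On a half circle the squared sine of the vertex angle
  is at least x^2 / (9n) (9 is the square of the 3 in \<open>abs_sin_ge\<close>) and is unaffected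
  by shifts by pi; coercivity passes this on to the edge angles in the exponent.\<close>

lemma norm_fourier_integrand_le:
  assumes fin: "finite E" and C: "C > 0"
    and coer: "\<And>\<theta>. (\<Sum>v<k. (sin (\<theta> v))\<^sup>2) \<le> C * (\<Sum>e\<in>E. (sin (edge_angle k ends \<theta> e / 2))\<^sup>2)"
    and n: "n > 0" and H: "real H \<ge> a * real n" and a: "a > 0"
  shows "norm (fourier_integrand k E ends H \<delta> n \<epsilon> x) \<le> (\<Prod>v<k. exp (- (a / (9 * C) * (x v)\<^sup>2)))"
proof (cases "\<forall>v<k. \<bar>x v\<bar> \<le> pi * sqrt (real n) / 2")
  case False
  then have "(\<Prod>v<k. indicator {-(pi * sqrt (real n) / 2)..pi * sqrt (real n) / 2} (x v)) = (0::real)"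
    by (force simp: prod_zero_iff indicator_def)
  then have "fourier_integrand k E ends H \<delta> n \<epsilon> x = 0"
    by (simp only: fourier_integrand_def scaleR_zero_left)
  then show ?thesis by (simp add: prod_nonneg)
next
  case True
  let ?s = "sqrt (real n)"
  let ?ang = "\<lambda>v. x v / ?s + pi * real (\<epsilon> v)"
  let ?\<Phi> = "edge_angle k ends ?ang"
  have s: "?s > 0" using n by simp
  have sinv: "(x v)\<^sup>2 / (9 * real n) \<le> (sin (?ang v))\<^sup>2" if "v < k" for v
  proof -
    have "\<bar>x v / ?s\<bar> \<le> pi / 2" using True that s by (simp add: abs_divide divide_le_eq)
    then have "\<bar>x v / ?s\<bar> / 3 \<le> \<bar>sin (x v / ?s)\<bar>" by (rule abs_sin_ge)
    also have "\<bar>sin (x v / ?s)\<bar> = \<bar>sin (?ang v)\<bar>" by (simp add: sin_add sin_npi2 cos_npi2 abs_mult mult.commute)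
    finally have "(\<bar>x v / ?s\<bar> / 3)\<^sup>2 \<le> \<bar>sin (?ang v)\<bar>\<^sup>2" by (intro power_mono) auto
    then show ?thesis using s by (simp add: power_divide)
  qed
  have "norm (fourier_integrand k E ends H \<delta> n \<epsilon> x) \<le> (\<Prod>e\<in>E. norm (wave H \<delta> (?\<Phi> e)))"
  proof -
    have "\<bar>\<Prod>v<k. indicator {-(pi * ?s / 2)..pi * ?s / 2} (x v)\<bar> \<le> (1::real)"
      by (simp add: abs_prod prod_le_1)
    then have "\<bar>\<Prod>v<k. indicator {-(pi * ?s / 2)..pi * ?s / 2} (x v)\<bar> * (\<Prod>e\<in>E. norm (wave H \<delta> (?\<Phi> e))) \<le> 1 * (\<Prod>e\<in>E. norm (wave H \<delta> (?\<Phi> e)))"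
      by (intro mult_right_mono prod_nonneg) auto
    then show ?thesis unfolding fourier_integrand_def edge_angle_shift[symmetric] by (simp add: prod_norm[symmetric])
  qed
  also have "\<dots> \<le> (\<Prod>e\<in>E. exp (- (real H * (sin (?\<Phi> e / 2))\<^sup>2)))"
    by (intro prod_mono conjI norm_wave_le) auto
  also have "\<dots> = exp (- (real H * (\<Sum>e\<in>E. (sin (?\<Phi> e / 2))\<^sup>2)))"
    using fin by (simp add: exp_sum[symmetric] sum_negf sum_distrib_left)
  also have "\<dots> \<le> exp (- (\<Sum>v<k. a / (9 * C) * (x v)\<^sup>2))"
  proof -
    have "(\<Sum>v<k. a / (9 * C) * (x v)\<^sup>2) = a * real n / C * (\<Sum>v<k. (x v)\<^sup>2 / (9 * real n))"
      using n by (simp add: sum_distrib_left mult.commute)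
    also have "\<dots> \<le> a * real n / C * (\<Sum>v<k. (sin (?ang v))\<^sup>2)"
      using a C by (intro mult_left_mono sum_mono sinv) auto
    also have "\<dots> \<le> a * real n / C * (C * (\<Sum>e\<in>E. (sin (?\<Phi> e / 2))\<^sup>2))"
      using a C by (intro mult_left_mono coer) auto
    also have "\<dots> = a * real n * (\<Sum>e\<in>E. (sin (?\<Phi> e / 2))\<^sup>2)" using C by simp
    also have "\<dots> \<le> real H * (\<Sum>e\<in>E. (sin (?\<Phi> e / 2))\<^sup>2)" by (intro mult_right_mono H sum_nonneg) auto
    finally show ?thesis by simp
  qed
  also have "\<dots> = (\<Prod>v<k. exp (- (a / (9 * C) * (x v)\<^sup>2)))" by (simp add: exp_sum[symmetric] sum_negf)
  finally show ?thesis .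
qed

lemma integrable_prod_exp_neg_square:
  fixes b :: real and k :: nat
  assumes "b > 0"
  shows "integrable (Pi\<^sub>M {..<k} (\<lambda>_. lborel)) (\<lambda>x. \<Prod>v<k. exp (- (b * (x v)\<^sup>2)))"
proof -
  interpret product_sigma_finite "\<lambda>_. lborel :: real measure" by standard
  have "integrable lborel (\<lambda>y::real. exp (- (b * y\<^sup>2)))"
  proof (rule integrableI_nonneg)
    have "(\<integral>\<^sup>+y. ennreal (exp (- (b * y\<^sup>2))) \<partial>lborel) = ennreal (sqrt (2 * pi / (2 * b)))"
      using nn_integral_exp_neg_square[of "2 * b" 0] assms by simp
    then show "(\<integral>\<^sup>+y. ennreal (exp (- (b * y\<^sup>2))) \<partial>lborel) < \<infinity>" by simp
  qed auto
  then show ?thesis by (intro product_integrable_prod) auto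
qed

lemma fourier_integral_LIMSEQ:
  assumes fin: "finite E" and C: "C > 0"
    and coer: "\<And>\<theta>. (\<Sum>v<k. (sin (\<theta> v))\<^sup>2) \<le> C * (\<Sum>e\<in>E. (sin (edge_angle k ends \<theta> e / 2))\<^sup>2)"
    and H: "(\<lambda>n. real (H n) / real n) \<longlonglongrightarrow> \<tau>" and \<tau>: "\<tau> > 0"
    and lim: "\<And>x. (\<lambda>n. fourier_integrand k E ends (H n) (\<delta> n) n \<epsilon> x) \<longlonglongrightarrow> f x"
    and [measurable]: "f \<in> borel_measurable (Pi\<^sub>M {..<k} (\<lambda>_. lborel))"
  shows "(\<lambda>n. \<integral>x. fourier_integrand k E ends (H n) (\<delta> n) n \<epsilon> x \<partial>Pi\<^sub>M {..<k} (\<lambda>_. lborel)) \<longlonglongrightarrow> (\<integral>x. f x \<partial>Pi\<^sub>M {..<k} (\<lambda>_. lborel))"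
proof -
  have "eventually (\<lambda>n. real (H n) / real n > \<tau> / 2) sequentially"
    using H by (rule order_tendstoD) (use \<tau> in simp)
  then have "eventually (\<lambda>n. n > 0 \<and> real (H n) \<ge> \<tau> / 2 * real n) sequentially"
    using eventually_gt_at_top[of 0] by eventually_elim (auto simp: field_simps)
  then obtain n0 where n0: "\<And>n. n \<ge> n0 \<Longrightarrow> n > 0 \<and> real (H n) \<ge> \<tau> / 2 * real n"
    by (auto simp: eventually_sequentially)
  show ?thesis
  \<comment> \<open>The dominating function is valid only once \<open>H n\<close> is at least
    \<open>\<tau> / 2 * real n\<close>, so the sequences start at \<open>n0\<close>.\<close>
  proof (rule LIMSEQ_offset[of _ n0], rule integral_dominated_convergence)
    show "integrable (Pi\<^sub>M {..<k} (\<lambda>_. lborel)) (\<lambda>x. \<Prod>v<k. exp (- (\<tau> / 2 / (9 * C) * (x v)\<^sup>2)))"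
      by (rule integrable_prod_exp_neg_square) (use \<tau> C in simp)
    show "AE x in Pi\<^sub>M {..<k} (\<lambda>_. lborel). (\<lambda>n. fourier_integrand k E ends (H (n + n0)) (\<delta> (n + n0)) (n + n0) \<epsilon> x) \<longlonglongrightarrow> f x"
      using LIMSEQ_ignore_initial_segment[OF lim] by simp
    show "AE x in Pi\<^sub>M {..<k} (\<lambda>_. lborel). norm (fourier_integrand k E ends (H (n + n0)) (\<delta> (n + n0)) (n + n0) \<epsilon> x)
        \<le> (\<Prod>v<k. exp (- (\<tau> / 2 / (9 * C) * (x v)\<^sup>2)))" for n
      using n0[of "n + n0"] \<tau> by (intro AE_I2 norm_fourier_integrand_le[OF fin C coer]) auto
  qed measurable
qed

definition edge_parity :: "nat \<Rightarrow> ('e \<Rightarrow> nat set) \<Rightarrow> (nat \<Rightarrow> nat) \<Rightarrow> 'e \<Rightarrow> nat" where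
  "edge_parity k ends \<epsilon> e = (\<Sum>v | v < k \<and> v \<in> ends e. \<epsilon> v)"

text \<open>The half-circle centres at which every edge angle is a multiple of 2 pi, so that every
  wave has modulus one there.\<close>

abbreviation even_shifts :: "nat \<Rightarrow> 'e set \<Rightarrow> ('e \<Rightarrow> nat set) \<Rightarrow> (nat \<Rightarrow> nat) set" where
  "even_shifts k E ends \<equiv> {\<epsilon> \<in> {..<k} \<rightarrow>\<^sub>E {..<2}. \<forall>e\<in>E. even (edge_parity k ends \<epsilon> e)}"

lemma indicator_box_LIMSEQ:
  "(\<lambda>n. \<Prod>v<k. indicator {-(pi * sqrt (real n) / 2)..pi * sqrt (real n) / 2} (x v)) \<longlonglongrightarrow> (1::real)"
proof -
  have "(\<lambda>n. indicator {-(pi * sqrt (real n) / 2)..pi * sqrt (real n) / 2} y :: real) \<longlonglongrightarrow> 1" for y :: real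
  proof (rule tendsto_eventually)
    have "filterlim (\<lambda>n. pi * sqrt (real n) / 2) at_top sequentially" by real_asymp
    then have "eventually (\<lambda>n. pi * sqrt (real n) / 2 \<ge> \<bar>y\<bar>) sequentially" by (simp add: filterlim_at_top)
    then show "eventually (\<lambda>n. indicator {-(pi * sqrt (real n) / 2)..pi * sqrt (real n) / 2} y = (1::real)) sequentially"
    proof eventually_elim
      case (elim n)
      then have "y \<in> {-(pi * sqrt (real n) / 2)..pi * sqrt (real n) / 2}"
        unfolding atLeastAtMost_iff by linarith
      then show ?case by simp
    qed
  qed
  then have "(\<lambda>n. \<Prod>v<k. indicator {-(pi * sqrt (real n) / 2)..pi * sqrt (real n) / 2} (x v)) \<longlonglongrightarrow> (\<Prod>v<k. 1::real)"
    by (intro tendsto_prod)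
  then show ?thesis by simp
qed

lemma fourier_integrand_LIMSEQ_zero_shift:
  assumes H: "(\<lambda>n. real (H n) / real n) \<longlonglongrightarrow> \<tau>" and \<delta>: "\<And>n. \<bar>\<delta> n\<bar> \<le> 1"
    and \<epsilon>: "\<And>e. e \<in> E \<Longrightarrow> edge_parity k ends \<epsilon> e = 0"
  shows "(\<lambda>n. fourier_integrand k E ends (H n) (\<delta> n) n \<epsilon> x) \<longlonglongrightarrow>
    of_real (exp (- (\<tau> / 4 * (\<Sum>e\<in>E. (edge_angle k ends x e)\<^sup>2))))"
proof -
  have "(\<lambda>n. fourier_integrand k E ends (H n) (\<delta> n) n \<epsilon> x) \<longlonglongrightarrow>
      1 *\<^sub>R (\<Prod>e\<in>E. of_real (exp (- (\<tau> * (edge_angle k ends x e)\<^sup>2 / 4))))"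
    unfolding fourier_integrand_def edge_parity_def[symmetric]
  proof (intro tendsto_scaleR indicator_box_LIMSEQ tendsto_prod)
    fix e assume "e \<in> E"
    then show "(\<lambda>n. wave (H n) (\<delta> n) (edge_angle k ends x e / sqrt (real n) + pi * real (edge_parity k ends \<epsilon> e)))
      \<longlonglongrightarrow> of_real (exp (- (\<tau> * (edge_angle k ends x e)\<^sup>2 / 4)))"
      using wave_LIMSEQ[OF H \<delta>] \<epsilon> by simp
  qed
  also have "(\<Prod>e\<in>E. of_real (exp (- (\<tau> * (edge_angle k ends x e)\<^sup>2 / 4)))) =
     (of_real (exp (- (\<tau> / 4 * (\<Sum>e\<in>E. (edge_angle k ends x e)\<^sup>2)))) :: complex)"
    by (cases "finite E") (simp_all add: exp_sum[symmetric] sum_negf sum_distrib_left flip: of_real_prod)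
  finally show ?thesis by simp
qed

text \<open>One odd edge suffices: half an odd multiple of pi turns its cosine into a sine up to
  sign, and this sine tends to zero. All other factors are at most one in modulus.\<close>

lemma fourier_integrand_LIMSEQ_odd_shift:
  assumes fin: "finite E" and H: "(\<lambda>n. real (H n) / real n) \<longlonglongrightarrow> \<tau>" and \<tau>: "\<tau> > 0"
    and e: "e \<in> E" "odd (edge_parity k ends \<epsilon> e)"
  shows "(\<lambda>n. fourier_integrand k E ends (H n) (\<delta> n) n \<epsilon> x) \<longlonglongrightarrow> 0"
proof (rule Lim_null_comparison)
  let ?s = "edge_parity k ends \<epsilon> e" and ?\<phi> = "edge_angle k ends x"
  have "eventually (\<lambda>n. real (H n) / real n > 0) sequentially" using H by (rule order_tendstoD) (rule \<tau>)
  then show "eventually (\<lambda>n. norm (fourier_integrand k E ends (H n) (\<delta> n) n \<epsilon> x) \<le> (sin (?\<phi> e / sqrt (real n) / 2))\<^sup>2) sequentially"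
  proof eventually_elim
    case (elim n)
    then have Hn: "H n \<noteq> 0" by (cases "H n = 0") auto
    let ?w = "\<lambda>e. wave (H n) (\<delta> n) (?\<phi> e / sqrt (real n) + pi * real (edge_parity k ends \<epsilon> e))"
    let ?y = "?\<phi> e / sqrt (real n) / 2"
    have le1: "norm (?w e) \<le> 1" for e
      by (rule order_trans[OF norm_wave_le]) simp
    have "norm (?w e) = ((cos (?y + pi * real ?s / 2))\<^sup>2) ^ H n"
      unfolding wave_def norm_mult norm_of_real norm_cis by (simp add: power_mult add_divide_distrib)
    also have "(cos (?y + pi * real ?s / 2))\<^sup>2 = (sin ?y)\<^sup>2"
    proof -
      obtain l where l: "?s = 2 * l + 1" using e(2) oddE by blast
      have "pi * real ?s / 2 = real l * pi + pi / 2" by (simp add: l algebra_simps)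
      moreover have "cos (real l * pi + pi / 2) = 0" "(sin (real l * pi + pi / 2))\<^sup>2 = 1"
        by (simp_all add: cos_add sin_add cos_npi power_mult[symmetric])
      ultimately have "cos (pi * real ?s / 2) = 0" "(sin (pi * real ?s / 2))\<^sup>2 = 1"
        by (simp_all only:)
      then show ?thesis by (simp add: cos_add power_mult_distrib)
    qed
    also have "((sin ?y)\<^sup>2) ^ H n \<le> ((sin ?y)\<^sup>2) ^ 1"
      by (rule power_decreasing) (use Hn in \<open>auto simp: abs_square_le_1\<close>)
    finally have we: "norm (?w e) \<le> (sin ?y)\<^sup>2" by simp
    have "norm (fourier_integrand k E ends (H n) (\<delta> n) n \<epsilon> x) =
       \<bar>\<Prod>v<k. indicator {-(pi * sqrt (real n) / 2)..pi * sqrt (real n) / 2} (x v)\<bar> * (norm (?w e) * (\<Prod>e\<in>E - {e}. norm (?w e)))"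
      unfolding fourier_integrand_def edge_parity_def[symmetric] norm_scaleR
      by (subst prod.remove[OF fin e(1)]) (simp add: norm_mult prod_norm[symmetric])
    also have "\<dots> \<le> 1 * ((sin ?y)\<^sup>2 * 1)"
      by (intro mult_mono we prod_le_1 mult_nonneg_nonneg prod_nonneg conjI le1) (auto simp: abs_prod intro!: prod_le_1 prod_nonneg)
    finally show ?case by simp
  qed
  have "(\<lambda>n. a / sqrt (real n) / 2) \<longlonglongrightarrow> 0" for a :: real by real_asymp
  then have "(\<lambda>n. (sin (?\<phi> e / sqrt (real n) / 2))\<^sup>2) \<longlonglongrightarrow> (sin 0)\<^sup>2" by (intro tendsto_intros)
  then show "(\<lambda>n. (sin (?\<phi> e / sqrt (real n) / 2))\<^sup>2) \<longlonglongrightarrow> 0" by simp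
qed

text \<open>A shift by 2 pi l changes the cosine of the half angle only by a sign, which the even
  exponent removes; a constant phase remains.\<close>

lemma wave_shift_even:
  "wave H \<delta> (\<phi> + pi * real (2 * l)) = wave H \<delta> \<phi> * cis (\<delta> * pi * real (2 * l))"
proof -
  have "(\<phi> + pi * real (2 * l)) / 2 = \<phi> / 2 + real l * pi" by (simp add: field_simps)
  then have "cos ((\<phi> + pi * real (2 * l)) / 2) = cos (\<phi> / 2 + real l * pi)" by (simp only:)
  also have "\<dots> = (- 1) ^ l * cos (\<phi> / 2)" by (simp add: cos_add cos_npi)
  finally have "cos ((\<phi> + pi * real (2 * l)) / 2) = (- 1) ^ l * cos (\<phi> / 2)" .
  then have "cos ((\<phi> + pi * real (2 * l)) / 2) ^ (2 * H) = cos (\<phi> / 2) ^ (2 * H)"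
    by (simp add: power_mult_distrib power_mult[symmetric])
  moreover have "cis (\<delta> * (\<phi> + pi * real (2 * l))) = cis (\<delta> * \<phi>) * cis (\<delta> * pi * real (2 * l))"
    by (simp add: cis_mult algebra_simps)
  ultimately show ?thesis by (simp add: wave_def)
qed

text \<open>The phases left by \<open>wave_shift_even\<close> multiply to 1. Their total parity is
  even, so the integer centre contributes a multiple of 2 pi. By regularity it also equals d times
  the sum of \<open>\<epsilon>\<close>, so the part with n/d is pi times n times that sum, even by
  assumption.\<close>

lemma fourier_integrand_even_shift:
  fixes c :: int and n :: nat
  assumes fin: "finite E" and d: "d > 0" and deg: "\<And>v. v < k \<Longrightarrow> card {e \<in> E. v \<in> ends e} = d"
    and \<epsilon>: "\<And>e. e \<in> E \<Longrightarrow> even (edge_parity k ends \<epsilon> e)" and n: "even (n * (\<Sum>v<k. \<epsilon> v))"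
  shows "fourier_integrand k E ends H (real_of_int c - real n / real d) n \<epsilon> x =
    fourier_integrand k E ends H (real_of_int c - real n / real d) n (\<lambda>_. 0) x"
proof -
  let ?\<delta> = "real_of_int c - real n / real d"
  let ?p = "edge_parity k ends \<epsilon>"
  have "(\<Prod>e\<in>E. wave H ?\<delta> (edge_angle k ends x e / sqrt (real n) + pi * real (?p e))) =
      (\<Prod>e\<in>E. wave H ?\<delta> (edge_angle k ends x e / sqrt (real n)) * cis (?\<delta> * pi * real (?p e)))"
  proof (rule prod.cong[OF refl])
    fix e assume "e \<in> E"
    then obtain l where "?p e = 2 * l" using \<epsilon> by blast
    then show "wave H ?\<delta> (edge_angle k ends x e / sqrt (real n) + pi * real (?p e)) =
       wave H ?\<delta> (edge_angle k ends x e / sqrt (real n)) * cis (?\<delta> * pi * real (?p e))"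
      by (simp only: wave_shift_even)
  qed
  also have "\<dots> = (\<Prod>e\<in>E. wave H ?\<delta> (edge_angle k ends x e / sqrt (real n))) * cis (?\<delta> * pi * (\<Sum>e\<in>E. real (?p e)))"
    by (simp add: prod.distrib prod_cis sum_distrib_left)
  also have "cis (?\<delta> * pi * (\<Sum>e\<in>E. real (?p e))) = 1"
  proof -
    have "(\<Sum>v<k. (\<Sum>e | e \<in> E \<and> v \<in> ends e. 1) * real (\<epsilon> v)) = (\<Sum>e\<in>E. 1 * edge_angle k ends (\<lambda>v. real (\<epsilon> v)) e)"
      using fin by (rule sum_incident_swap)
    then have s: "(\<Sum>e\<in>E. real (?p e)) = real d * (\<Sum>v<k. real (\<epsilon> v))"
      using deg by (simp add: edge_angle_def edge_parity_def sum_distrib_left)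
    obtain a where a: "n * (\<Sum>v<k. \<epsilon> v) = 2 * a" using n by blast
    have "even (\<Sum>e\<in>E. ?p e)" using \<epsilon> by (intro dvd_sum) auto
    then obtain b where b: "(\<Sum>e\<in>E. ?p e) = 2 * b" by blast
    have A: "n * (\<Sum>v<k. real (\<epsilon> v)) = 2 * real a" using arg_cong[OF a, of real] by simp
    have B: "(\<Sum>e\<in>E. real (?p e)) = 2 * real b" using arg_cong[OF b, of real] by simp
    have "real n / real d * (\<Sum>e\<in>E. real (?p e)) = 2 * real a" unfolding s using d A by simp
    then have "real n / real d * (2 * real b) = 2 * real a" unfolding B .
    moreover have "?\<delta> * pi * (2 * real b) = pi * (c * (2 * real b) - real n / real d * (2 * real b))"
      by (simp only: left_diff_distrib right_diff_distrib mult_ac)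
    ultimately have "?\<delta> * pi * (2 * real b) = 2 * pi * real_of_int (c * int b - int a)"
      by (simp only:) (simp add: algebra_simps)
    then show ?thesis unfolding B by (simp only:) (rule cis_multiple_2pi, simp)
  qed
  finally show ?thesis unfolding fourier_integrand_def edge_parity_def[symmetric] by (simp add: edge_parity_def)
qed

text \<open>The even shifts all contribute exactly the integral of the zero shift, and the other
  shifts contribute nothing in the limit; hence the factor \<open>card G\<close>. Restricting n to
  \<open>N\<close> is what makes the phases of the even shifts agree.\<close>

theorem binomial_constrained_sum_tendsto:
  fixes E :: "'e set" and c :: "nat \<Rightarrow> int"
  assumes fin: "finite E" and d: "d > 0" and deg: "\<And>v. v < k \<Longrightarrow> card {e \<in> E. v \<in> ends e} = d"
    and C: "C > 0"
    and coer: "\<And>\<theta>. (\<Sum>v<k. (sin (\<theta> v))\<^sup>2) \<le> C * (\<Sum>e\<in>E. (sin (edge_angle k ends \<theta> e / 2))\<^sup>2)"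
    and H: "(\<lambda>n. real (H n) / real n) \<longlonglongrightarrow> \<tau>" and \<tau>: "\<tau> > 0"
    and c: "\<And>n. \<bar>real_of_int (c n) - real n / real d\<bar> \<le> 1"
  defines "G \<equiv> even_shifts k E ends"
  assumes N: "\<And>n \<epsilon>. n \<in> N \<Longrightarrow> \<epsilon> \<in> G \<Longrightarrow> even (n * (\<Sum>v<k. \<epsilon> v))"
  shows "((\<lambda>n. (\<Sum>m | m \<in> E \<rightarrow>\<^sub>E {c n - int (H n)..c n + int (H n)} \<and> (\<forall>v<k. (\<Sum>e | e \<in> E \<and> v \<in> ends e. m e) = int n).
       \<Prod>e\<in>E. shifted_binomial (H n) (c n) (m e)) * (2 * pi * sqrt (real n)) ^ k) \<longlongrightarrow>
     real (card G) * (\<integral>x. exp (- (\<tau> / 4 * (\<Sum>e\<in>E. (edge_angle k ends x e)\<^sup>2))) \<partial>Pi\<^sub>M {..<k} (\<lambda>_. lborel)))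
     (inf sequentially (principal N))"
    (is "((\<lambda>n. ?T n * _ ^ k) \<longlongrightarrow> _ * ?J) _")
proof -
  let ?D = "{..<k} \<rightarrow>\<^sub>E {..<2::nat}" and ?P = "Pi\<^sub>M {..<k} (\<lambda>_. lborel :: real measure)"
  define \<delta> where "\<delta> n = real_of_int (c n) - real n / real d" for n
  define I where "I \<epsilon> n = (\<integral>x. fourier_integrand k E ends (H n) (\<delta> n) n \<epsilon> x \<partial>?P)" for \<epsilon> n
  have \<delta>: "\<bar>\<delta> n\<bar> \<le> 1" for n using c by (simp add: \<delta>_def)
  have finD: "finite ?D" by (intro finite_PiE) auto
  have GD: "G \<subseteq> ?D" by (auto simp: G_def)
  have "I (\<lambda>_. 0) \<longlonglongrightarrow> (\<integral>x. of_real (exp (- (\<tau> / 4 * (\<Sum>e\<in>E. (edge_angle k ends x e)\<^sup>2)))) \<partial>?P)"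
    unfolding I_def[abs_def]
    by (intro fourier_integral_LIMSEQ[OF fin C coer H \<tau>] fourier_integrand_LIMSEQ_zero_shift[OF H \<delta>])
       (auto simp: edge_parity_def)
  then have I0: "I (\<lambda>_. 0) \<longlonglongrightarrow> of_real ?J" by (simp only: integral_complex_of_real)
  have Iodd: "I \<epsilon> \<longlonglongrightarrow> 0" if \<epsilon>: "\<epsilon> \<in> ?D - G" for \<epsilon>
  proof -
    obtain e where "e \<in> E" "odd (edge_parity k ends \<epsilon> e)" using \<epsilon> unfolding G_def by blast
    then have "I \<epsilon> \<longlonglongrightarrow> (\<integral>x. 0 \<partial>?P)"
      unfolding I_def[abs_def]
      by (intro fourier_integral_LIMSEQ[OF fin C coer H \<tau>] fourier_integrand_LIMSEQ_odd_shift[OF fin H \<tau>]) auto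
    then show ?thesis by simp
  qed
  have lim: "(\<lambda>n. of_nat (card G) * I (\<lambda>_. 0) n + (\<Sum>\<epsilon>\<in>?D - G. I \<epsilon> n)) \<longlonglongrightarrow> of_nat (card G) * of_real ?J + (\<Sum>\<epsilon>\<in>?D - G. 0)"
    by (intro tendsto_intros I0 Iodd)
  have "((\<lambda>n. of_nat (card G) * I (\<lambda>_. 0) n + (\<Sum>\<epsilon>\<in>?D - G. I \<epsilon> n)) \<longlongrightarrow> of_real (real (card G) * ?J)) (inf sequentially (principal N))"
    by (rule tendsto_mono[OF inf_le1]) (use lim in simp)
  moreover have "eventually (\<lambda>n. of_nat (card G) * I (\<lambda>_. 0) n + (\<Sum>\<epsilon>\<in>?D - G. I \<epsilon> n) = of_real (?T n * (2 * pi * sqrt (real n)) ^ k)) (inf sequentially (principal N))"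
    unfolding eventually_inf_principal using eventually_gt_at_top[of 0]
  proof eventually_elim
    case (elim n)
    show ?case
    proof
      assume n: "n \<in> N"
      have "of_real (?T n * (2 * pi * sqrt (real n)) ^ k) = (\<Sum>\<epsilon>\<in>?D. I \<epsilon> n)"
        using constrained_sum_eq_fourier_integrals[OF fin elim d deg, where c = "c n" and H = "H n"]
        unfolding I_def \<delta>_def by (simp only: of_real_mult of_real_power)
      also have "\<dots> = (\<Sum>\<epsilon>\<in>G. I \<epsilon> n) + (\<Sum>\<epsilon>\<in>?D - G. I \<epsilon> n)"
        by (subst sum.subset_diff[OF GD finD]) (rule add.commute)
      also have "(\<Sum>\<epsilon>\<in>G. I \<epsilon> n) = (\<Sum>\<epsilon>\<in>G. I (\<lambda>_. 0) n)"
      proof (rule sum.cong[OF refl])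
        fix \<epsilon> assume \<epsilon>: "\<epsilon> \<in> G"
        then show "I \<epsilon> n = I (\<lambda>_. 0) n" unfolding I_def \<delta>_def
          by (intro Bochner_Integration.integral_cong refl fourier_integrand_even_shift[OF fin d deg _ N[OF n \<epsilon>]])
             (auto simp: G_def)
      qed
      finally show "of_nat (card G) * I (\<lambda>_. 0) n + (\<Sum>\<epsilon>\<in>?D - G. I \<epsilon> n) = of_real (?T n * (2 * pi * sqrt (real n)) ^ k)"
        by simp
    qed
  qed
  ultimately have "((\<lambda>n. complex_of_real (?T n * (2 * pi * sqrt (real n)) ^ k)) \<longlongrightarrow> of_real (real (card G) * ?J)) (inf sequentially (principal N))"
    by (rule Lim_transform_eventually)
  then show ?thesis by (simp only: tendsto_of_real_iff)
qed

section \<open>Cycles and parity in the base graph\<close>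

definition total_sine :: "nat \<Rightarrow> 'e set \<Rightarrow> ('e \<Rightarrow> nat set) \<Rightarrow> (nat \<Rightarrow> real) \<Rightarrow> real" where
  "total_sine k E ends \<theta> = (\<Sum>e\<in>E. \<bar>sin (edge_angle k ends \<theta> e / 2)\<bar>)"

text \<open>
  With \<open>k = g - 1\<close> the angle at the last vertex is frozen at zero, which corresponds to dropping the
  constraint at that vertex.
\<close>

definition zero_beyond :: "nat \<Rightarrow> (nat \<Rightarrow> 'a::zero) \<Rightarrow> nat \<Rightarrow> 'a" where
  "zero_beyond k \<theta> v = (if v < k then \<theta> v else 0)"

text \<open>Subadditivity lets the absolute sine act as a distance to the multiples of pi when
  errors are propagated along walks.\<close>

lemma abs_sin_add_le: "\<bar>sin (x + y)\<bar> \<le> \<bar>sin x\<bar> + \<bar>sin (y::real)\<bar>"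
proof -
  have "\<bar>sin (x + y)\<bar> \<le> \<bar>sin x\<bar> * \<bar>cos y\<bar> + \<bar>cos x\<bar> * \<bar>sin y\<bar>"
    unfolding sin_add abs_mult[symmetric] by (rule abs_triangle_ineq)
  also have "\<dots> \<le> \<bar>sin x\<bar> * 1 + 1 * \<bar>sin y\<bar>" by (intro add_mono mult_mono) auto
  finally show ?thesis by simp
qed

lemma abs_sin_diff_le: "\<bar>sin (x - y)\<bar> \<le> \<bar>sin x\<bar> + \<bar>sin (y::real)\<bar>"
  using abs_sin_add_le[of x "- y"] by simp

lemma sum_zero_beyond_eq:
  fixes f :: "nat \<Rightarrow> 'a::comm_monoid_add"
  assumes "u \<noteq> v" "ends e = {u, v}"
  shows "(\<Sum>w | w < k \<and> w \<in> ends e. f w) = zero_beyond k f u + zero_beyond k f v"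
proof -
  have "(\<Sum>w | w < k \<and> w \<in> ends e. f w) = (\<Sum>w\<in>{u, v}. zero_beyond k f w)"
    unfolding zero_beyond_def assms(2) by (subst sum.inter_filter[symmetric]) (auto intro!: sum.cong)
  then show ?thesis using assms by simp
qed

context
  fixes g :: nat and E :: "'e set" and ends :: "'e \<Rightarrow> nat set"
  assumes G: "loopless_multigraph {..<g} E ends" and conn: "connected_multigraph {..<g} E ends"
begin

lemma finite_edges: "finite E" and ends_subset: "e \<in> E \<Longrightarrow> ends e \<subseteq> {..<g}" and card_ends: "e \<in> E \<Longrightarrow> card (ends e) = 2"
  using G by (auto simp: loopless_multigraph_def)

lemma ends_neq: "e \<in> E \<Longrightarrow> ends e = {u, v} \<Longrightarrow> u \<noteq> v"
  using card_ends[of e] by auto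

lemma edge_angle_eq: "e \<in> E \<Longrightarrow> ends e = {u, v} \<Longrightarrow> edge_angle k ends \<theta> e = zero_beyond k \<theta> u + zero_beyond k \<theta> v"
  unfolding edge_angle_def using ends_neq by (intro sum_zero_beyond_eq) auto

lemma edge_parity_eq: "e \<in> E \<Longrightarrow> ends e = {u, v} \<Longrightarrow> edge_parity k ends \<epsilon> e = zero_beyond k \<epsilon> u + zero_beyond k \<epsilon> v"
  unfolding edge_parity_def using ends_neq by (intro sum_zero_beyond_eq) auto

lemma abs_sin_edge_le_total_sine: "e \<in> E \<Longrightarrow> \<bar>sin (edge_angle k ends \<theta> e / 2)\<bar> \<le> total_sine k E ends \<theta>"
  unfolding total_sine_def by (rule member_le_sum) (auto simp: finite_edges)

lemma connected_induct [consumes 2, case_names base step]: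
  assumes "w < g" "v < g" "P w" "\<And>x y e. P x \<Longrightarrow> e \<in> E \<Longrightarrow> ends e = {x, y} \<Longrightarrow> P y"
  shows "P v"
proof -
  have "(w, v) \<in> {(x, y). \<exists>e\<in>E. ends e = {x, y}}\<^sup>*"
    using conn assms by (auto simp: connected_multigraph_def)
  then show ?thesis by induction (use assms in auto)
qed

text \<open>Across an edge the new vertex angle is the edge angle minus the old vertex angle, and
  the sine of the edge angle is at most twice that of its half. A bound at one vertex thus spreads
  through the connected graph.\<close>

lemma abs_sin_vertex_le_total_sine:
  assumes w: "w < g" "\<exists>K. \<forall>\<theta>. \<bar>sin (zero_beyond k \<theta> w)\<bar> \<le> K * total_sine k E ends \<theta>" and v: "v < g"
  shows "\<exists>K. \<forall>\<theta>. \<bar>sin (zero_beyond k \<theta> v)\<bar> \<le> K * total_sine k E ends \<theta>"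
  using w(1) v
proof (induction rule: connected_induct)
  case base
  show ?case by (rule w(2))
next
  case (step x y e)
  then obtain K where K: "\<And>\<theta>. \<bar>sin (zero_beyond k \<theta> x)\<bar> \<le> K * total_sine k E ends \<theta>" by blast
  have "\<bar>sin (zero_beyond k \<theta> y)\<bar> \<le> (2 + K) * total_sine k E ends \<theta>" for \<theta>
  proof -
    let ?h = "edge_angle k ends \<theta> e / 2"
    have "zero_beyond k \<theta> y = (?h + ?h) - zero_beyond k \<theta> x" using edge_angle_eq[OF step(2,3)] by simp
    then have "\<bar>sin (zero_beyond k \<theta> y)\<bar> \<le> \<bar>sin (?h + ?h)\<bar> + \<bar>sin (zero_beyond k \<theta> x)\<bar>"
      by (simp only: abs_sin_diff_le)
    also have "\<bar>sin (?h + ?h)\<bar> \<le> \<bar>sin ?h\<bar> + \<bar>sin ?h\<bar>" by (rule abs_sin_add_le)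
    finally have "\<bar>sin (zero_beyond k \<theta> y)\<bar> \<le> \<bar>sin ?h\<bar> + \<bar>sin ?h\<bar> + \<bar>sin (zero_beyond k \<theta> x)\<bar>" by simp
    then show ?thesis using K[of \<theta>] abs_sin_edge_le_total_sine[OF step(2), of k \<theta>] by (simp add: algebra_simps)
  qed
  then show ?case by blast
qed

text \<open>Linear bounds by \<open>total_sine\<close> become quadratic ones by the Cauchy-Schwarz
  inequality, at the price of the factor \<open>card E\<close>.\<close>

lemma coercive_from_vertex:
  assumes "k \<le> g" "w < g" "\<exists>K. \<forall>\<theta>. \<bar>sin (zero_beyond k \<theta> w)\<bar> \<le> K * total_sine k E ends \<theta>"
  shows "\<exists>C>0. \<forall>\<theta>. (\<Sum>v<k. (sin (\<theta> v))\<^sup>2) \<le> C * (\<Sum>e\<in>E. (sin (edge_angle k ends \<theta> e / 2))\<^sup>2)"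
proof -
  have "\<forall>v\<in>{..<g}. \<exists>K. \<forall>\<theta>. \<bar>sin (zero_beyond k \<theta> v)\<bar> \<le> K * total_sine k E ends \<theta>"
    using abs_sin_vertex_le_total_sine[OF assms(2,3)] by blast
  then obtain K where K: "\<And>v \<theta>. v < g \<Longrightarrow> \<bar>sin (zero_beyond k \<theta> v)\<bar> \<le> K v * total_sine k E ends \<theta>"
    by (metis bchoice lessThan_iff)
  \<comment> \<open>The summand 1 ensures positivity.\<close>
  define C where "C = 1 + (\<Sum>v<k. (K v)\<^sup>2) * real (card E)"
  have "(\<Sum>v<k. (sin (\<theta> v))\<^sup>2) \<le> C * (\<Sum>e\<in>E. (sin (edge_angle k ends \<theta> e / 2))\<^sup>2)" for \<theta>
  proof -
    let ?Q = "\<Sum>e\<in>E. (sin (edge_angle k ends \<theta> e / 2))\<^sup>2"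
    have Q: "?Q \<ge> 0" by (intro sum_nonneg) auto
    have "(total_sine k E ends \<theta>)\<^sup>2 \<le> (\<Sum>e\<in>E. \<bar>sin (edge_angle k ends \<theta> e / 2)\<bar>\<^sup>2) * real (card E)"
      unfolding total_sine_def by (rule sum_squared_le_sum_of_squares)
    then have S: "(total_sine k E ends \<theta>)\<^sup>2 \<le> ?Q * real (card E)" by simp
    have "(\<Sum>v<k. (sin (\<theta> v))\<^sup>2) \<le> (\<Sum>v<k. (K v)\<^sup>2 * (?Q * real (card E)))"
    proof (rule sum_mono)
      fix v assume v: "v \<in> {..<k}"
      then have "\<bar>sin (\<theta> v)\<bar> \<le> K v * total_sine k E ends \<theta>" using K[of v \<theta>] assms(1) by (simp add: zero_beyond_def)
      then have "\<bar>sin (\<theta> v)\<bar>\<^sup>2 \<le> (K v * total_sine k E ends \<theta>)\<^sup>2" by (intro power_mono) auto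
      also have "\<dots> \<le> (K v)\<^sup>2 * (?Q * real (card E))" unfolding power_mult_distrib by (intro mult_left_mono S) auto
      finally show "(sin (\<theta> v))\<^sup>2 \<le> (K v)\<^sup>2 * (?Q * real (card E))" by simp
    qed
    also have "\<dots> = (\<Sum>v<k. (K v)\<^sup>2) * real (card E) * ?Q"
      by (subst sum_distrib_right[symmetric]) (simp add: mult_ac)
    also have "\<dots> \<le> C * ?Q" using Q unfolding C_def by (intro mult_right_mono) auto
    finally show ?thesis .
  qed
  moreover have "C > 0" unfolding C_def by (intro add_pos_nonneg mult_nonneg_nonneg sum_nonneg) auto
  ultimately show ?thesis by blast
qed

lemma g_pos: "g > 0"
  using conn by (auto simp: connected_multigraph_def)

lemma coercive_rooted:
  "\<exists>C>0. \<forall>\<theta>. (\<Sum>v<g - 1. (sin (\<theta> v))\<^sup>2) \<le> C * (\<Sum>e\<in>E. (sin (edge_angle (g - 1) ends \<theta> e / 2))\<^sup>2)"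
proof (rule coercive_from_vertex)
  show "\<exists>K. \<forall>\<theta>. \<bar>sin (zero_beyond (g - 1) \<theta> (g - 1))\<bar> \<le> K * total_sine (g - 1) E ends \<theta>"
    by (intro exI[of _ 0]) (simp add: zero_beyond_def)
qed (use g_pos in auto)

text \<open>
  Alternating sums of edge angles along an odd closed walk through a vertex give twice the angle
  at that vertex; walks are recorded as paths in the bipartite double cover.
\<close>

lemma coercive_nonbipartite:
  assumes nb: "\<not> bipartite {..<g} E ends"
  shows "\<exists>C>0. \<forall>\<theta>. (\<Sum>v<g. (sin (\<theta> v))\<^sup>2) \<le> C * (\<Sum>e\<in>E. (sin (edge_angle g ends \<theta> e / 2))\<^sup>2)"
proof -
  \<comment> \<open>One step in the double cover; the Boolean is the parity of the length of the
    walk so far.\<close>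
  define R where "R = {((x, b), (y, \<not> b)) | x y b. \<exists>e\<in>E. ends e = {x, y}}"
  define reach where "reach b v \<longleftrightarrow> ((0, False), (v, b)) \<in> R\<^sup>*" for b and v :: nat
  have reach_step: "reach (\<not> b) y" if "reach b x" "e \<in> E" "ends e = {x, y}" for b x y e
  proof -
    have "((x, b), (y, \<not> b)) \<in> R" using that by (auto simp: R_def)
    then show ?thesis using that(1) unfolding reach_def by (rule rtrancl_into_rtrancl[rotated])
  qed
  have reach_some: "\<exists>b. reach b v" if "v < g" for v
    using g_pos that
  proof (induction rule: connected_induct)
    case base
    show ?case by (auto simp: reach_def)
  next
    case (step x y e)
    then show ?case using reach_step by blast
  qed
  \<comment> \<open>The alternating sum of the edge angles along a walk telescopes to the difference
    of the end angles after an even number of steps, and to their sum after an odd number.\<close>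
  have reach_sin: "\<exists>K. \<forall>\<theta>. \<bar>sin ((zero_beyond g \<theta> 0 - (if snd q then -1 else 1) * zero_beyond g \<theta> (fst q)) / 2)\<bar> \<le> K * total_sine g E ends \<theta>"
    if "((0, False), q) \<in> R\<^sup>*" for q
    using that
  proof (induction rule: rtrancl_induct)
    case base
    show ?case by (intro exI[of _ 0]) simp
  next
    case (step q q')
    from step(2) obtain x y b e where q: "q = (x, b)" "q' = (y, \<not> b)" "e \<in> E" "ends e = {x, y}" by (auto simp: R_def)
    from step(3) obtain K where K: "\<And>\<theta>. \<bar>sin ((zero_beyond g \<theta> 0 - (if b then -1 else 1) * zero_beyond g \<theta> x) / 2)\<bar> \<le> K * total_sine g E ends \<theta>"
      unfolding q by auto
    have "\<bar>sin ((zero_beyond g \<theta> 0 - (if \<not> b then -1 else 1) * zero_beyond g \<theta> y) / 2)\<bar> \<le> (K + 1) * total_sine g E ends \<theta>" for \<theta>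
    proof -
      let ?a = "(zero_beyond g \<theta> 0 - (if b then -1 else 1) * zero_beyond g \<theta> x) / 2" and ?h = "edge_angle g ends \<theta> e / 2"
      have "(zero_beyond g \<theta> 0 - (if \<not> b then -1 else 1) * zero_beyond g \<theta> y) / 2 = (if b then ?a - ?h else ?a + ?h)"
        using edge_angle_eq[OF q(3,4)] by (simp add: field_simps)
      then have "\<bar>sin ((zero_beyond g \<theta> 0 - (if \<not> b then -1 else 1) * zero_beyond g \<theta> y) / 2)\<bar> \<le> \<bar>sin ?a\<bar> + \<bar>sin ?h\<bar>"
        using abs_sin_add_le[of ?a ?h] abs_sin_diff_le[of ?a ?h] by presburger
      then show ?thesis using K[of \<theta>] abs_sin_edge_le_total_sine[OF q(3), of g \<theta>] by (simp add: algebra_simps)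
    qed
    then show ?case unfolding q fst_conv snd_conv by blast
  qed
  \<comment> \<open>Otherwise the vertices reached with even parity and those reached with odd
    parity form a bipartition.\<close>
  have "\<exists>w<g. reach False w \<and> reach True w"
  proof (rule ccontr)
    assume no: "\<not> ?thesis"
    have "bipartite {..<g} E ends" unfolding bipartite_def
    proof (intro exI conjI ballI)
      show "{v. v < g \<and> reach False v} \<union> {v. v < g \<and> reach True v} = {..<g}"
        using reach_some by (auto, metis (full_types))
      show "{v. v < g \<and> reach False v} \<inter> {v. v < g \<and> reach True v} = {}" using no by auto
      fix e assume e: "e \<in> E"
      then obtain x y where xy: "ends e = {x, y}" using card_ends[OF e] by (auto simp: card_2_iff)
      have lt: "x < g" "y < g" using ends_subset[OF e] xy by auto
      obtain b where b: "reach b x" using reach_some[OF lt(1)] by blast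
      have "reach (\<not> b) y" by (rule reach_step[OF b e xy])
      then show "\<exists>x\<in>{v. v < g \<and> reach False v}. \<exists>y\<in>{v. v < g \<and> reach True v}. ends e = {x, y}"
        using b lt xy by (cases b) (auto simp: insert_commute)
    qed
    then show False using nb by simp
  qed
  then obtain w where w: "w < g" "reach False w" "reach True w" by blast
  obtain K1 where K1: "\<And>\<theta>. \<bar>sin ((zero_beyond g \<theta> 0 - zero_beyond g \<theta> w) / 2)\<bar> \<le> K1 * total_sine g E ends \<theta>"
    using reach_sin[of "(w, False)"] w by (auto simp: reach_def)
  obtain K2 where K2: "\<And>\<theta>. \<bar>sin ((zero_beyond g \<theta> 0 + zero_beyond g \<theta> w) / 2)\<bar> \<le> K2 * total_sine g E ends \<theta>"
    using reach_sin[of "(w, True)"] w by (auto simp: reach_def)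
  have "\<bar>sin (zero_beyond g \<theta> w)\<bar> \<le> (K2 + K1) * total_sine g E ends \<theta>" for \<theta>
  proof -
    have "zero_beyond g \<theta> w = (zero_beyond g \<theta> 0 + zero_beyond g \<theta> w) / 2 - (zero_beyond g \<theta> 0 - zero_beyond g \<theta> w) / 2"
      by (simp add: field_simps)
    then have "\<bar>sin (zero_beyond g \<theta> w)\<bar> \<le> \<bar>sin ((zero_beyond g \<theta> 0 + zero_beyond g \<theta> w) / 2)\<bar> + \<bar>sin ((zero_beyond g \<theta> 0 - zero_beyond g \<theta> w) / 2)\<bar>"
      using abs_sin_diff_le by metis
    then show ?thesis using K1[of \<theta>] K2[of \<theta>] by (simp add: algebra_simps)
  qed
  then show ?thesis using w(1) by (intro coercive_from_vertex[of g w]) auto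
qed

text \<open>The values are 0 or 1, so an even sum along an edge forces equality at its ends;
  connectedness does the rest.\<close>

lemma zero_beyond_constant:
  assumes \<epsilon>: "\<epsilon> \<in> {..<k} \<rightarrow>\<^sub>E {..<2::nat}" "\<forall>e\<in>E. even (edge_parity k ends \<epsilon> e)" and v: "v < g" "w < g"
  shows "zero_beyond k \<epsilon> v = zero_beyond k \<epsilon> w"
  using v(2,1)
proof (induction rule: connected_induct)
  case (step x y e)
  have two: "zero_beyond k \<epsilon> z < 2" for z using PiE_mem[OF \<epsilon>(1), of z] by (auto simp: zero_beyond_def)
  have "even (zero_beyond k \<epsilon> x + zero_beyond k \<epsilon> y)"
    using \<epsilon>(2) step edge_parity_eq[of e x y k \<epsilon>] by auto
  then have "zero_beyond k \<epsilon> x = zero_beyond k \<epsilon> y" using two[of x] two[of y] by (auto simp: less_2_cases_iff)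
  then show ?case using step by simp
qed simp

lemma even_shifts_rooted:
  "even_shifts (g - 1) E ends = {\<lambda>v\<in>{..<g - 1}. 0}"
proof (intro equalityI subsetI)
  fix \<epsilon> assume "\<epsilon> \<in> even_shifts (g - 1) E ends"
  then have \<epsilon>: "\<epsilon> \<in> {..<g - 1} \<rightarrow>\<^sub>E {..<2::nat}" "\<forall>e\<in>E. even (edge_parity (g - 1) ends \<epsilon> e)" by auto
  have "\<epsilon> v = 0" if "v < g - 1" for v
    using zero_beyond_constant[OF \<epsilon>, of v "g - 1"] that by (simp add: zero_beyond_def)
  then show "\<epsilon> \<in> {\<lambda>v\<in>{..<g - 1}. 0}" using \<epsilon>(1) by (auto simp: fun_eq_iff PiE_def extensional_def)
qed (auto simp: edge_parity_def)

lemma even_shifts_full: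
  "even_shifts g E ends = {\<lambda>v\<in>{..<g}. 0, \<lambda>v\<in>{..<g}. 1}"
proof (intro equalityI subsetI)
  fix \<epsilon> assume "\<epsilon> \<in> even_shifts g E ends"
  then have \<epsilon>: "\<epsilon> \<in> {..<g} \<rightarrow>\<^sub>E {..<2::nat}" "\<forall>e\<in>E. even (edge_parity g ends \<epsilon> e)" by auto
  obtain a where a: "\<epsilon> 0 = a" by simp
  have "\<epsilon> v = a" if "v < g" for v
    using zero_beyond_constant[OF \<epsilon>, of v 0] that a by (simp add: zero_beyond_def)
  then have "\<epsilon> = (\<lambda>v\<in>{..<g}. a)" using \<epsilon>(1) by (auto simp: fun_eq_iff PiE_def extensional_def)
  moreover have "a = 0 \<or> a = 1" using PiE_mem[OF \<epsilon>(1), of 0] g_pos a by auto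
  ultimately show "\<epsilon> \<in> {\<lambda>v\<in>{..<g}. 0, \<lambda>v\<in>{..<g}. 1}" by (metis insertCI)
next
  fix \<epsilon> assume "\<epsilon> \<in> {\<lambda>v\<in>{..<g}. 0::nat, \<lambda>v\<in>{..<g}. 1}"
  then obtain a where a: "\<epsilon> = (\<lambda>v\<in>{..<g}. a)" "a < 2" by auto
  have "edge_parity g ends \<epsilon> e = 2 * a" if e: "e \<in> E" for e
  proof -
    obtain x y where xy: "ends e = {x, y}" using card_ends[OF e] by (auto simp: card_2_iff)
    then have "x < g" "y < g" using ends_subset[OF e] by auto
    then show ?thesis using edge_parity_eq[OF e xy] by (simp add: zero_beyond_def a)
  qed
  then show "\<epsilon> \<in> even_shifts g E ends" using a by auto
qed

lemma card_even_shifts_full: "card {\<lambda>v\<in>{..<g}. 0::nat, \<lambda>v\<in>{..<g}. 1} = 2"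
proof -
  have "(\<lambda>v\<in>{..<g}. 0::nat) \<noteq> (\<lambda>v\<in>{..<g}. 1)" using g_pos by (metis lessThan_iff restrict_apply' zero_neq_one)
  then show ?thesis by simp
qed

section \<open>The Gram matrix of the incidence vectors\<close>

definition gram :: "nat \<Rightarrow> nat \<Rightarrow> real" where
  "gram i j = real (card {e \<in> E. i \<in> ends e \<and> j \<in> ends e})"

lemma quad_form_gram: "quad_form k gram x = (\<Sum>e\<in>E. (edge_angle k ends x e)\<^sup>2)"
proof -
  have "(edge_angle k ends x e)\<^sup>2 = (\<Sum>i<k. \<Sum>j<k. of_bool (i \<in> ends e \<and> j \<in> ends e) * x i * x j)" for e
  proof -
    have "edge_angle k ends x e = (\<Sum>i<k. of_bool (i \<in> ends e) * x i)"
      unfolding edge_angle_def by (rule sum.mono_neutral_cong_left) auto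
    then have "(edge_angle k ends x e)\<^sup>2 = (\<Sum>i<k. \<Sum>j<k. (of_bool (i \<in> ends e) * x i) * (of_bool (j \<in> ends e) * x j))"
      by (simp only: power2_eq_square sum_product)
    also have "\<dots> = (\<Sum>i<k. \<Sum>j<k. of_bool (i \<in> ends e \<and> j \<in> ends e) * x i * x j)"
      by (intro sum.cong refl) auto
    finally show ?thesis .
  qed
  then have "(\<Sum>e\<in>E. (edge_angle k ends x e)\<^sup>2) = (\<Sum>e\<in>E. \<Sum>i<k. \<Sum>j<k. of_bool (i \<in> ends e \<and> j \<in> ends e) * x i * x j)"
    by simp
  also have "\<dots> = (\<Sum>i<k. \<Sum>e\<in>E. \<Sum>j<k. of_bool (i \<in> ends e \<and> j \<in> ends e) * x i * x j)" by (rule sum.swap)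
  also have "\<dots> = (\<Sum>i<k. \<Sum>j<k. \<Sum>e\<in>E. of_bool (i \<in> ends e \<and> j \<in> ends e) * x i * x j)"
    by (rule sum.cong[OF refl], rule sum.swap)
  also have "\<dots> = quad_form k gram x"
    unfolding quad_form_def gram_def
    by (intro sum.cong refl) (simp add: sum_distrib_right[symmetric] finite_edges Int_def)
  finally show ?thesis by simp
qed

text \<open>Positive definiteness is inherited from coercivity: at a zero of the form all edge
  angles vanish, and they do so for every multiple of the vector, which forces the sines of all
  vertex angles to vanish too.\<close>

lemma quad_form_gram_pos:
  assumes coer: "\<And>\<theta>. (\<Sum>v<k. (sin (\<theta> v))\<^sup>2) \<le> C * (\<Sum>e\<in>E. (sin (edge_angle k ends \<theta> e / 2))\<^sup>2)"
    and x: "\<exists>i<k. x i \<noteq> 0"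
  shows "quad_form k gram x > 0"
proof (rule ccontr)
  assume "\<not> ?thesis"
  moreover have "(\<Sum>e\<in>E. (edge_angle k ends x e)\<^sup>2) \<ge> 0" by (intro sum_nonneg) auto
  ultimately have "(\<Sum>e\<in>E. (edge_angle k ends x e)\<^sup>2) = 0" unfolding quad_form_gram by linarith
  then have zero: "edge_angle k ends x e = 0" if "e \<in> E" for e
    using that finite_edges by (simp add: sum_nonneg_eq_0_iff)
  obtain i where i: "i < k" "x i \<noteq> 0" using x by blast
  \<comment> \<open>This scaling brings a nonzero coordinate to pi/2, where the sine is 1.\<close>
  define t where "t = pi / (2 * x i)"
  have "edge_angle k ends (\<lambda>v. t * x v) e = 0" if "e \<in> E" for e
    using zero[OF that] by (simp add: edge_angle_def sum_distrib_left[symmetric])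
  then have "(\<Sum>v<k. (sin (t * x v))\<^sup>2) \<le> 0" using coer[of "\<lambda>v. t * x v"] by simp
  moreover have "(sin (t * x i))\<^sup>2 \<le> (\<Sum>v<k. (sin (t * x v))\<^sup>2)" by (rule member_le_sum) (use i in auto)
  moreover have "t * x i = pi / 2" using i by (simp add: t_def)
  ultimately show False by simp
qed

text \<open>
  \<^const>\<open>gram\<close> is the product of the unsigned incidence matrix with its transpose.
\<close>

lemma gram_matrix_eq:
  assumes reg: "regular {..<g} E ends d"
  shows "mat g g (\<lambda>(i, j). gram i j) = adjacency_matrix g E ends + real d \<cdot>\<^sub>m 1\<^sub>m g"
    and "mat (g - 1) (g - 1) (\<lambda>(i, j). gram i j) =
      mat_delete (adjacency_matrix g E ends) (g - 1) (g - 1) + real d \<cdot>\<^sub>m 1\<^sub>m (g - 1)"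
proof -
  have gram: "gram i j = real (card {e \<in> E. ends e = {i, j}}) + (if i = j then real d else 0)" if "i < g" for i j
  proof (cases "i = j")
    case True
    \<comment> \<open>Without loops the diagonal of the adjacency matrix is zero, and the diagonal
      of \<open>gram\<close> is the degree.\<close>
    then have "{e \<in> E. ends e = {i, j}} = {}" using ends_neq[of _ i j] by blast
    then have "card {e \<in> E. ends e = {i, j}} = 0" by (simp only: card.empty)
    then show ?thesis using True reg \<open>i < g\<close> by (simp add: gram_def regular_def vertex_degree_def)
  next
    case False
    have "i \<in> ends e \<and> j \<in> ends e \<longleftrightarrow> ends e = {i, j}" if "e \<in> E" for e
      using card_ends[OF that] False by (auto simp: card_2_iff)
    then have "{e \<in> E. i \<in> ends e \<and> j \<in> ends e} = {e \<in> E. ends e = {i, j}}" by blast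
    then show ?thesis using False by (simp add: gram_def)
  qed
  show "mat g g (\<lambda>(i, j). gram i j) = adjacency_matrix g E ends + real d \<cdot>\<^sub>m 1\<^sub>m g"
    by (rule eq_matI) (auto simp: adjacency_matrix_def gram)
  show "mat (g - 1) (g - 1) (\<lambda>(i, j). gram i j) =
      mat_delete (adjacency_matrix g E ends) (g - 1) (g - 1) + real d \<cdot>\<^sub>m 1\<^sub>m (g - 1)"
    by (rule eq_matI) (auto simp: adjacency_matrix_def mat_delete_def gram)
qed

end

section \<open>Comparison with binomial weights\<close>

definition edge_weight :: "nat \<Rightarrow> nat \<Rightarrow> real" where
  "edge_weight n m = fact (n - m) / (fact m * fact n)"

definition edge_variance :: "nat \<Rightarrow> real" where
  "edge_variance d = (real d - 1) / (real d * (real d - 2))"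

text \<open>Since 2H fair trials have variance H/2, this H gives variance
  \<open>edge_variance d * real n\<close> up to rounding.\<close>

definition bin_half :: "nat \<Rightarrow> nat \<Rightarrow> nat" where
  "bin_half d n = nat \<lfloor>2 * edge_variance d * real n\<rfloor>"

definition bin_centre :: "nat \<Rightarrow> nat \<Rightarrow> int" where
  "bin_centre d n = int (n div d)"

text \<open>
  The logarithm of \<^const>\<open>edge_weight\<close> divided by \<^const>\<open>shifted_binomial\<close> near the centre, up to a
  linear term that cancels in every balanced sum over the edges.
\<close>

definition log_ratio :: "nat \<Rightarrow> nat \<Rightarrow> real" where
  "log_ratio d n = real n * bethe (1 / real d) - 2 / real d * (real n * ln (real n) - real n)
     + ln ((real d - 1) * real (bin_half d n) / (2 * real n)) / 2"

lemma edge_variance_pos: "d \<ge> 3 \<Longrightarrow> edge_variance d > 0"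
  by (simp add: edge_variance_def)

lemma bin_centre_near: "d > 0 \<Longrightarrow> \<bar>real_of_int (bin_centre d n) - real n / real d\<bar> \<le> 1"
proof -
  assume d: "d > 0"
  have "real n = real d * real (n div d) + real (n mod d)"
    by (metis mult_div_mod_eq of_nat_add of_nat_mult)
  then have "real n / real d = real (n div d) + real (n mod d) / real d" using d by (simp add: field_simps)
  moreover have "0 \<le> real (n mod d) / real d" "real (n mod d) / real d \<le> 1"
    using d by (auto simp: divide_le_eq intro: less_imp_le)
  ultimately show ?thesis by (simp add: bin_centre_def)
qed

lemma bin_half_bounds:
  assumes "d \<ge> 3"
  shows "real (bin_half d n) \<le> 2 * edge_variance d * real n" "2 * edge_variance d * real n - 1 \<le> real (bin_half d n)"
proof -
  have "0 \<le> 2 * edge_variance d * real n" using edge_variance_pos[OF assms] by simp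
  then have "real (bin_half d n) = of_int \<lfloor>2 * edge_variance d * real n\<rfloor>" by (simp add: bin_half_def)
  then show "real (bin_half d n) \<le> 2 * edge_variance d * real n" "2 * edge_variance d * real n - 1 \<le> real (bin_half d n)"
    by linarith+
qed

lemma bin_half_LIMSEQ:
  assumes d: "d \<ge> 3"
  shows "(\<lambda>n. real (bin_half d n) / real n) \<longlonglongrightarrow> 2 * edge_variance d"
proof (rule tendsto_sandwich)
  show "(\<lambda>n. 2 * edge_variance d - 1 / real n) \<longlonglongrightarrow> 2 * edge_variance d" by real_asymp
  show "(\<lambda>n. 2 * edge_variance d) \<longlonglongrightarrow> 2 * edge_variance d" by simp
  show "eventually (\<lambda>n. 2 * edge_variance d - 1 / real n \<le> real (bin_half d n) / real n) sequentially"
    using eventually_gt_at_top[of 0]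
  proof eventually_elim
    case (elim n)
    have "(2 * edge_variance d * real n - 1) / real n \<le> real (bin_half d n) / real n"
      by (intro divide_right_mono bin_half_bounds[OF d]) auto
    then show ?case using elim by (simp add: diff_divide_distrib)
  qed
  show "eventually (\<lambda>n. real (bin_half d n) / real n \<le> 2 * edge_variance d) sequentially"
    using eventually_gt_at_top[of 0]
  proof eventually_elim
    case (elim n)
    then show ?case using bin_half_bounds(1)[OF d, of n] by (simp add: divide_le_eq)
  qed
qed

text \<open>Hoeffding's inequality for 2H fair trials, applied to a single point of the
  tail.\<close>

lemma shifted_binomial_le:
  assumes H: "H > 0" and j: "c - int H \<le> j"
  shows "shifted_binomial H c j \<le> 2 * exp (- ((real_of_int (j - c))\<^sup>2 / real H))"
proof -
  define l where "l = nat (j - c + int H)"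
  have z: "real_of_int (j - c) = real l - real H" using j by (simp add: l_def)
  interpret binomial_distribution "2 * H" "1/2" by standard auto
  have "shifted_binomial H c j = pmf (binomial_pmf (2 * H) (1/2)) l"
  proof (cases "l \<le> 2 * H")
    case True
    have "(1/2 :: real) ^ l * (1/2) ^ (2 * H - l) = (1/2) ^ (2 * H)" using True by (simp add: power_add[symmetric])
    also have "\<dots> = 1 / 4 ^ H" by (simp add: power_mult power_divide)
    finally show ?thesis by (simp add: shifted_binomial_def l_def[symmetric] pmf_binomial mult.assoc)
  next
    case False
    then show ?thesis by (simp add: shifted_binomial_def l_def[symmetric] pmf_binomial binomial_eq_0)
  qed
  also have "\<dots> = measure_pmf.prob (binomial_pmf (2 * H) (1/2)) {l}" by (simp add: measure_pmf_single)
  also have "\<dots> \<le> measure_pmf.prob (binomial_pmf (2 * H) (1/2)) {x. \<bar>real x - real (2 * H) * (1/2)\<bar> \<ge> \<bar>real_of_int (j - c)\<bar>}"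
    unfolding z by (intro measure_pmf.finite_measure_mono) auto
  also have "\<dots> \<le> 2 * exp (- 2 * \<bar>real_of_int (j - c)\<bar>\<^sup>2 / real (2 * H))" by (rule prob_abs_ge) (use H in auto)
  finally show ?thesis by simp
qed

text \<open>The arithmetic of the next lemma with every product and logarithm replaced by a
  variable, so that only linear reasoning remains: six Stirling errors and one error from the
  mismatch of the quadratic terms.\<close>

lemma Stirling_errors_add:
  fixes \<epsilon> :: real
  assumes "\<bar>F1 - (Ap - Aq - A + (t + w + (p - q)) / 2 + y1 + YA)\<bar> \<le> \<epsilon>"
    and "\<bar>F2 - (np - Ap + Bs - B + (t + w + (p + s - q)) / 2 - y2 + YB)\<bar> \<le> \<epsilon>"
    and "\<bar>F3 - (np - n + (t + w + p) / 2)\<bar> \<le> \<epsilon>"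
    and "\<bar>F4 - (2 * Ht + 2 * Hh - 2 * H + (t + w + (t + h)) / 2)\<bar> \<le> \<epsilon>"
    and "\<bar>F5 - (Hh - H + (t + w + h) / 2 + zh + Z)\<bar> \<le> \<epsilon>"
    and "\<bar>F6 - (Hh - H + (t + w + h) / 2 - zh + Z)\<bar> \<le> \<epsilon>"
    and "\<bar>2 * Z - Y\<bar> \<le> \<epsilon>" "YB - YA = - Y" "B = n - A"
  shows "\<bar>F2 - F1 - F3 - (F4 - F5 - F6 - 2 * Ht) -
    (Bs + Aq - (2 * Ap - 2 * A) + (s + h - t - p) / 2 - (y1 + y2))\<bar> \<le> 7 * \<epsilon>"
    (is "\<bar>?X\<bar> \<le> _")
proof -
  have sum7: "\<bar>a2 - a1 - a3 - a4 + a5 + a6 + a7\<bar> \<le> 7 * \<epsilon>"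
    if "\<bar>a1\<bar> \<le> \<epsilon>" "\<bar>a2\<bar> \<le> \<epsilon>" "\<bar>a3\<bar> \<le> \<epsilon>" "\<bar>a4\<bar> \<le> \<epsilon>" "\<bar>a5\<bar> \<le> \<epsilon>" "\<bar>a6\<bar> \<le> \<epsilon>" "\<bar>a7\<bar> \<le> \<epsilon>"
    for a1 a2 a3 a4 a5 a6 a7 :: real
    using that by (intro abs_leI) linarith+
  have Y: "YB = YA - Y" using assms(8) by simp
  have "?X = (F2 - (np - Ap + Bs - B + (t + w + (p + s - q)) / 2 - y2 + YB))
      - (F1 - (Ap - Aq - A + (t + w + (p - q)) / 2 + y1 + YA)) - (F3 - (np - n + (t + w + p) / 2))
      - (F4 - (2 * Ht + 2 * Hh - 2 * H + (t + w + (t + h)) / 2)) + (F5 - (Hh - H + (t + w + h) / 2 + zh + Z))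
      + (F6 - (Hh - H + (t + w + h) / 2 - zh + Z)) + (2 * Z - Y)"
    unfolding Y assms(9) by (simp add: field_simps)
  then show ?thesis using sum7[OF assms(1-7)] by (simp only:)
qed

text \<open>Stirling expansions of the six factorials are combined. The quadratic terms of the edge
  weight amount to -y^2 / (2 sigma^2 n) with sigma^2 = \<open>edge_variance d\<close>, because 1/A -
  1/B = 1/(sigma^2 n); those of the binomial amount to -z^2 / H, which agrees up to the error in
  \<open>e7\<close>. What survives is a constant and the linear term in y.\<close>

lemma ln_edge_weight_expansion:
  fixes n d m H :: nat and y z \<epsilon> :: real and c :: int
  assumes d: "d \<ge> 3" and n: "n > 0" and H: "H > 0"
  defines "A \<equiv> real n / real d" and "B \<equiv> real n * (real d - 1) / real d"
  assumes m: "m \<le> n" "real m = A + y" and l: "int m - c + int H \<ge> 0" "int m - c \<le> int H" and z: "z = real_of_int (int m - c)"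
    and e1: "\<bar>ln (fact m) - (A * ln A - A + ln (2 * pi * A) / 2 + y * ln A + y\<^sup>2 / (2 * A))\<bar> \<le> \<epsilon>"
    and e2: "\<bar>ln (fact (n - m)) - (B * ln B - B + ln (2 * pi * B) / 2 + (- y) * ln B + (- y)\<^sup>2 / (2 * B))\<bar> \<le> \<epsilon>"
    and e3: "\<bar>ln (fact n) - (real n * ln (real n) - real n + ln (2 * pi * real n) / 2 + 0 * ln (real n) + 0\<^sup>2 / (2 * real n))\<bar> \<le> \<epsilon>"
    and e4: "\<bar>ln (fact (2 * H)) - (real (2 * H) * ln (real (2 * H)) - real (2 * H) + ln (2 * pi * real (2 * H)) / 2 + 0 * ln (real (2 * H)) + 0\<^sup>2 / (2 * real (2 * H)))\<bar> \<le> \<epsilon>"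
    and e5: "\<bar>ln (fact (nat (int m - c + int H))) - (real H * ln (real H) - real H + ln (2 * pi * real H) / 2 + z * ln (real H) + z\<^sup>2 / (2 * real H))\<bar> \<le> \<epsilon>"
    and e6: "\<bar>ln (fact (2 * H - nat (int m - c + int H))) - (real H * ln (real H) - real H + ln (2 * pi * real H) / 2 + (- z) * ln (real H) + (- z)\<^sup>2 / (2 * real H))\<bar> \<le> \<epsilon>"
    and e7: "\<bar>z\<^sup>2 / real H - y\<^sup>2 / (2 * edge_variance d * real n)\<bar> \<le> \<epsilon>"
  shows "edge_weight n m > 0" "shifted_binomial H c (int m) > 0"
    and "\<bar>ln (edge_weight n m) - ln (shifted_binomial H c (int m)) -
      (real n * bethe (1 / real d) - 2 / real d * (real n * ln (real n) - real n) + ln ((real d - 1) * real H / (2 * real n)) / 2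
        - y * (ln A + ln B))\<bar> \<le> 7 * \<epsilon>"
proof -
  let ?l = "nat (int m - c + int H)"
  have l2: "?l \<le> 2 * H" using l by simp
  show "edge_weight n m > 0" by (simp add: edge_weight_def)
  show "shifted_binomial H c (int m) > 0" using l2 by (simp add: shifted_binomial_def)
  have lw: "ln (edge_weight n m) = ln (fact (n - m)) - ln (fact m) - ln (fact n)"
    by (simp add: edge_weight_def ln_div ln_mult)
  have lb: "ln (shifted_binomial H c (int m)) = ln (fact (2 * H)) - ln (fact ?l) - ln (fact (2 * H - ?l)) - real H * (2 * ln 2)"
  proof -
    have "ln (4::real) = ln (2 ^ 2)" by simp
    then have "ln (4::real) = 2 * ln 2" by (simp only: ln_realpow)
    then show ?thesis using l2 by (simp add: shifted_binomial_def binomial_fact ln_div ln_mult ln_realpow)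
  qed
  define p where "p = ln (real n)"
  define q where "q = ln (real d)"
  define s where "s = ln (real d - 1)"
  define h where "h = ln (real H)"
  define t where "t = ln (2::real)"
  define w where "w = ln pi"
  have lA: "ln A = p - q" using n d by (simp add: A_def p_def q_def ln_div)
  have lB: "ln B = p + s - q" using n d by (simp add: B_def p_def q_def s_def ln_div ln_mult)
  have AB: "A > 0" "B > 0" "B = real n - A" using n d by (auto simp: A_def B_def field_simps)
  have l2A: "ln (2 * pi * A) = t + w + (p - q)" using AB lA by (simp add: ln_mult t_def w_def)
  have l2B: "ln (2 * pi * B) = t + w + (p + s - q)" using AB lB by (simp add: ln_mult t_def w_def)
  have l2n: "ln (2 * pi * real n) = t + w + p" using n by (simp add: ln_mult t_def w_def p_def)
  have lH2: "ln (real (2 * H)) = t + h" using H by (simp add: ln_mult t_def h_def)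
  have l2H2: "ln (2 * pi * real (2 * H)) = t + w + (t + h)"
  proof -
    have "ln (2 * pi * real (2 * H)) = ln (2 * pi) + ln (real (2 * H))" using H by (intro ln_mult_pos) auto
    then show ?thesis unfolding lH2 by (simp add: ln_mult t_def w_def)
  qed
  have l2H: "ln (2 * pi * real H) = t + w + h" using H by (simp add: ln_mult t_def w_def h_def)
  have bet: "real n * bethe (1 / real d) = B * (s - q) + A * q"
  proof -
    have "1 - 1 / real d = (real d - 1) / real d" using d by (simp add: field_simps)
    then have "bethe (1 / real d) = (real d - 1) / real d * (s - q) + 1 / real d * q"
      using d by (simp add: bethe_def ln_div s_def q_def)
    then show ?thesis by (simp add: A_def B_def distrib_left)
  qed
  have lr: "ln ((real d - 1) * real H / (2 * real n)) = s + h - t - p"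
    using d H n by (simp add: ln_div ln_mult s_def h_def t_def p_def)
  have quad: "y\<^sup>2 / (2 * B) - y\<^sup>2 / (2 * A) = - (y\<^sup>2 / (2 * edge_variance d * real n))"
  proof -
    have "1 / B - 1 / A = - (1 / (edge_variance d * real n))"
      using d n by (simp add: A_def B_def edge_variance_def field_simps)
    moreover have "y\<^sup>2 / (2 * B) - y\<^sup>2 / (2 * A) = y\<^sup>2 / 2 * (1 / B - 1 / A)"
      by (simp add: right_diff_distrib)
    moreover have "y\<^sup>2 / 2 * (- (1 / (edge_variance d * real n))) = - (y\<^sup>2 / (2 * edge_variance d * real n))"
      by (simp add: mult.assoc)
    ultimately show ?thesis by (simp only:)
  qed
  have d2: "2 / real d * (real n * ln (real n) - real n) = 2 * (A * p) - 2 * A" by (simp add: A_def p_def algebra_simps)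
  define Y where "Y = y\<^sup>2 / (2 * edge_variance d * real n)"
  define YA where "YA = y\<^sup>2 / (2 * A)"
  define YB where "YB = y\<^sup>2 / (2 * B)"
  define Z where "Z = z\<^sup>2 / (2 * real H)"
  have ZH: "z\<^sup>2 / real H = 2 * Z" by (simp add: Z_def)
  have YY: "YB - YA = - Y" using quad by (simp add: Y_def YA_def YB_def)
  define HH where "HH = real H * h"
  define Ht where "Ht = real H * t"
  have HHt: "real (2 * H) * (t + h) = 2 * Ht + 2 * HH" by (simp add: HH_def Ht_def algebra_simps)
  have f1: "\<bar>ln (fact m) - (A * (p - q) - A + (t + w + (p - q)) / 2 + y * (p - q) + YA)\<bar> \<le> \<epsilon>"
    using e1 by (simp only: l2A lA YA_def)
  have f2: "\<bar>ln (fact (n - m)) - (B * (p + s - q) - B + (t + w + (p + s - q)) / 2 - y * (p + s - q) + YB)\<bar> \<le> \<epsilon>"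
    using e2 by (simp add: l2B lB YB_def)
  have f3: "\<bar>ln (fact n) - (real n * p - real n + (t + w + p) / 2)\<bar> \<le> \<epsilon>"
    using e3 by (simp add: l2n p_def[symmetric])
  have f4: "\<bar>ln (fact (2 * H)) - (2 * Ht + 2 * HH - 2 * real H + (t + w + (t + h)) / 2)\<bar> \<le> \<epsilon>"
    using e4 unfolding l2H2 lH2 HHt by simp
  have f5: "\<bar>ln (fact ?l) - (HH - real H + (t + w + h) / 2 + z * h + Z)\<bar> \<le> \<epsilon>"
    using e5 by (simp only: l2H h_def[symmetric] HH_def Z_def)
  have f6: "\<bar>ln (fact (2 * H - ?l)) - (HH - real H + (t + w + h) / 2 - z * h + Z)\<bar> \<le> \<epsilon>"
    using e6 by (simp add: l2H h_def[symmetric] HH_def Z_def)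
  have f7: "\<bar>2 * Z - Y\<bar> \<le> \<epsilon>" using e7 by (simp only: ZH Y_def)
  have lbt: "real H * (2 * ln 2) = 2 * Ht" by (simp add: Ht_def t_def)
  have "B * p = real n * p - A * p" by (simp only: AB(3) left_diff_distrib)
  then have Bn: "B * (p + s - q) = real n * p - A * p + (B * (s - q))" by (simp add: algebra_simps)
  have Aq: "A * (p - q) = A * p - A * q" by (simp add: algebra_simps)
  have yy: "y * (ln A + ln B) = y * (p - q) + y * (p + s - q)" by (simp add: lA lB algebra_simps)
  show "\<bar>ln (edge_weight n m) - ln (shifted_binomial H c (int m)) -
      (real n * bethe (1 / real d) - 2 / real d * (real n * ln (real n) - real n) + ln ((real d - 1) * real H / (2 * real n)) / 2
        - y * (ln A + ln B))\<bar> \<le> 7 * \<epsilon>"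
    unfolding lw lb bet d2 lr yy lbt
    by (rule Stirling_errors_add[OF f1[unfolded Aq] f2[unfolded Bn] f3 f4 f5 f6 f7 YY AB(3)])
qed

lemma ln_ratio_near:
  fixes \<epsilon> :: real
  assumes d: "d \<ge> 3" and \<epsilon>: "\<epsilon> > 0"
  shows "eventually (\<lambda>n. n > 0 \<and> bin_half d n > 0 \<and> (\<forall>m::int. \<bar>real_of_int m - real n / real d\<bar> \<le> real n powr (3/5) \<longrightarrow>
     0 \<le> m \<and> m \<le> int n \<and> m \<in> {bin_centre d n - int (bin_half d n)..bin_centre d n + int (bin_half d n)} \<and>
     edge_weight n (nat m) > 0 \<and> shifted_binomial (bin_half d n) (bin_centre d n) m > 0 \<and>
     \<bar>ln (edge_weight n (nat m)) - ln (shifted_binomial (bin_half d n) (bin_centre d n) m) -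
       (log_ratio d n - (real_of_int m - real n / real d) * (ln (real n / real d) + ln (real n * (real d - 1) / real d)))\<bar> \<le> \<epsilon>)) sequentially"
proof -
  \<comment> \<open>One seventh for each error in \<open>Stirling_errors_add\<close>.\<close>
  define \<epsilon>' where "\<epsilon>' = \<epsilon> / 7"
  have \<epsilon>': "\<epsilon>' > 0" using \<epsilon> by (simp add: \<epsilon>'_def)
  define r where "r = real d"
  have r: "r \<ge> 3" using d by (simp add: r_def)
  define \<sigma> where "\<sigma> = edge_variance d"
  have \<sigma>: "\<sigma> > 0" using edge_variance_pos[OF d] by (simp add: \<sigma>_def)
  obtain A0 where A0: "A0 > 0" "\<And>A y m. A \<ge> A0 \<Longrightarrow> A + y = real m \<Longrightarrow> \<bar>y\<bar> \<le> A powr (5/8) \<Longrightarrow>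
    \<bar>ln (fact m) - (A * ln A - A + ln (2 * pi * A) / 2 + y * ln A + y\<^sup>2 / (2 * A))\<bar> \<le> \<epsilon>'"
    using ln_fact_near[OF \<epsilon>'] by blast
  have r0: "r > 0" using r by simp
  have r1: "r - 1 > 0" using r by simp
  have "eventually (\<lambda>n. real n / r \<ge> A0) sequentially" using r0 by real_asymp
  moreover have "eventually (\<lambda>n. real n * (r - 1) / r \<ge> A0) sequentially"
  proof -
    have "filterlim (\<lambda>n. real n * ((r - 1) / r)) at_top sequentially" using r0 r1 by real_asymp
    then show ?thesis by (simp add: filterlim_at_top)
  qed
  moreover have "eventually (\<lambda>n. \<sigma> * real n \<ge> A0) sequentially" using \<sigma> by real_asymp
  moreover have "eventually (\<lambda>n. \<sigma> * real n \<ge> 1) sequentially" using \<sigma> by real_asymp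
  moreover have "eventually (\<lambda>n. real n \<ge> A0) sequentially" by real_asymp
  moreover have "eventually (\<lambda>n. real n powr (3/5) \<le> (real n / r) powr (5/8)) sequentially" using r0 by real_asymp
  moreover have "eventually (\<lambda>n. real n powr (3/5) + 1 \<le> (\<sigma> * real n) powr (5/8)) sequentially" using \<sigma> by real_asymp
  moreover have "eventually (\<lambda>n. real n powr (3/5) + 1 \<le> \<sigma> * real n) sequentially" using \<sigma> by real_asymp
  moreover have "eventually (\<lambda>n. real n powr (3/5) \<le> real n / r) sequentially" using r0 by real_asymp
  \<comment> \<open>A bound for the mismatch of the quadratic terms: the first fraction pays for
    moving the centre by at most 1, the second for rounding \<open>bin_half\<close> by at most
    1.\<close>
  moreover have "eventually (\<lambda>n. (2 * real n powr (3/5) + 1) / (\<sigma> * real n) + (real n powr (3/5))\<^sup>2 / (\<sigma> * real n * (2 * \<sigma> * real n)) < \<epsilon>') sequentially"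
  proof -
    have "(\<lambda>n. (2 * real n powr (3/5) + 1) / (\<sigma> * real n) + (real n powr (3/5))\<^sup>2 / (\<sigma> * real n * (2 * \<sigma> * real n))) \<longlonglongrightarrow> 0"
      using \<sigma> by real_asymp
    then show ?thesis by (rule order_tendstoD) (rule \<epsilon>')
  qed
  ultimately show ?thesis using eventually_gt_at_top[of 0]
  proof eventually_elim
    case (elim n)
    let ?H = "bin_half d n" and ?c = "bin_centre d n"
    define R where "R = real n powr (3/5)"
    define A where "A = real n / real d"
    define B where "B = real n * (real d - 1) / real d"
    have H\<sigma>: "\<sigma> * real n \<le> real ?H" using bin_half_bounds(2)[OF d, of n] elim(4) by (simp add: \<sigma>_def)
    have H0: "?H > 0" using H\<sigma> elim(4) by (cases ?H) auto
    have Hup: "real ?H \<le> 2 * \<sigma> * real n" "2 * \<sigma> * real n - 1 \<le> real ?H" using bin_half_bounds[OF d, of n] by (simp_all add: \<sigma>_def)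
    have main: "0 \<le> m \<and> m \<le> int n \<and> m \<in> {?c - int ?H..?c + int ?H} \<and>
     edge_weight n (nat m) > 0 \<and> shifted_binomial ?H ?c m > 0 \<and>
     \<bar>ln (edge_weight n (nat m)) - ln (shifted_binomial ?H ?c m) -
       (log_ratio d n - (real_of_int m - A) * (ln A + ln B))\<bar> \<le> \<epsilon>"
      if m: "\<bar>real_of_int m - A\<bar> \<le> R" for m :: int
    proof -
      define y where "y = real_of_int m - A"
      have y: "\<bar>y\<bar> \<le> R" using m by (simp add: y_def)
      have RA: "R \<le> A" using elim(9) by (simp add: R_def A_def r_def)
      have A: "A + A \<le> real n" using mult_right_mono[of 2 r "real n"] r by (simp add: A_def r_def[symmetric] field_simps)
      have "0 \<le> real_of_int m" using y RA by (simp add: y_def)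
      then have m0: "0 \<le> m" by simp
      have "real_of_int m \<le> real n" using y RA A by (simp add: y_def)
      then have mn: "m \<le> int n" by linarith
      define z where "z = real_of_int (m - ?c)"
      have zy: "\<bar>z - y\<bar> \<le> 1" using bin_centre_near[of d n] d by (simp add: z_def y_def A_def)
      have zR: "\<bar>z\<bar> \<le> R + 1" using zy y by linarith
      have zH: "\<bar>z\<bar> \<le> real ?H" using zR elim(8) H\<sigma> by (simp add: R_def)
      then have l: "m - ?c + int ?H \<ge> 0" "m - ?c \<le> int ?H" unfolding z_def by linarith+
      define k where "k = nat m"
      have k: "int k = m" "k \<le> n" using m0 mn by (auto simp: k_def)
      have rk: "real k = A + y" "real (n - k) = B + (- y)"
        using k d by (auto simp: y_def of_nat_diff A_def B_def field_simps)
      have RB: "A powr (5/8) \<le> B powr (5/8)"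
        using A d by (intro powr_mono2) (auto simp: A_def B_def field_simps)
      have Hp: "(\<sigma> * real n) powr (5/8) \<le> real ?H powr (5/8)" using H\<sigma> \<sigma> by (intro powr_mono2) auto
      have yA: "\<bar>y\<bar> \<le> A powr (5/8)" using y elim(6) by (simp add: R_def A_def r_def)
      have zHp: "\<bar>z\<bar> \<le> real ?H powr (5/8)" using zR elim(7) Hp by (simp add: R_def)
      have nl: "real (nat (int k - ?c + int ?H)) = real ?H + z" "real (2 * ?H - nat (int k - ?c + int ?H)) = real ?H + (- z)"
        using l by (auto simp: z_def k(1) of_nat_diff)
      have e7: "\<bar>z\<^sup>2 / real ?H - y\<^sup>2 / (2 * \<sigma> * real n)\<bar> \<le> \<epsilon>'"
      proof -
        have "z\<^sup>2 / real ?H - y\<^sup>2 / (2 * \<sigma> * real n) = (z - y) * (z + y) / real ?H + y\<^sup>2 * (2 * \<sigma> * real n - real ?H) / (real ?H * (2 * \<sigma> * real n))"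
          using H0 elim(11) \<sigma> by (simp add: field_simps power2_eq_square)
        also have "\<bar>\<dots>\<bar> \<le> \<bar>(z - y) * (z + y) / real ?H\<bar> + \<bar>y\<^sup>2 * (2 * \<sigma> * real n - real ?H) / (real ?H * (2 * \<sigma> * real n))\<bar>"
          by (rule abs_triangle_ineq)
        also have "\<bar>(z - y) * (z + y) / real ?H\<bar> \<le> (2 * R + 1) / (\<sigma> * real n)"
        proof -
          have "\<bar>z - y\<bar> * \<bar>z + y\<bar> \<le> 1 * (2 * R + 1)" using zy y zR by (intro mult_mono) auto
          then have "\<bar>z - y\<bar> * \<bar>z + y\<bar> / real ?H \<le> (2 * R + 1) / (\<sigma> * real n)"
            using H\<sigma> \<sigma> elim(11) y by (intro frac_le) auto
          then show ?thesis by (simp add: abs_mult)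
        qed
        also have "\<bar>y\<^sup>2 * (2 * \<sigma> * real n - real ?H) / (real ?H * (2 * \<sigma> * real n))\<bar> \<le> R\<^sup>2 / (\<sigma> * real n * (2 * \<sigma> * real n))"
        proof -
          have "y\<^sup>2 * \<bar>2 * \<sigma> * real n - real ?H\<bar> \<le> R\<^sup>2 * 1"
          proof (rule mult_mono)
            show "y\<^sup>2 \<le> R\<^sup>2" using power_mono[OF y, of 2] by simp
            show "\<bar>2 * \<sigma> * real n - real ?H\<bar> \<le> 1" using Hup by linarith
          qed auto
          then have "y\<^sup>2 * \<bar>2 * \<sigma> * real n - real ?H\<bar> / (real ?H * (2 * \<sigma> * real n)) \<le> R\<^sup>2 / (\<sigma> * real n * (2 * \<sigma> * real n))"
            using H\<sigma> \<sigma> elim(11) by (intro frac_le mult_right_mono) auto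
          then show ?thesis using \<sigma> by (simp add: abs_mult)
        qed
        finally show ?thesis using elim(10) by (simp add: R_def)
      qed
      have n0: "n > 0" using elim by simp
      have ew: "edge_weight n k > 0" "shifted_binomial ?H ?c (int k) > 0"
        "\<bar>ln (edge_weight n k) - ln (shifted_binomial ?H ?c (int k)) -
          (real n * bethe (1 / real d) - 2 / real d * (real n * ln (real n) - real n) + ln ((real d - 1) * real ?H / (2 * real n)) / 2
          - y * (ln A + ln B))\<bar> \<le> 7 * \<epsilon>'"
      proof -
        have R0: "0 \<le> real n powr (5/8)" "0 \<le> real (2 * ?H) powr (5/8)" by simp_all
        have AA: "A \<ge> A0" "B \<ge> A0" using elim(1,2) by (simp_all add: A_def B_def r_def)
        have HH: "real ?H \<ge> A0" "real (2 * ?H) \<ge> A0" using elim(3) H\<sigma> by auto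
        note * = ln_edge_weight_expansion[OF d n0 H0, folded A_def B_def, of k y ?c z \<epsilon>', folded \<sigma>_def]
        have prem: "k \<le> n" "real k = A + y" "int k - ?c + int ?H \<ge> 0" "int k - ?c \<le> int ?H" "z = real_of_int (int k - ?c)"
          using k rk l by (auto simp: z_def)
        have e1: "\<bar>ln (fact k) - (A * ln A - A + ln (2 * pi * A) / 2 + y * ln A + y\<^sup>2 / (2 * A))\<bar> \<le> \<epsilon>'"
          by (rule A0(2)) (use AA rk yA in auto)
        have e2: "\<bar>ln (fact (n - k)) - (B * ln B - B + ln (2 * pi * B) / 2 + (- y) * ln B + (- y)\<^sup>2 / (2 * B))\<bar> \<le> \<epsilon>'"
          by (rule A0(2)) (use AA rk yA RB in auto)
        have e3: "\<bar>ln (fact n) - (real n * ln (real n) - real n + ln (2 * pi * real n) / 2 + 0 * ln (real n) + 0\<^sup>2 / (2 * real n))\<bar> \<le> \<epsilon>'"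
          by (rule A0(2)) (use elim R0 in auto)
        have e4: "\<bar>ln (fact (2 * ?H)) - (real (2 * ?H) * ln (real (2 * ?H)) - real (2 * ?H) + ln (2 * pi * real (2 * ?H)) / 2 + 0 * ln (real (2 * ?H)) + 0\<^sup>2 / (2 * real (2 * ?H)))\<bar> \<le> \<epsilon>'"
          by (rule A0(2)) (use HH R0 in auto)
        have e5: "\<bar>ln (fact (nat (int k - ?c + int ?H))) - (real ?H * ln (real ?H) - real ?H + ln (2 * pi * real ?H) / 2 + z * ln (real ?H) + z\<^sup>2 / (2 * real ?H))\<bar> \<le> \<epsilon>'"
          by (rule A0(2)) (use HH nl zHp in auto)
        have e6: "\<bar>ln (fact (2 * ?H - nat (int k - ?c + int ?H))) - (real ?H * ln (real ?H) - real ?H + ln (2 * pi * real ?H) / 2 + (- z) * ln (real ?H) + (- z)\<^sup>2 / (2 * real ?H))\<bar> \<le> \<epsilon>'"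
          by (rule A0(2)) (use HH nl zHp in auto)
        show "edge_weight n k > 0" "shifted_binomial ?H ?c (int k) > 0"
          "\<bar>ln (edge_weight n k) - ln (shifted_binomial ?H ?c (int k)) -
          (real n * bethe (1 / real d) - 2 / real d * (real n * ln (real n) - real n) + ln ((real d - 1) * real ?H / (2 * real n)) / 2
          - y * (ln A + ln B))\<bar> \<le> 7 * \<epsilon>'"
          by (fact *[OF prem e1 e2 e3 e4 e5 e6 e7])+
      qed
      show ?thesis
        using ew m0 mn l unfolding k(1) k_def[symmetric] log_ratio_def[symmetric] y_def \<epsilon>'_def by auto
    qed
    show ?case using main H0 elim(11) unfolding A_def B_def R_def by blast
  qed
qed

lemma edge_weight_pos: "edge_weight n m > 0"
  by (simp add: edge_weight_def)

lemma shifted_binomial_nonneg: "shifted_binomial H c j \<ge> 0"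
  by (simp add: shifted_binomial_def)

lemma ln_edge_weight_le:
  assumes n: "n > 0" and m: "m \<le> n"
  shows "ln (edge_weight n m) \<le> real n * bethe (real m / real n) - 2 * (real m / real n) * (real n * ln (real n) - real n) + (ln (real n + 1) + 1)"
proof -
  define x where "x = real m / real n"
  have mx: "real m = real n * x" using n by (simp add: x_def)
  have nm: "real (n - m) = real n * (1 - x)" using n m by (simp add: x_def of_nat_diff field_simps)
  have "ln (edge_weight n m) = ln (fact (n - m)) - ln (fact m) - ln (fact n)"
    by (simp add: edge_weight_def ln_div ln_mult)
  also have "\<dots> \<le> (real (n - m) * ln (real (n - m)) - real (n - m) + ln (real (n - m) + 1) + 1) - (real m * ln (real m) - real m) - (real n * ln (real n) - real n)"
    by (intro diff_mono ln_fact_bounds)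
  also have "ln (real (n - m) + 1) \<le> ln (real n + 1)" by simp
  also have "real (n - m) * ln (real (n - m)) = real n * (1 - x) * ln (real n) + real n * ((1 - x) * ln (1 - x))"
  proof (cases "m = n")
    case True
    then show ?thesis using n by (simp add: x_def)
  next
    case False
    then have "1 - x > 0" using m n by (simp add: x_def)
    then have l: "ln (real n * (1 - x)) = ln (real n) + ln (1 - x)" using n by (simp add: ln_mult)
    show ?thesis unfolding nm l by (simp only: distrib_left mult.assoc)
  qed
  also have "real m * ln (real m) = real n * x * ln (real n) + real n * (x * ln x)"
  proof (cases "m = 0")
    case True
    then show ?thesis by (simp add: x_def)
  next
    case False
    then have "x > 0" using n by (simp add: x_def)
    then have l: "ln (real n * x) = ln (real n) + ln x" using n by (simp add: ln_mult)
    show ?thesis unfolding mx l by (simp only: distrib_left mult.assoc)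
  qed
  finally show ?thesis unfolding x_def[symmetric] nm mx using n by (simp add: bethe_def algebra_simps)
qed

text \<open>
  The exponent \<open>\<kappa>\<close> is half the number of redundant vertex constraints: \<open>0\<close> for non-bipartite and
  \<open>1/2\<close> for bipartite graphs.
\<close>

definition lift_limit :: "nat \<Rightarrow> nat \<Rightarrow> real \<Rightarrow> real \<Rightarrow> nat \<Rightarrow> real" where
  "lift_limit d g \<kappa> D n = (let r = real d; s = real g in
     (r - 1) powr ((r - 1) * s / 2 + \<kappa>) / ((r * (r - 2)) powr (r * s / 4 - s / 2 + \<kappa>) * sqrt D)
       * (2 * pi * real n) powr \<kappa> * ((r - 1) powr (r - 1) / r powr (r - 2)) powr (s * real n / 2))"

lemma gaussian_integral_gram:
  assumes G: "loopless_multigraph {..<g} E ends" and conn: "connected_multigraph {..<g} E ends"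
    and coer: "\<And>\<theta>. (\<Sum>v<k. (sin (\<theta> v))\<^sup>2) \<le> C * (\<Sum>e\<in>E. (sin (edge_angle k ends \<theta> e / 2))\<^sup>2)"
    and v: "v > 0"
  shows "det (mat k k (\<lambda>(i, j). gram E ends i j)) > 0"
    and "(\<integral>x. exp (- (v / 2 * (\<Sum>e\<in>E. (edge_angle k ends x e)\<^sup>2))) \<partial>Pi\<^sub>M {..<k} (\<lambda>_. lborel)) =
      sqrt ((2 * pi) ^ k / (v ^ k * det (mat k k (\<lambda>(i, j). gram E ends i j))))"
proof -
  let ?gram = "gram E ends" and ?S = "\<lambda>i j. v * gram E ends i j"
  have qS: "quad_form k ?S x = v * (\<Sum>e\<in>E. (edge_angle k ends x e)\<^sup>2)" for x
    unfolding quad_form_gram[OF G conn, symmetric] by (simp add: quad_form_def sum_distrib_left mult_ac)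
  have sym: "?S i j = ?S j i" for i j by (simp add: gram_def[OF G conn] conj_commute)
  have pos: "quad_form k ?S x > 0" if "\<exists>i<k. x i \<noteq> 0" for x
    using quad_form_gram_pos[OF G conn coer that] v unfolding qS quad_form_gram[OF G conn] by simp
  have "mat k k (\<lambda>(i, j). ?S i j) = v \<cdot>\<^sub>m mat k k (\<lambda>(i, j). ?gram i j)" by (intro eq_matI) auto
  then have D: "det (mat k k (\<lambda>(i, j). ?S i j)) = v ^ k * det (mat k k (\<lambda>(i, j). ?gram i j))"
    by (simp add: det_smult)
  have "det (mat k k (\<lambda>(i, j). ?S i j)) > 0" by (rule gaussian_integral_PiM(1)[OF sym pos])
  then show Dpos: "det (mat k k (\<lambda>(i, j). ?gram i j)) > 0" unfolding D using v by (simp add: zero_less_mult_iff)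
  have "(\<integral>\<^sup>+x. ennreal (exp (- quad_form k ?S x / 2)) \<partial>Pi\<^sub>M {..<k} (\<lambda>_. lborel)) =
      ennreal (sqrt ((2 * pi) ^ k / det (mat k k (\<lambda>(i, j). ?S i j))))"
    by (rule gaussian_integral_PiM(2)[OF sym pos])
  then have "(\<integral>x. exp (- quad_form k ?S x / 2) \<partial>Pi\<^sub>M {..<k} (\<lambda>_. lborel)) = sqrt ((2 * pi) ^ k / det (mat k k (\<lambda>(i, j). ?S i j)))"
    using v Dpos by (subst integral_eq_nn_integral) (auto simp: D)
  then show "(\<integral>x. exp (- (v / 2 * (\<Sum>e\<in>E. (edge_angle k ends x e)\<^sup>2))) \<partial>Pi\<^sub>M {..<k} (\<lambda>_. lborel)) =
      sqrt ((2 * pi) ^ k / (v ^ k * det (mat k k (\<lambda>(i, j). ?gram i j))))"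
    unfolding D qS by simp
qed

context
  fixes g d :: nat and E :: "'e set" and ends :: "'e \<Rightarrow> nat set"
  assumes G: "loopless_multigraph {..<g} E ends" and conn: "connected_multigraph {..<g} E ends"
    and reg: "regular {..<g} E ends d" and d: "d \<ge> 3"
begin

section \<open>Edge sums in a regular graph and estimates far from the uniform weight\<close>

lemma finite_edge_set: "finite E" using G by (simp add: loopless_multigraph_def)

lemma degree: "v < g \<Longrightarrow> card {e \<in> E. v \<in> ends e} = d"
  using reg by (auto simp: regular_def vertex_degree_def)

lemma sum_over_vertices: "(\<Sum>v<g. \<Sum>e | e \<in> E \<and> v \<in> ends e. f e) = 2 * (\<Sum>e\<in>E. f e :: real)"
proof -
  have "(\<Sum>v<g. \<Sum>e | e \<in> E \<and> v \<in> ends e. f e) = (\<Sum>e\<in>E. \<Sum>v | v \<in> {..<g} \<and> v \<in> ends e. f e)"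
    using finite_edge_set by (intro sum.swap_restrict) auto
  also have "\<dots> = (\<Sum>e\<in>E. 2 * f e)"
  proof (rule sum.cong[OF refl])
    fix e assume e: "e \<in> E"
    then have "{v. v \<in> {..<g} \<and> v \<in> ends e} = ends e" using ends_subset[OF G conn] by auto
    then show "(\<Sum>v | v \<in> {..<g} \<and> v \<in> ends e. f e) = 2 * f e" using card_ends[OF G conn e] by simp
  qed
  finally show ?thesis by (simp add: sum_distrib_left)
qed

lemma handshake: "real d * real g = 2 * real (card E)"
proof -
  have "(\<Sum>v<g. \<Sum>e | e \<in> E \<and> v \<in> ends e. 1) = 2 * (\<Sum>e\<in>E. 1 :: real)" by (rule sum_over_vertices)
  then show ?thesis using degree by (simp add: mult.commute)
qed

lemma sum_balanced:
  assumes "\<And>v. v < g \<Longrightarrow> (\<Sum>e | e \<in> E \<and> v \<in> ends e. f e) = c"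
  shows "(\<Sum>e\<in>E. f e :: real) = c * real (card E) / real d"
proof -
  have "2 * (\<Sum>e\<in>E. f e) = (\<Sum>v<g. c)" unfolding sum_over_vertices[symmetric] using assms by (intro sum.cong) auto
  then have "2 * (\<Sum>e\<in>E. f e) = c * real g" by simp
  moreover have "real g = 2 * real (card E) / real d" using handshake d by (simp add: field_simps)
  ultimately have "2 * (\<Sum>e\<in>E. f e) = 2 * (c * real (card E) / real d)" by (simp add: mult_ac)
  then show ?thesis by (simp only: mult_cancel_left) simp
qed

text \<open>The entropy bound is applied at every vertex, and with a deficit at one endpoint
  \<open>v0\<close> of the deviating edge. The deviation of m/n exceeds n^(-2/5), so n times its
  square gives n^(1/5); the 4 of the deficit becomes 8 because every edge is counted at both
  ends.\<close>

lemma prod_edge_weight_far: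
  assumes n: "n > 0" and m: "m \<in> balanced_weights n {..<g} E ends"
    and e0: "e0 \<in> E" "\<bar>real (m e0) - real n / real d\<bar> > real n powr (3/5)"
  shows "(\<Prod>e\<in>E. edge_weight n (m e)) \<le>
    exp (real (card E) * (real n * bethe (1 / real d) - 2 / real d * (real n * ln (real n) - real n))
      + real (card E) * (ln (real n + 1) + 1) - real n powr (1/5) / (8 * (real d)\<^sup>2))"
proof -
  define x where "x e = real (m e) / real n" for e
  define \<delta> where "\<delta> = real n powr (-2/5)"
  have bal: "\<And>v. v < g \<Longrightarrow> (\<Sum>e | e \<in> E \<and> v \<in> ends e. m e) = n" and le: "\<And>e. e \<in> E \<Longrightarrow> m e \<le> n"
    using m by (auto simp: balanced_weights_def)
  have xs: "(\<Sum>e | e \<in> E \<and> v \<in> ends e. x e) = 1" if "v < g" for v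
    using arg_cong[OF bal[OF that], of real] n by (simp add: x_def sum_divide_distrib[symmetric])
  have xsum: "(\<Sum>e\<in>E. x e) = real (card E) / real d" using sum_balanced[of x 1] xs by simp
  have x0: "\<bar>x e0 - 1 / real d\<bar> \<ge> \<delta>"
  proof -
    have "x e0 - 1 / real d = (real (m e0) - real n / real d) / real n" using n by (simp add: x_def diff_divide_distrib)
    then have "\<bar>x e0 - 1 / real d\<bar> = \<bar>real (m e0) - real n / real d\<bar> / real n" by simp
    also have "\<dots> \<ge> real n powr (3/5) / real n" using e0 by (intro divide_right_mono) auto
    also have "real n powr (3/5) / real n = real n powr (3/5) / real n powr 1" using n by simp
    also have "\<dots> = \<delta>" unfolding \<delta>_def by (subst powr_diff[symmetric]) simp
    finally show ?thesis .
  qed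
  obtain v0 where v0: "v0 < g" "v0 \<in> ends e0"
    using ends_subset[OF G conn e0(1)] card_ends[OF G conn e0(1)] by (metis card.empty ex_in_conv lessThan_iff subsetD zero_neq_numeral)
  have vb: "(\<Sum>e | e \<in> E \<and> v \<in> ends e. bethe (x e)) \<le> real d * bethe (1 / real d) - (if v = v0 then (\<delta> / real d)\<^sup>2 / 4 else 0)" if v: "v < g" for v
  proof (cases "v = v0")
    case True
    then show ?thesis
      using sum_bethe_le[of "{e \<in> E. v \<in> ends e}" d x e0 \<delta>] finite_edge_set degree[OF v] d xs[OF v] x0 e0(1) v0
      by (auto simp: x_def \<delta>_def)
  next
    \<comment> \<open>At the other vertices the bound is used with deviation 0, for which any
      incident edge will do.\<close>
    case False
    have "card {e \<in> E. v \<in> ends e} \<noteq> 0" using degree[OF v] d by simp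
    then obtain e1 where "e1 \<in> {e \<in> E. v \<in> ends e}" by (metis card.empty ex_in_conv)
    then show ?thesis
      using sum_bethe_le[of "{e \<in> E. v \<in> ends e}" d x e1 0] finite_edge_set degree[OF v] d xs[OF v] False
      by (auto simp: x_def)
  qed
  have "2 * (\<Sum>e\<in>E. bethe (x e)) = (\<Sum>v<g. \<Sum>e | e \<in> E \<and> v \<in> ends e. bethe (x e))" by (rule sum_over_vertices[symmetric])
  also have "\<dots> \<le> (\<Sum>v<g. real d * bethe (1 / real d) - (if v = v0 then (\<delta> / real d)\<^sup>2 / 4 else 0))"
    by (intro sum_mono vb) auto
  also have "\<dots> = real d * real g * bethe (1 / real d) - (\<delta> / real d)\<^sup>2 / 4"
    using v0 by (simp add: sum_subtractf)
  finally have bs: "(\<Sum>e\<in>E. bethe (x e)) \<le> real (card E) * bethe (1 / real d) - (\<delta> / real d)\<^sup>2 / 8"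
    unfolding handshake by simp
  have n\<delta>: "real n * (\<delta> / real d)\<^sup>2 / 8 = real n powr (1/5) / (8 * (real d)\<^sup>2)"
  proof -
    have "real n * \<delta>\<^sup>2 = real n powr 1 * (real n powr (-2/5) * real n powr (-2/5))" using n by (simp add: \<delta>_def power2_eq_square)
    also have "\<dots> = real n powr (1 + (- 2/5 + - 2/5))" by (simp only: powr_add)
    also have "\<dots> = real n powr (1/5)" by simp
    finally show ?thesis by (simp add: power_divide)
  qed
  define Q where "Q = real n * ln (real n) - real n"
  have "ln (\<Prod>e\<in>E. edge_weight n (m e)) = (\<Sum>e\<in>E. ln (edge_weight n (m e)))"
    using finite_edge_set by (intro ln_prod) (auto simp: less_imp_neq[OF edge_weight_pos, symmetric])
  also have "\<dots> \<le> (\<Sum>e\<in>E. real n * bethe (x e) - 2 * x e * Q + (ln (real n + 1) + 1))"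
    unfolding x_def Q_def by (intro sum_mono ln_edge_weight_le n le)
  also have "\<dots> = (\<Sum>e\<in>E. real n * bethe (x e) - 2 * Q * x e + (ln (real n + 1) + 1))"
    by (simp only: mult_ac)
  also have "\<dots> = real n * (\<Sum>e\<in>E. bethe (x e)) - 2 * Q * (\<Sum>e\<in>E. x e) + real (card E) * (ln (real n + 1) + 1)"
    by (simp add: sum.distrib sum_subtractf sum_distrib_left[symmetric])
  also have "real n * (\<Sum>e\<in>E. bethe (x e)) \<le> real n * (real (card E) * bethe (1 / real d) - (\<delta> / real d)\<^sup>2 / 8)"
    by (intro mult_left_mono bs) auto
  also have "\<dots> = real (card E) * (real n * bethe (1 / real d)) - real n powr (1/5) / (8 * (real d)\<^sup>2)"
    unfolding n\<delta>[symmetric] by (simp add: algebra_simps)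
  also have "2 * Q * (\<Sum>e\<in>E. x e) = real (card E) * (2 / real d * Q)" unfolding xsum by simp
  finally have "ln (\<Prod>e\<in>E. edge_weight n (m e)) \<le> real (card E) * (real n * bethe (1 / real d) - 2 / real d * Q)
      + real (card E) * (ln (real n + 1) + 1) - real n powr (1/5) / (8 * (real d)\<^sup>2)"
    by (simp add: right_diff_distrib)
  moreover have "(\<Prod>e\<in>E. edge_weight n (m e)) > 0" by (intro prod_pos) (auto simp: edge_weight_pos)
  ultimately show ?thesis unfolding Q_def[symmetric] by (metis exp_le_cancel_iff exp_ln)
qed

text \<open>The deviating edge supplies the Gaussian factor and every other factor is at most 2. The
  1 subtracted from the radius accounts for the offset between n/d and the integer centre.\<close>

lemma prod_shifted_binomial_far:
  assumes H: "bin_half d n > 0" and R: "real n powr (3/5) \<ge> 1" and n: "n > 0"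
    and m: "m \<in> E \<rightarrow>\<^sub>E {bin_centre d n - int (bin_half d n)..bin_centre d n + int (bin_half d n)}"
    and e0: "e0 \<in> E" "\<bar>real_of_int (m e0) - real n / real d\<bar> > real n powr (3/5)"
  shows "(\<Prod>e\<in>E. shifted_binomial (bin_half d n) (bin_centre d n) (m e)) \<le>
    2 ^ card E * exp (- ((real n powr (3/5) - 1)\<^sup>2 / (2 * edge_variance d * real n)))"
proof -
  let ?H = "bin_half d n" and ?c = "bin_centre d n"
  let ?b = "\<lambda>e. shifted_binomial ?H ?c (m e)"
  have range: "?c - int ?H \<le> m e" if "e \<in> E" for e using PiE_mem[OF m that] by simp
  have b: "?b e \<le> 2 * exp (- ((real_of_int (m e - ?c))\<^sup>2 / real ?H))" if "e \<in> E" for e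
    by (rule shifted_binomial_le[OF H range[OF that]])
  have b2: "?b e \<le> 2" if "e \<in> E" for e
    by (rule order_trans[OF b[OF that]]) simp
  have z: "real n powr (3/5) - 1 \<le> \<bar>real_of_int (m e0 - ?c)\<bar>"
    using e0(2) bin_centre_near[of d n] d by (simp add: abs_if split: if_splits)
  have "?b e0 \<le> 2 * exp (- ((real n powr (3/5) - 1)\<^sup>2 / (2 * edge_variance d * real n)))"
  proof -
    have "(real n powr (3/5) - 1)\<^sup>2 \<le> (real_of_int (m e0 - ?c))\<^sup>2"
      using power_mono[OF z, of 2] R by simp
    then have "(real n powr (3/5) - 1)\<^sup>2 / (2 * edge_variance d * real n) \<le> (real_of_int (m e0 - ?c))\<^sup>2 / real ?H"
      using bin_half_bounds(1)[OF d, of n] H by (intro frac_le) auto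
    then show ?thesis using b[OF e0(1)] by (smt (verit) exp_le_cancel_iff)
  qed
  moreover have "(\<Prod>e\<in>E - {e0}. ?b e) \<le> (\<Prod>e\<in>E - {e0}. 2)"
    using b2 by (intro prod_mono) (auto simp: shifted_binomial_nonneg)
  ultimately have "?b e0 * (\<Prod>e\<in>E - {e0}. ?b e) \<le>
      2 * exp (- ((real n powr (3/5) - 1)\<^sup>2 / (2 * edge_variance d * real n))) * (\<Prod>e\<in>E - {e0}. 2)"
    by (intro mult_mono prod_nonneg) (auto simp: shifted_binomial_nonneg)
  also have "(\<Prod>e\<in>E. ?b e) = ?b e0 * (\<Prod>e\<in>E - {e0}. ?b e)" using finite_edge_set e0 by (intro prod.remove)
  moreover have "(\<Prod>e\<in>E. 2 :: real) = 2 * (\<Prod>e\<in>E - {e0}. 2)" using finite_edge_set e0 by (intro prod.remove)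
  ultimately show ?thesis by (simp add: mult_ac)
qed

text \<open>Integer-valued copies of the balanced weights, comparable with those in
  \<open>bin_weights\<close>, where negative entries may occur.\<close>

definition int_weights :: "nat \<Rightarrow> ('e \<Rightarrow> int) set" where
  "int_weights n = {m \<in> E \<rightarrow>\<^sub>E {0..int n}. \<forall>v<g. (\<Sum>e | e \<in> E \<and> v \<in> ends e. m e) = int n}"

definition near_weights :: "nat \<Rightarrow> ('e \<Rightarrow> int) set" where
  "near_weights n = {m \<in> extensional E. (\<forall>e\<in>E. \<bar>real_of_int (m e) - real n / real d\<bar> \<le> real n powr (3/5)) \<and>
     (\<forall>v<g. (\<Sum>e | e \<in> E \<and> v \<in> ends e. m e) = int n)}"

definition bin_weights :: "nat \<Rightarrow> nat \<Rightarrow> ('e \<Rightarrow> int) set" where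
  "bin_weights k n = {m. m \<in> E \<rightarrow>\<^sub>E {bin_centre d n - int (bin_half d n)..bin_centre d n + int (bin_half d n)} \<and>
     (\<forall>v<k. (\<Sum>e | e \<in> E \<and> v \<in> ends e. m e) = int n)}"

definition lift_term :: "nat \<Rightarrow> ('e \<Rightarrow> int) \<Rightarrow> real" where
  "lift_term n m = (\<Prod>e\<in>E. edge_weight n (nat (m e)))"

definition bin_term :: "nat \<Rightarrow> ('e \<Rightarrow> int) \<Rightarrow> real" where
  "bin_term n m = (\<Prod>e\<in>E. shifted_binomial (bin_half d n) (bin_centre d n) (m e))"

lemma finite_int_weights: "finite (int_weights n)" and card_int_weights: "card (int_weights n) \<le> (n + 1) ^ card E"
proof -
  have fin: "finite (E \<rightarrow>\<^sub>E {0..int n})" using finite_edge_set by (intro finite_PiE) auto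
  have sub: "int_weights n \<subseteq> E \<rightarrow>\<^sub>E {0..int n}" by (auto simp: int_weights_def)
  show "finite (int_weights n)" by (rule finite_subset[OF sub fin])
  have "card (int_weights n) \<le> card (E \<rightarrow>\<^sub>E {0..int n})" by (rule card_mono[OF fin sub])
  then show "card (int_weights n) \<le> (n + 1) ^ card E" using finite_edge_set by (simp add: card_PiE nat_add_distrib)
qed

lemma finite_bin_weights: "finite (bin_weights k n)" and card_bin_weights: "card (bin_weights k n) \<le> (2 * bin_half d n + 1) ^ card E"
proof -
  let ?B = "{bin_centre d n - int (bin_half d n)..bin_centre d n + int (bin_half d n)}"
  have fin: "finite (E \<rightarrow>\<^sub>E ?B)" using finite_edge_set by (intro finite_PiE) auto
  have sub: "bin_weights k n \<subseteq> E \<rightarrow>\<^sub>E ?B" by (auto simp: bin_weights_def)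
  show "finite (bin_weights k n)" by (rule finite_subset[OF sub fin])
  have "card (bin_weights k n) \<le> card (E \<rightarrow>\<^sub>E ?B)" by (rule card_mono[OF fin sub])
  also have "card ?B = 2 * bin_half d n + 1" by simp
  then have "card (E \<rightarrow>\<^sub>E ?B) = (2 * bin_half d n + 1) ^ card E" using finite_edge_set by (simp add: card_PiE)
  finally show "card (bin_weights k n) \<le> (2 * bin_half d n + 1) ^ card E" .
qed

lemma nat_weights_balanced:
  assumes m: "m \<in> int_weights n"
  shows "(\<lambda>e\<in>E. nat (m e)) \<in> balanced_weights n {..<g} E ends"
proof -
  have m0: "0 \<le> m e \<and> m e \<le> int n" if "e \<in> E" for e using m that by (auto simp: int_weights_def)
  have "(\<Sum>e | e \<in> E \<and> v \<in> ends e. (\<lambda>e\<in>E. nat (m e)) e) = n" if "v < g" for v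
  proof -
    have "int (\<Sum>e | e \<in> E \<and> v \<in> ends e. (\<lambda>e\<in>E. nat (m e)) e) = (\<Sum>e | e \<in> E \<and> v \<in> ends e. m e)"
      unfolding int_sum by (intro sum.cong) (auto simp: m0)
    also have "\<dots> = int n" using m that by (simp add: int_weights_def)
    finally show ?thesis by (simp only: of_nat_eq_iff)
  qed
  moreover have "(\<lambda>e\<in>E. nat (m e)) \<in> E \<rightarrow>\<^sub>E {..n}" using m0 by (auto simp: nat_le_iff)
  ultimately show ?thesis by (simp add: balanced_weights_def)
qed

lemma sum_balanced_weights_eq:
  "(\<Sum>m\<in>balanced_weights n {..<g} E ends. \<Prod>e\<in>E. edge_weight n (m e)) = (\<Sum>m\<in>int_weights n. lift_term n m)"
proof (rule sum.reindex_bij_witness[where j = "\<lambda>m. \<lambda>e\<in>E. int (m e)" and i = "\<lambda>m. \<lambda>e\<in>E. nat (m e)"])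
  fix m assume m: "m \<in> balanced_weights n {..<g} E ends"
  then show "(\<lambda>e\<in>E. nat ((\<lambda>e\<in>E. int (m e)) e)) = m"
    by (auto simp: balanced_weights_def fun_eq_iff PiE_def extensional_def)
  have "(\<Sum>e | e \<in> E \<and> v \<in> ends e. (\<lambda>e\<in>E. int (m e)) e) = int n" if "v < g" for v
  proof -
    have "(\<Sum>e | e \<in> E \<and> v \<in> ends e. (\<lambda>e\<in>E. int (m e)) e) = (\<Sum>e | e \<in> E \<and> v \<in> ends e. int (m e))"
      by (intro sum.cong) auto
    also have "\<dots> = int (\<Sum>e | e \<in> E \<and> v \<in> ends e. m e)" by (simp only: of_nat_sum)
    also have "(\<Sum>e | e \<in> E \<and> v \<in> ends e. m e) = n" using m that by (simp add: balanced_weights_def)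
    finally show ?thesis .
  qed
  moreover have "(\<lambda>e\<in>E. int (m e)) \<in> E \<rightarrow>\<^sub>E {0..int n}" using m by (auto simp: balanced_weights_def)
  ultimately show "(\<lambda>e\<in>E. int (m e)) \<in> int_weights n" by (simp add: int_weights_def)
  show "lift_term n (\<lambda>e\<in>E. int (m e)) = (\<Prod>e\<in>E. edge_weight n (m e))" by (simp add: lift_term_def)
next
  fix m assume m: "m \<in> int_weights n"
  have m0: "0 \<le> m e \<and> m e \<le> int n" if "e \<in> E" for e using m that by (auto simp: int_weights_def)
  then show "(\<lambda>e\<in>E. int ((\<lambda>e\<in>E. nat (m e)) e)) = m"
    using m by (auto simp: int_weights_def fun_eq_iff PiE_def extensional_def)
  show "(\<lambda>e\<in>E. nat (m e)) \<in> balanced_weights n {..<g} E ends" by (rule nat_weights_balanced[OF m])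
qed

text \<open>Taking the product over the edges removes the linear terms, since the deviations from
  n/d of a balanced weight sum to zero. The remaining logarithmic error is at most
  \<open>card E\<close> times the error per edge, and continuity of exp at 0 makes it a relative
  error.\<close>

lemma near_terms_close:
  assumes \<eta>: "\<eta> > 0"
  shows "eventually (\<lambda>n. near_weights n \<subseteq> int_weights n \<and> (\<forall>k\<le>g. near_weights n \<subseteq> bin_weights k n) \<and>
    (\<forall>m\<in>near_weights n. \<bar>lift_term n m / exp (real (card E) * log_ratio d n) - bin_term n m\<bar> \<le> \<eta> * bin_term n m)) sequentially"
proof -
  have "isCont exp (0::real)" by simp
  then have "((\<lambda>t::real. exp t) \<longlongrightarrow> 1) (at 0)" by (simp add: isCont_def)
  then obtain \<delta> where \<delta>: "\<delta> > 0" "\<And>t::real. t \<noteq> 0 \<Longrightarrow> \<bar>t\<bar> < \<delta> \<Longrightarrow> \<bar>exp t - 1\<bar> < \<eta>"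
    using \<eta> unfolding tendsto_iff eventually_at dist_real_def by (metis UNIV_I diff_zero)
  \<comment> \<open>The total over all edges stays below \<open>\<delta>\<close>; the summand 1
    keeps the denominator positive.\<close>
  define \<epsilon> where "\<epsilon> = \<delta> / (2 * (real (card E) + 1))"
  have \<epsilon>: "\<epsilon> > 0" using \<delta>(1) by (simp add: \<epsilon>_def)
  have E\<epsilon>: "real (card E) * \<epsilon> < \<delta>"
  proof -
    have "real (card E) * \<epsilon> = \<delta> * (real (card E) / (2 * (real (card E) + 1)))" by (simp add: \<epsilon>_def)
    also have "\<dots> < \<delta> * 1" using \<delta>(1) by (intro mult_strict_left_mono) (auto simp: divide_less_eq)
    finally show ?thesis by simp
  qed
  show ?thesis using ln_ratio_near[OF d \<epsilon>]
  proof eventually_elim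
    case (elim n)
    let ?b = "\<lambda>j. shifted_binomial (bin_half d n) (bin_centre d n) j"
    let ?L = "ln (real n / real d) + ln (real n * (real d - 1) / real d)"
    have near: "0 \<le> j" "j \<le> int n" "j \<in> {bin_centre d n - int (bin_half d n)..bin_centre d n + int (bin_half d n)}"
      "edge_weight n (nat j) > 0" "?b j > 0"
      "\<bar>ln (edge_weight n (nat j)) - ln (?b j) - (log_ratio d n - (real_of_int j - real n / real d) * ?L)\<bar> \<le> \<epsilon>"
      if "\<bar>real_of_int j - real n / real d\<bar> \<le> real n powr (3/5)" for j
      using elim that by blast+
    have 1: "near_weights n \<subseteq> int_weights n"
      using near(1,2) by (auto simp: near_weights_def int_weights_def PiE_def)
    have 2: "near_weights n \<subseteq> bin_weights k n" if "k \<le> g" for k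
      using near(3) that unfolding near_weights_def bin_weights_def PiE_def Pi_def by fastforce
    have 3: "\<bar>lift_term n m / exp (real (card E) * log_ratio d n) - bin_term n m\<bar> \<le> \<eta> * bin_term n m" if m: "m \<in> near_weights n" for m
    proof -
      have nm: "\<bar>real_of_int (m e) - real n / real d\<bar> \<le> real n powr (3/5)" if "e \<in> E" for e
        using m that by (auto simp: near_weights_def)
      have bpos: "bin_term n m > 0" unfolding bin_term_def by (intro prod_pos near(5) nm)
      have lpos: "lift_term n m > 0" unfolding lift_term_def by (intro prod_pos near(4) nm)
      have "(\<Sum>e | e \<in> E \<and> v \<in> ends e. real_of_int (m e)) = real n" if "v < g" for v
      proof -
        have "(\<Sum>e | e \<in> E \<and> v \<in> ends e. m e) = int n" using m that by (auto simp: near_weights_def)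
        then show ?thesis by (metis of_int_sum of_int_of_nat_eq)
      qed
      then have sm: "(\<Sum>e\<in>E. real_of_int (m e)) = real n * real (card E) / real d"
        by (rule sum_balanced)
      have s0: "(\<Sum>e\<in>E. (real_of_int (m e) - real n / real d) * ?L) = 0"
        unfolding sum_distrib_right[symmetric] by (simp add: sum_subtractf sm)
      define t where "t = ln (lift_term n m) - ln (bin_term n m) - real (card E) * log_ratio d n"
      have "ln (lift_term n m) = (\<Sum>e\<in>E. ln (edge_weight n (nat (m e))))"
        unfolding lift_term_def using finite_edge_set by (intro ln_prod) (auto simp: less_imp_neq[OF edge_weight_pos, symmetric])
      moreover have "ln (bin_term n m) = (\<Sum>e\<in>E. ln (?b (m e)))"
        unfolding bin_term_def using finite_edge_set near(5)[OF nm] by (intro ln_prod) (auto simp: less_imp_neq[symmetric])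
      moreover have "(\<Sum>e\<in>E. ln (edge_weight n (nat (m e))) - ln (?b (m e)) - (log_ratio d n - (real_of_int (m e) - real n / real d) * ?L)) =
          (\<Sum>e\<in>E. ln (edge_weight n (nat (m e)))) - (\<Sum>e\<in>E. ln (?b (m e))) -
          (real (card E) * log_ratio d n - (\<Sum>e\<in>E. (real_of_int (m e) - real n / real d) * ?L))"
        by (simp only: sum_subtractf sum_constant)
      ultimately have t_eq: "t = (\<Sum>e\<in>E. ln (edge_weight n (nat (m e))) - ln (?b (m e)) - (log_ratio d n - (real_of_int (m e) - real n / real d) * ?L))"
        unfolding s0 t_def by (simp only: diff_zero)
      have "\<bar>t\<bar> \<le> (\<Sum>e\<in>E. \<bar>ln (edge_weight n (nat (m e))) - ln (?b (m e)) - (log_ratio d n - (real_of_int (m e) - real n / real d) * ?L)\<bar>)"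
        unfolding t_eq by (rule sum_abs)
      also have "\<dots> \<le> (\<Sum>e\<in>E. \<epsilon>)" by (intro sum_mono near(6) nm)
      also have "\<dots> < \<delta>" using E\<epsilon> by simp
      finally have t: "\<bar>t\<bar> < \<delta>" .
      have et: "\<bar>exp t - 1\<bar> \<le> \<eta>" using \<delta>(2)[OF _ t] \<eta> by (cases "t = 0") auto
      have "exp t = exp (ln (lift_term n m)) / exp (ln (bin_term n m)) / exp (real (card E) * log_ratio d n)"
        unfolding t_def by (simp only: exp_diff)
      then have "lift_term n m / exp (real (card E) * log_ratio d n) = exp t * bin_term n m"
        using bpos lpos by (simp add: field_simps)
      then have "lift_term n m / exp (real (card E) * log_ratio d n) - bin_term n m = (exp t - 1) * bin_term n m"
        by (simp add: left_diff_distrib)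
      then show ?thesis using et bpos by (simp add: abs_mult)
    qed
    show ?case using 1 2 3 by blast
  qed
qed

text \<open>The number of integer weights times the bound of \<open>prod_edge_weight_far\<close>,
  divided by exp (card E * \<open>log_ratio d n\<close>). The leading terms cancel, leaving -n^(1/5)
  / (8 d^2) against logarithms; \<open>bin_tail\<close> plays the same part for the binomial
  sum.\<close>

definition lift_tail :: "nat \<Rightarrow> real" where
  "lift_tail n = exp (real (card E) * ln (real n + 1) + real (card E) * (ln (real n + 1) + 1)
     - real (card E) * (ln ((real d - 1) * edge_variance d / 2) / 2) - real n powr (1/5) / (8 * (real d)\<^sup>2))"

definition bin_tail :: "nat \<Rightarrow> real" where
  "bin_tail n = exp (real (card E) * ln (4 * edge_variance d * real n + 1) + real (card E) * ln 2
     - (real n powr (3/5) - 1)\<^sup>2 / (2 * edge_variance d * real n))"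

lemma tails_LIMSEQ: "(\<lambda>n. (lift_tail n + bin_tail n) * (2 * pi * sqrt (real n)) ^ k) \<longlonglongrightarrow> 0"
proof -
  have v: "edge_variance d > 0" by (rule edge_variance_pos[OF d])
  define c where "c = 1 / (8 * (real d)\<^sup>2)"
  have c: "c > 0" using d by (simp add: c_def)
  define M where "M = real (card E) - real (card E) * (ln ((real d - 1) * edge_variance d / 2) / 2)"
  have "(\<lambda>n. exp (2 * real (card E) * ln (real n + 1) + M - c * real n powr (1/5) + real k * ln (2 * pi * sqrt (real n)))) \<longlonglongrightarrow> 0"
    using c by real_asymp
  moreover have "(\<lambda>n. exp (real (card E) * ln (4 * edge_variance d * real n + 1) + real (card E) * ln 2
     - (real n powr (3/5) - 1)\<^sup>2 / (2 * edge_variance d * real n) + real k * ln (2 * pi * sqrt (real n)))) \<longlonglongrightarrow> 0"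
    using v by real_asymp
  ultimately have "(\<lambda>n. exp (2 * real (card E) * ln (real n + 1) + M - c * real n powr (1/5) + real k * ln (2 * pi * sqrt (real n))) +
      exp (real (card E) * ln (4 * edge_variance d * real n + 1) + real (card E) * ln 2
     - (real n powr (3/5) - 1)\<^sup>2 / (2 * edge_variance d * real n) + real k * ln (2 * pi * sqrt (real n)))) \<longlonglongrightarrow> 0 + 0"
    by (rule tendsto_add)
  moreover have "eventually (\<lambda>n. exp (2 * real (card E) * ln (real n + 1) + M - c * real n powr (1/5) + real k * ln (2 * pi * sqrt (real n))) +
      exp (real (card E) * ln (4 * edge_variance d * real n + 1) + real (card E) * ln 2
     - (real n powr (3/5) - 1)\<^sup>2 / (2 * edge_variance d * real n) + real k * ln (2 * pi * sqrt (real n)))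
     = (lift_tail n + bin_tail n) * (2 * pi * sqrt (real n)) ^ k) sequentially"
    using eventually_gt_at_top[of 0]
  proof eventually_elim
    case (elim n)
    have p: "exp (real k * ln (2 * pi * sqrt (real n))) = (2 * pi * sqrt (real n)) ^ k"
      using elim by (simp add: exp_of_nat_mult)
    have l: "exp (2 * real (card E) * ln (real n + 1) + M - c * real n powr (1/5)) = lift_tail n"
      unfolding lift_tail_def M_def c_def by (simp add: algebra_simps)
    show ?case unfolding exp_add[of _ "real k * ln (2 * pi * sqrt (real n))"] p l bin_tail_def[symmetric]
      by (simp add: distrib_right)
  qed
  ultimately show ?thesis by (simp add: Lim_transform_eventually)
qed

lemma far_lift_sum_le:
  "eventually (\<lambda>n. (\<Sum>m\<in>int_weights n - near_weights n. lift_term n m) / exp (real (card E) * log_ratio d n) \<le> lift_tail n) sequentially"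
proof -
  have v: "edge_variance d > 0" by (rule edge_variance_pos[OF d])
  have "eventually (\<lambda>n. edge_variance d * real n \<ge> 1) sequentially" using v by real_asymp
  then show ?thesis using eventually_gt_at_top[of 0]
  proof eventually_elim
    case (elim n)
    let ?lm = "real n * bethe (1 / real d) - 2 / real d * (real n * ln (real n) - real n)"
    let ?T = "exp (real (card E) * ?lm + real (card E) * (ln (real n + 1) + 1) - real n powr (1/5) / (8 * (real d)\<^sup>2))"
    have each: "lift_term n m \<le> ?T" if m: "m \<in> int_weights n - near_weights n" for m
    proof -
      let ?k = "\<lambda>e\<in>E. nat (m e)"
      have m0: "0 \<le> m e \<and> m e \<le> int n" if "e \<in> E" for e using m that by (auto simp: int_weights_def)
      have k: "?k \<in> balanced_weights n {..<g} E ends" by (rule nat_weights_balanced) (use m in simp)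
      have "m \<in> extensional E" "\<forall>v<g. (\<Sum>e | e \<in> E \<and> v \<in> ends e. m e) = int n" using m by (auto simp: int_weights_def PiE_def)
      then obtain e0 where e0: "e0 \<in> E" "\<not> \<bar>real_of_int (m e0) - real n / real d\<bar> \<le> real n powr (3/5)"
        using m unfolding near_weights_def by blast
      then have "\<bar>real (?k e0) - real n / real d\<bar> > real n powr (3/5)" using m0[OF e0(1)] by simp
      from prod_edge_weight_far[OF elim(2) k e0(1) this]
      show ?thesis by (simp add: lift_term_def)
    qed
    have "(\<Sum>m\<in>int_weights n - near_weights n. lift_term n m) \<le> real (card (int_weights n - near_weights n)) * ?T"
      by (rule sum_bounded_above) (rule each)
    also have "\<dots> \<le> real ((n + 1) ^ card E) * ?T"
    proof (intro mult_right_mono)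
      have "card (int_weights n - near_weights n) \<le> card (int_weights n)" by (intro card_mono finite_int_weights) auto
      then show "real (card (int_weights n - near_weights n)) \<le> real ((n + 1) ^ card E)"
        using card_int_weights[of n] by (simp only: of_nat_le_iff)
    qed simp
    also have "real ((n + 1) ^ card E) = exp (real (card E) * ln (real n + 1))"
      by (simp add: exp_of_nat_mult add.commute)
    finally have "(\<Sum>m\<in>int_weights n - near_weights n. lift_term n m) / exp (real (card E) * log_ratio d n)
       \<le> exp (real (card E) * ln (real n + 1)) * ?T / exp (real (card E) * log_ratio d n)"
      by (intro divide_right_mono) auto
    also have "\<dots> = exp (real (card E) * ln (real n + 1) + (real (card E) * ?lm + real (card E) * (ln (real n + 1) + 1) - real n powr (1/5) / (8 * (real d)\<^sup>2)) - real (card E) * log_ratio d n)"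
      by (simp only: exp_add exp_diff)
    also have "\<dots> \<le> lift_tail n"
    proof -
      have "ln ((real d - 1) * edge_variance d / 2) \<le> ln ((real d - 1) * real (bin_half d n) / (2 * real n))"
      proof -
        have "edge_variance d * real n \<le> real (bin_half d n)"
          using bin_half_bounds(2)[OF d, of n] elim(1) by simp
        then have "(real d - 1) * (edge_variance d * real n) \<le> (real d - 1) * real (bin_half d n)"
          using d by (intro mult_left_mono) auto
        then have le: "(real d - 1) * edge_variance d / 2 \<le> (real d - 1) * real (bin_half d n) / (2 * real n)"
          using elim(2) by (simp add: field_simps)
        have pos: "0 < (real d - 1) * edge_variance d / 2" using v d by simp
        show ?thesis using le pos by (subst ln_le_cancel_iff) linarith+
      qed
      then have "real (card E) * (ln ((real d - 1) * edge_variance d / 2) / 2) \<le> real (card E) * (ln ((real d - 1) * real (bin_half d n) / (2 * real n)) / 2)"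
        by (intro mult_left_mono divide_right_mono) auto
      moreover have "real (card E) * log_ratio d n = real (card E) * ?lm + real (card E) * (ln ((real d - 1) * real (bin_half d n) / (2 * real n)) / 2)"
        by (simp only: log_ratio_def distrib_left)
      ultimately show ?thesis unfolding lift_tail_def by (simp only: exp_le_cancel_iff)
    qed
    finally show ?case .
  qed
qed

text \<open>The assumption \<open>red\<close> restores the dropped constraint, so a weight can fail
  to be near only through an edge far from n/d.\<close>

lemma far_bin_sum_le:
  assumes red: "\<And>n m. \<forall>v<k. (\<Sum>e | e \<in> E \<and> v \<in> ends e. m e) = int n \<Longrightarrow> \<forall>v<g. (\<Sum>e | e \<in> E \<and> v \<in> ends e. m e) = int n"
  shows "eventually (\<lambda>n. (\<Sum>m\<in>bin_weights k n - near_weights n. bin_term n m) \<le> bin_tail n) sequentially"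
proof -
  have v: "edge_variance d > 0" by (rule edge_variance_pos[OF d])
  have "eventually (\<lambda>n. edge_variance d * real n > 1) sequentially" using v by real_asymp
  moreover have "eventually (\<lambda>n. real n powr (3/5) \<ge> 1) sequentially" by real_asymp
  ultimately show ?thesis using eventually_gt_at_top[of 0]
  proof eventually_elim
    case (elim n)
    let ?T = "2 ^ card E * exp (- ((real n powr (3/5) - 1)\<^sup>2 / (2 * edge_variance d * real n)))"
    have "real (bin_half d n) > 0" using bin_half_bounds(2)[OF d, of n] elim(1) by simp
    then have H: "bin_half d n > 0" by simp
    have each: "bin_term n m \<le> ?T" if m: "m \<in> bin_weights k n - near_weights n" for m
    proof -
      have m1: "m \<in> E \<rightarrow>\<^sub>E {bin_centre d n - int (bin_half d n)..bin_centre d n + int (bin_half d n)}"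
        using m by (simp add: bin_weights_def)
      then have "m \<in> extensional E" by (simp add: PiE_def)
      moreover have "\<forall>v<g. (\<Sum>e | e \<in> E \<and> v \<in> ends e. m e) = int n" by (rule red) (use m in \<open>simp add: bin_weights_def\<close>)
      ultimately obtain e0 where e0: "e0 \<in> E" "\<not> \<bar>real_of_int (m e0) - real n / real d\<bar> \<le> real n powr (3/5)"
        using m unfolding near_weights_def by blast
      then have "\<bar>real_of_int (m e0) - real n / real d\<bar> > real n powr (3/5)" by simp
      from prod_shifted_binomial_far[OF H elim(2,3) m1 e0(1) this]
      show ?thesis by (simp add: bin_term_def)
    qed
    have "(\<Sum>m\<in>bin_weights k n - near_weights n. bin_term n m) \<le> real (card (bin_weights k n - near_weights n)) * ?T"
      by (rule sum_bounded_above) (rule each)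
    also have "\<dots> \<le> (4 * edge_variance d * real n + 1) ^ card E * ?T"
    proof (intro mult_right_mono)
      have "card (bin_weights k n - near_weights n) \<le> card (bin_weights k n)" by (intro card_mono finite_bin_weights) auto
      then have "real (card (bin_weights k n - near_weights n)) \<le> real ((2 * bin_half d n + 1) ^ card E)"
        using card_bin_weights[of k n] by (simp only: of_nat_le_iff)
      also have "\<dots> = (2 * real (bin_half d n) + 1) ^ card E" by (simp add: add.commute)
      also have "\<dots> \<le> (4 * edge_variance d * real n + 1) ^ card E"
      proof (rule power_mono)
        show "2 * real (bin_half d n) + 1 \<le> 4 * edge_variance d * real n + 1"
          using bin_half_bounds(1)[OF d, of n] by linarith
      qed simp
      finally show "real (card (bin_weights k n - near_weights n)) \<le> (4 * edge_variance d * real n + 1) ^ card E" .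
    qed simp
    also have "(4 * edge_variance d * real n + 1) ^ card E = exp (real (card E) * ln (4 * edge_variance d * real n + 1))"
    proof -
      have "4 * edge_variance d * real n + 1 > 0" using v by (intro add_nonneg_pos) auto
      then show ?thesis by (simp add: exp_of_nat_mult)
    qed
    also have "(2::real) ^ card E = exp (real (card E) * ln 2)" by (simp add: exp_of_nat_mult)
    also have "exp (real (card E) * ln (4 * edge_variance d * real n + 1)) *
        (exp (real (card E) * ln 2) * exp (- ((real n powr (3/5) - 1)\<^sup>2 / (2 * edge_variance d * real n)))) = bin_tail n"
      unfolding bin_tail_def by (simp only: exp_add[symmetric]) (simp add: algebra_simps)
    finally show ?case .
  qed
qed

text \<open>The two sums differ by at most \<open>\<eta>\<close> times the binomial sum plus tails.
  The normalised binomial sum converges, hence is eventually bounded, so both contributions can be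
  made arbitrarily small.\<close>

lemma lift_sum_tendsto:
  assumes k: "k \<le> g"
    and red: "\<And>n m. \<forall>v<k. (\<Sum>e | e \<in> E \<and> v \<in> ends e. m e) = int n \<Longrightarrow> \<forall>v<g. (\<Sum>e | e \<in> E \<and> v \<in> ends e. m e) = int n"
    and lim: "((\<lambda>n. (\<Sum>m\<in>bin_weights k n. bin_term n m) * (2 * pi * sqrt (real n)) ^ k) \<longlongrightarrow> L) F"
    and F: "F \<le> sequentially"
  shows "((\<lambda>n. (\<Sum>m\<in>int_weights n. lift_term n m) / exp (real (card E) * log_ratio d n) * (2 * pi * sqrt (real n)) ^ k) \<longlongrightarrow> L) F"
proof -
  define S where "S n = (\<Sum>m\<in>int_weights n. lift_term n m) / exp (real (card E) * log_ratio d n)" for n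
  define T where "T n = (\<Sum>m\<in>bin_weights k n. bin_term n m)" for n
  define p where "p n = (2 * pi * sqrt (real n)) ^ k" for n
  have p0: "p n \<ge> 0" for n by (simp add: p_def)
  have far_bin: "eventually (\<lambda>n. (\<Sum>m\<in>bin_weights k n - near_weights n. bin_term n m) \<le> bin_tail n) sequentially"
    by (rule far_bin_sum_le[of k]) (fact red)
  have bound: "eventually (\<lambda>n. \<bar>S n - T n\<bar> \<le> \<eta> * T n + (lift_tail n + bin_tail n)) F" if \<eta>: "\<eta> > 0" for \<eta>
  proof (rule filter_leD[OF F])
    show "eventually (\<lambda>n. \<bar>S n - T n\<bar> \<le> \<eta> * T n + (lift_tail n + bin_tail n)) sequentially"
      using near_terms_close[OF \<eta>] far_lift_sum_le far_bin
    proof eventually_elim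
      case (elim n)
      let ?N = "near_weights n" and ?C = "exp (real (card E) * log_ratio d n)"
      have sub: "?N \<subseteq> int_weights n" "?N \<subseteq> bin_weights k n" using elim(1) k by auto
      have lift0: "0 \<le> lift_term n m" for m unfolding lift_term_def by (intro prod_nonneg) (simp add: edge_weight_def)
      have bin0: "0 \<le> bin_term n m" for m unfolding bin_term_def by (intro prod_nonneg) (simp add: shifted_binomial_nonneg)
      have S: "S n = (\<Sum>m\<in>?N. lift_term n m / ?C) + (\<Sum>m\<in>int_weights n - ?N. lift_term n m) / ?C"
        unfolding S_def by (subst sum.subset_diff[OF sub(1) finite_int_weights]) (simp add: add_divide_distrib sum_divide_distrib)
      have T: "T n = (\<Sum>m\<in>?N. bin_term n m) + (\<Sum>m\<in>bin_weights k n - ?N. bin_term n m)"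
        unfolding T_def by (subst sum.subset_diff[OF sub(2) finite_bin_weights]) simp
      have "\<bar>(\<Sum>m\<in>?N. lift_term n m / ?C) - (\<Sum>m\<in>?N. bin_term n m)\<bar> \<le> (\<Sum>m\<in>?N. \<bar>lift_term n m / ?C - bin_term n m\<bar>)"
        unfolding sum_subtractf[symmetric] by (rule sum_abs)
      also have "\<dots> \<le> (\<Sum>m\<in>?N. \<eta> * bin_term n m)" using elim(1) by (intro sum_mono) blast
      also have "\<dots> = \<eta> * (\<Sum>m\<in>?N. bin_term n m)" by (simp add: sum_distrib_left)
      also have "\<dots> \<le> \<eta> * T n" unfolding T using \<eta> bin0 by (intro mult_left_mono) (auto intro: sum_nonneg)
      finally have "\<bar>(\<Sum>m\<in>?N. lift_term n m / ?C) - (\<Sum>m\<in>?N. bin_term n m)\<bar> \<le> \<eta> * T n" .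
      moreover have "0 \<le> (\<Sum>m\<in>int_weights n - ?N. lift_term n m) / ?C" by (intro divide_nonneg_nonneg sum_nonneg lift0) auto
      moreover have "0 \<le> (\<Sum>m\<in>bin_weights k n - ?N. bin_term n m)" by (intro sum_nonneg bin0)
      ultimately show ?case using elim(2,3) unfolding S T by linarith
    qed
  qed
  have tails: "((\<lambda>n. (lift_tail n + bin_tail n) * p n) \<longlongrightarrow> 0) F"
    unfolding p_def by (rule tendsto_mono[OF F tails_LIMSEQ])
  have "((\<lambda>n. S n * p n - T n * p n) \<longlongrightarrow> 0) F"
  proof (rule tendstoI)
    fix e :: real assume e: "e > 0"
    \<comment> \<open>\<open>\<bar>L\<bar> + 1\<close> eventually bounds the normalised binomial
      sum, so this choice leaves e/2 for the tails.\<close>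
    define \<eta> where "\<eta> = e / 2 / (\<bar>L\<bar> + 1)"
    have L1: "\<bar>L\<bar> + 1 > 0" by linarith
    have \<eta>: "\<eta> > 0" using e L1 by (simp add: \<eta>_def)
    have "eventually (\<lambda>n. \<bar>(lift_tail n + bin_tail n) * p n\<bar> < e / 2) F"
      using tendstoD[OF tails, of "e / 2"] e by (simp add: dist_real_def)
    moreover have "eventually (\<lambda>n. T n * p n < \<bar>L\<bar> + 1) F"
      by (rule order_tendstoD(2)[OF lim[folded T_def p_def]]) linarith
    ultimately show "eventually (\<lambda>n. dist (S n * p n - T n * p n) 0 < e) F" using bound[OF \<eta>]
    proof eventually_elim
      case (elim n)
      have "\<bar>S n - T n\<bar> * p n \<le> (\<eta> * T n + (lift_tail n + bin_tail n)) * p n"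
        by (intro mult_right_mono elim(3) p0)
      also have "\<dots> = \<eta> * (T n * p n) + (lift_tail n + bin_tail n) * p n" by (simp add: algebra_simps)
      also have "\<dots> < \<eta> * (\<bar>L\<bar> + 1) + e / 2"
        using elim(1,2) \<eta> by (intro add_strict_mono mult_strict_left_mono) auto
      also have "\<eta> * (\<bar>L\<bar> + 1) = e / 2" unfolding \<eta>_def using L1 by (intro nonzero_eq_divide_eq[THEN iffD1]) simp_all
      finally have "\<bar>S n - T n\<bar> * p n < e" by simp
      moreover have "\<bar>S n * p n - T n * p n\<bar> = \<bar>S n - T n\<bar> * p n"
        using p0[of n] by (simp add: left_diff_distrib[symmetric] abs_mult)
      ultimately show ?case by (simp add: dist_real_def)
    qed
  qed
  from tendsto_add[OF this lim[folded T_def p_def]] show ?thesis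
    unfolding S_def p_def by simp
qed

section \<open>Asymptotics of the expectation\<close>

text \<open>By the handshake identity \<open>card E\<close> times 2/d equals g, so the terms n ln n
  - n in \<open>log_ratio\<close> cancel those of the g factorials. What remains is g Stirling
  constants and the rounding of \<open>bin_half\<close>, both convergent.\<close>

lemma Stirling_factor_tendsto:
  "(\<lambda>n. real g * ln (fact n) + real (card E) * log_ratio d n - real g / 2 * ln (2 * pi * real n)
     - real (card E) / 2 * ln ((real d - 1) * edge_variance d) - real n * real (card E) * bethe (1 / real d)) \<longlonglongrightarrow> 0"
proof -
  have v: "edge_variance d > 0" by (rule edge_variance_pos[OF d])
  have "(\<lambda>n. (real d - 1) * (real (bin_half d n) / real n) / 2) \<longlonglongrightarrow> (real d - 1) * (2 * edge_variance d) / 2"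
    by (intro tendsto_intros bin_half_LIMSEQ d) simp
  then have lim: "(\<lambda>n. ln ((real d - 1) * (real (bin_half d n) / real n) / 2)) \<longlonglongrightarrow> ln ((real d - 1) * (2 * edge_variance d) / 2)"
    by (rule tendsto_ln) (use d v in auto)
  have "(\<lambda>n. real g * (stirling_seq n - ln (2 * pi) / 2) + real (card E) / 2 *
      (ln ((real d - 1) * (real (bin_half d n) / real n) / 2) - ln ((real d - 1) * (2 * edge_variance d) / 2))) \<longlonglongrightarrow>
      real g * (ln (2 * pi) / 2 - ln (2 * pi) / 2) + real (card E) / 2 *
      (ln ((real d - 1) * (2 * edge_variance d) / 2) - ln ((real d - 1) * (2 * edge_variance d) / 2))"
    by (intro tendsto_add tendsto_mult tendsto_diff tendsto_const stirling_seq_LIMSEQ lim)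
  moreover have "eventually (\<lambda>n. real g * (stirling_seq n - ln (2 * pi) / 2) + real (card E) / 2 *
      (ln ((real d - 1) * (real (bin_half d n) / real n) / 2) - ln ((real d - 1) * (2 * edge_variance d) / 2)) =
      real g * ln (fact n) + real (card E) * log_ratio d n - real g / 2 * ln (2 * pi * real n)
     - real (card E) / 2 * ln ((real d - 1) * edge_variance d) - real n * real (card E) * bethe (1 / real d)) sequentially"
    using eventually_gt_at_top[of 0]
  proof eventually_elim
    case (elim n)
    define a where "a = ln ((real d - 1) * real (bin_half d n) / (2 * real n))"
    define b where "b = ln ((real d - 1) * edge_variance d)"
    define Q where "Q = real n * ln (real n) - real n"
    define be where "be = real n * bethe (1 / real d)"
    define c where "c = real (card E)"
    define p where "p = ln (real n)"
    define w where "w = ln (2 * pi)"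
    have a: "ln ((real d - 1) * (real (bin_half d n) / real n) / 2) = a" by (simp add: a_def mult.commute)
    have b: "ln ((real d - 1) * (2 * edge_variance d) / 2) = b" by (simp add: b_def)
    have lr: "log_ratio d n = be - 2 / real d * Q + a / 2" by (simp add: log_ratio_def be_def Q_def a_def)
    have nc: "real n * real (card E) * bethe (1 / real d) = c * be" by (simp add: be_def c_def)
    have ln2: "ln (2 * pi * real n) = w + p" using elim by (simp add: w_def p_def ln_mult)
    have "c * (2 / real d * Q) = real g * Q" using handshake d by (simp add: c_def field_simps)
    then have "c * log_ratio d n = c * be - real g * Q + c / 2 * a" unfolding lr by (simp add: distrib_left right_diff_distrib)
    moreover have "stirling_seq n = ln (fact n) - Q - p / 2" by (simp add: stirling_seq_def Q_def p_def algebra_simps)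
    ultimately show ?case unfolding a b nc ln2 unfolding b_def[symmetric] c_def[symmetric] w_def[symmetric]
      by (simp add: distrib_left right_diff_distrib)
  qed
  ultimately show ?thesis by (simp add: Lim_transform_eventually)
qed

text \<open>The factorials supply (2 pi n)^(g/2) and the k Gaussian dimensions (2 pi n)^(-k/2); the
  surplus is the power with exponent (g - k)/2. Everything is compared inside one exponential, as a
  linear form in the logarithms of r - 1, r (r - 2), r, 2 pi and n.\<close>

lemma lift_limit_eq:
  assumes k: "k \<le> g" and D: "D > 0" and n: "n > 0"
  shows "exp (real g / 2 * ln (2 * pi * real n) + real (card E) / 2 * ln ((real d - 1) * edge_variance d) + real n * real (card E) * bethe (1 / real d))
      * sqrt ((2 * pi) ^ k / (edge_variance d ^ k * D)) / (2 * pi * sqrt (real n)) ^ k = lift_limit d g (real (g - k) / 2) D n"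
proof -
  define r where "r = real d"
  define s where "s = real g"
  define \<kappa> where "\<kappa> = real (g - k) / 2"
  define a where "a = ln (r - 1)"
  define b where "b = ln (r * (r - 2))"
  define q where "q = ln r"
  define w where "w = ln (2 * pi)"
  define p where "p = ln (real n)"
  have r: "r \<ge> 3" using d by (simp add: r_def)
  have rp: "r - 1 > 0" "r * (r - 2) > 0" "r > 0" using r by auto
  have kk: "real k = s - 2 * \<kappa>" using k by (simp add: s_def \<kappa>_def of_nat_diff field_simps)
  have cE: "real (card E) = r * s / 2" using handshake by (simp add: r_def s_def)
  have v: "edge_variance d > 0" by (rule edge_variance_pos[OF d])
  have lv: "ln (edge_variance d) = a - b" using rp by (simp add: edge_variance_def a_def b_def r_def[symmetric] ln_div)
  have lrv: "ln ((real d - 1) * edge_variance d) = 2 * a - b" using rp v lv by (simp add: ln_mult a_def r_def[symmetric])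
  have lnn: "ln (2 * pi * real n) = w + p" using n by (simp add: w_def p_def ln_mult)
  have rb: "r * bethe (1 / real d) = (r - 1) * a - (r - 2) * q"
  proof -
    have "1 - 1 / r = (r - 1) / r" using r by (simp add: field_simps)
    then have "bethe (1 / r) = (r - 1) / r * (a - q) + 1 / r * q"
      using rp by (simp add: bethe_def ln_div a_def q_def)
    then have "r * bethe (1 / r) = (r - 1) * (a - q) + q" using rp by (simp add: distrib_left)
    then show ?thesis by (simp add: r_def[symmetric] algebra_simps)
  qed
  have e1: "sqrt ((2 * pi) ^ k / (edge_variance d ^ k * D)) = exp (real k / 2 * w - real k / 2 * (a - b)) / sqrt D"
  proof -
    have "(2 * pi) ^ k = exp (real k * w)" by (simp add: exp_of_nat_mult w_def)
    moreover have "edge_variance d ^ k = exp (real k * (a - b))" using v by (simp add: exp_of_nat_mult lv[symmetric])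
    ultimately have "(2 * pi) ^ k / (edge_variance d ^ k * D) = exp (real k * w - real k * (a - b)) / D"
      by (simp add: exp_diff)
    also have "exp (real k * w - real k * (a - b)) = (exp (real k / 2 * w - real k / 2 * (a - b)))\<^sup>2"
      unfolding exp_double[symmetric] by (simp add: field_simps)
    finally show ?thesis by (simp add: real_sqrt_divide)
  qed
  have e2: "(2 * pi * sqrt (real n)) ^ k = exp (real k * (w + p / 2))"
  proof -
    have "2 * pi * sqrt (real n) = exp (w + p / 2)"
      using n by (simp add: exp_add w_def p_def ln_sqrt[symmetric])
    then show ?thesis by (simp add: exp_of_nat_mult)
  qed
  have e3: "((r - 1) powr (r - 1) / r powr (r - 2)) powr (s * real n / 2) = exp (s * real n / 2 * ((r - 1) * a - (r - 2) * q))"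
    using rp by (simp add: powr_def a_def q_def exp_diff[symmetric])
  have "lift_limit d g \<kappa> D n = exp (((r - 1) * s / 2 + \<kappa>) * a - (r * s / 4 - s / 2 + \<kappa>) * b + \<kappa> * (w + p) + s * real n / 2 * ((r - 1) * a - (r - 2) * q)) / sqrt D"
  proof -
    have "(r - 1) powr ((r - 1) * s / 2 + \<kappa>) = exp (((r - 1) * s / 2 + \<kappa>) * a)" using rp by (simp add: powr_def a_def)
    moreover have "(r * (r - 2)) powr (r * s / 4 - s / 2 + \<kappa>) = exp ((r * s / 4 - s / 2 + \<kappa>) * b)" using rp r by (simp add: powr_def b_def)
    moreover have "(2 * pi * real n) powr \<kappa> = exp (\<kappa> * (w + p))" using n lnn by (simp add: powr_def)
    ultimately show ?thesis
      unfolding lift_limit_def Let_def r_def[symmetric] s_def[symmetric] e3 by (simp add: exp_add exp_diff)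
  qed
  moreover have "exp (real g / 2 * ln (2 * pi * real n) + real (card E) / 2 * ln ((real d - 1) * edge_variance d) + real n * real (card E) * bethe (1 / real d))
      * (exp (real k / 2 * w - real k / 2 * (a - b)) / sqrt D) / exp (real k * (w + p / 2)) =
      exp (s / 2 * (w + p) + r * s / 4 * (2 * a - b) + real n * s / 2 * ((r - 1) * a - (r - 2) * q)
        + (real k / 2 * w - real k / 2 * (a - b)) - real k * (w + p / 2)) / sqrt D"
  proof -
    have gen: "exp x * (exp y / sqrt D) / exp z = exp (x + y - z) / sqrt D" for x y z :: real
      by (simp add: exp_add exp_diff)
    have "real n * real (card E) * bethe (1 / real d) = real n * s / 2 * (r * bethe (1 / real d))" by (simp add: cE)
    then have nb: "real n * real (card E) * bethe (1 / real d) = real n * s / 2 * ((r - 1) * a - (r - 2) * q)" unfolding rb .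
    have cE2: "real (card E) / 2 = r * s / 4" by (simp add: cE)
    show ?thesis unfolding gen lnn lrv nb cE2 s_def[symmetric] ..
  qed
  moreover have "s / 2 * (w + p) + r * s / 4 * (2 * a - b) + real n * s / 2 * ((r - 1) * a - (r - 2) * q)
        + (real k / 2 * w - real k / 2 * (a - b)) - real k * (w + p / 2) =
      ((r - 1) * s / 2 + \<kappa>) * a - (r * s / 4 - s / 2 + \<kappa>) * b + \<kappa> * (w + p) + s * real n / 2 * ((r - 1) * a - (r - 2) * q)"
    unfolding kk by (simp add: field_simps)
  ultimately show ?thesis unfolding e1 e2 \<kappa>_def[symmetric] by (simp only:)
qed

text \<open>Both cases at once: \<open>k = g\<close> with \<open>\<gamma> = 2\<close> for
  non-bipartite graphs, and \<open>k = g - 1\<close> with \<open>\<gamma> = 1\<close> for bipartite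
  ones, where \<open>red\<close> says that the remaining constraints imply the last.\<close>

theorem expected_perfect_matchings_asymp_equiv:
  assumes k: "k \<le> g"
    and red: "\<And>n m. \<forall>v<k. (\<Sum>e | e \<in> E \<and> v \<in> ends e. m e) = int n \<Longrightarrow> \<forall>v<g. (\<Sum>e | e \<in> E \<and> v \<in> ends e. m e) = int n"
    and coer: "\<exists>C>0. \<forall>\<theta>. (\<Sum>v<k. (sin (\<theta> v))\<^sup>2) \<le> C * (\<Sum>e\<in>E. (sin (edge_angle k ends \<theta> e / 2))\<^sup>2)"
    and N: "\<And>n \<epsilon>. n \<in> N \<Longrightarrow> \<epsilon> \<in> even_shifts k E ends \<Longrightarrow> even (n * (\<Sum>v<k. \<epsilon> v))"
    and \<gamma>: "card (even_shifts k E ends) = \<gamma>" "\<gamma> > 0"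
  shows "expected_perfect_matchings {..<g} E ends \<sim>[inf sequentially (principal N)]
    (\<lambda>n. real \<gamma> * lift_limit d g (real (g - k) / 2) (det (mat k k (\<lambda>(i, j). gram E ends i j))) n)"
proof -
  let ?F = "inf sequentially (principal N)" and ?v = "edge_variance d"
  let ?S = "\<lambda>n. (\<Sum>m\<in>int_weights n. lift_term n m) / exp (real (card E) * log_ratio d n) * (2 * pi * sqrt (real n)) ^ k"
  let ?Z = "\<lambda>n. real g * ln (fact n) + real (card E) * log_ratio d n - real g / 2 * ln (2 * pi * real n)
     - real (card E) / 2 * ln ((real d - 1) * ?v) - real n * real (card E) * bethe (1 / real d)"
  define D where "D = det (mat k k (\<lambda>(i, j). gram E ends i j))"
  have F: "?F \<le> sequentially" by simp
  have v: "?v > 0" by (rule edge_variance_pos[OF d])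
  obtain C where C: "C > 0" "\<And>\<theta>. (\<Sum>v<k. (sin (\<theta> v))\<^sup>2) \<le> C * (\<Sum>e\<in>E. (sin (edge_angle k ends \<theta> e / 2))\<^sup>2)"
    using coer by blast
  have D: "D > 0" unfolding D_def by (rule gaussian_integral_gram(1)[OF G conn C(2) v])
  define J where "J = sqrt ((2 * pi) ^ k / (?v ^ k * D))"
  have J: "J > 0" using v D by (simp add: J_def)
  have J_eq: "(\<integral>x. exp (- (2 * ?v / 4 * (\<Sum>e\<in>E. (edge_angle k ends x e)\<^sup>2))) \<partial>Pi\<^sub>M {..<k} (\<lambda>_. lborel)) = J"
    using gaussian_integral_gram(2)[OF G conn C(2) v] unfolding J_def D_def by simp
  have "((\<lambda>n. (\<Sum>m | m \<in> E \<rightarrow>\<^sub>E {bin_centre d n - int (bin_half d n)..bin_centre d n + int (bin_half d n)} \<and>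
        (\<forall>v<k. (\<Sum>e | e \<in> E \<and> v \<in> ends e. m e) = int n).
       \<Prod>e\<in>E. shifted_binomial (bin_half d n) (bin_centre d n) (m e)) * (2 * pi * sqrt (real n)) ^ k) \<longlongrightarrow>
     real (card (even_shifts k E ends)) *
       (\<integral>x. exp (- (2 * ?v / 4 * (\<Sum>e\<in>E. (edge_angle k ends x e)\<^sup>2))) \<partial>Pi\<^sub>M {..<k} (\<lambda>_. lborel))) ?F"
  proof (rule binomial_constrained_sum_tendsto[OF finite_edge_set _ _ C bin_half_LIMSEQ[OF d] _ _ N])
    show "d > 0" using d by simp
    show "card {e \<in> E. v \<in> ends e} = d" if "v < k" for v using degree that k by simp
    show "2 * ?v > 0" using v by simp
    show "\<bar>real_of_int (bin_centre d n) - real n / real d\<bar> \<le> 1" for n using bin_centre_near d by simp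
  qed
  then have bin_lim: "((\<lambda>n. (\<Sum>m\<in>bin_weights k n. bin_term n m) * (2 * pi * sqrt (real n)) ^ k) \<longlongrightarrow> real \<gamma> * J) ?F"
    unfolding J_eq \<gamma>(1) bin_weights_def bin_term_def .
  have "((\<lambda>n. ?S n) \<longlongrightarrow> real \<gamma> * J) ?F"
    by (rule lift_sum_tendsto[OF k _ bin_lim F]) (fact red)
  then have "((\<lambda>n. ?S n / (real \<gamma> * J)) \<longlongrightarrow> real \<gamma> * J / (real \<gamma> * J)) ?F"
    by (intro tendsto_divide tendsto_const) (use \<gamma> J in auto)
  moreover have "((\<lambda>n. exp (?Z n)) \<longlongrightarrow> exp 0) ?F"
    by (intro tendsto_exp tendsto_mono[OF F Stirling_factor_tendsto])
  ultimately have "((\<lambda>n. ?S n / (real \<gamma> * J) *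
      exp (?Z n)) \<longlongrightarrow> real \<gamma> * J / (real \<gamma> * J) * exp 0) ?F"
    by (rule tendsto_mult)
  then have lim: "((\<lambda>n. ?S n / (real \<gamma> * J) *
      exp (?Z n)) \<longlongrightarrow> 1) ?F"
    using \<gamma> J by simp
  have pos: "eventually (\<lambda>n. n > 0) ?F" by (rule filter_leD[OF F eventually_gt_at_top])
  show ?thesis unfolding D_def[symmetric]
  proof (rule asymp_equivI')
    show "((\<lambda>n. expected_perfect_matchings {..<g} E ends n / (real \<gamma> * lift_limit d g (real (g - k) / 2) D n)) \<longlongrightarrow> 1) ?F"
    proof (rule Lim_transform_eventually[OF lim])
      show "eventually (\<lambda>n. ?S n / (real \<gamma> * J) *
      exp (?Z n) =
      expected_perfect_matchings {..<g} E ends n / (real \<gamma> * lift_limit d g (real (g - k) / 2) D n)) ?F"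
        using pos
      proof eventually_elim
        case (elim n)
        define S where "S = (\<Sum>m\<in>int_weights n. lift_term n m)"
        define c where "c = exp (real (card E) * log_ratio d n)"
        define P where "P = (2 * pi * sqrt (real n)) ^ k"
        define M where "M = exp (real g / 2 * ln (2 * pi * real n) + real (card E) / 2 * ln ((real d - 1) * ?v) + real n * real (card E) * bethe (1 / real d))"
        have pp: "c > 0" "P > 0" "M > 0" using elim by (auto simp: c_def P_def M_def)
        have ex: "expected_perfect_matchings {..<g} E ends n = fact n ^ g * S"
          unfolding expected_perfect_matchings_eq[OF G] edge_weight_def[symmetric] sum_balanced_weights_eq S_def by simp
        have ll: "lift_limit d g (real (g - k) / 2) D n = M * J / P"
          unfolding M_def J_def P_def by (rule lift_limit_eq[OF k D elim, symmetric])
        have "?Z n =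
          real g * ln (fact n) + real (card E) * log_ratio d n - (real g / 2 * ln (2 * pi * real n)
     + real (card E) / 2 * ln ((real d - 1) * ?v) + real n * real (card E) * bethe (1 / real d))" by simp
        then have "exp (?Z n) = fact n ^ g * c / M"
          by (simp only: exp_diff exp_add exp_of_nat_mult M_def c_def) simp
        then show ?case unfolding ex ll S_def[symmetric] c_def[symmetric] P_def[symmetric]
          using pp J \<gamma>(2) by (simp only:) (simp add: divide_simps)
      qed
    qed
  qed
qed

section \<open>Redundancy of a constraint in bipartite graphs, parity of admissible n\<close>

lemma sum_over_side:
  fixes m :: "'e \<Rightarrow> int"
  assumes L: "finite L" "L \<inter> R = {}" "\<forall>e\<in>E. \<exists>x\<in>L. \<exists>y\<in>R. ends e = {x, y}"
  shows "(\<Sum>v\<in>L. \<Sum>e | e \<in> E \<and> v \<in> ends e. m e) = (\<Sum>e\<in>E. m e)"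
proof -
  have "(\<Sum>v\<in>L. \<Sum>e | e \<in> E \<and> v \<in> ends e. m e) = (\<Sum>e\<in>E. \<Sum>v | v \<in> L \<and> v \<in> ends e. m e)"
    using L(1) finite_edge_set by (intro sum.swap_restrict)
  also have "\<dots> = (\<Sum>e\<in>E. m e)"
  proof (rule sum.cong[OF refl])
    fix e assume "e \<in> E"
    then obtain x y where "x \<in> L" "y \<in> R" "ends e = {x, y}" using L(3) by blast
    then have "{v. v \<in> L \<and> v \<in> ends e} = {x}" using L(2) by blast
    then show "(\<Sum>v | v \<in> L \<and> v \<in> ends e. m e) = m e" by simp
  qed
  finally show ?thesis .
qed

text \<open>Each side of the bipartition meets every edge once, so the vertex sums over the two
  sides agree. The sides have the same size, and all vertex sums but one are n; hence so is the
  last.\<close>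

lemma bipartite_last_constraint:
  fixes m :: "'e \<Rightarrow> int"
  assumes bip: "bipartite {..<g} E ends" and m: "\<forall>v<g - 1. (\<Sum>e | e \<in> E \<and> v \<in> ends e. m e) = int n"
  shows "\<forall>v<g. (\<Sum>e | e \<in> E \<and> v \<in> ends e. m e) = int n"
proof -
  have gp: "g > 0" by (rule g_pos[OF G conn])
  have main: "(\<Sum>e | e \<in> E \<and> g - 1 \<in> ends e. m e) = int n"
    if L: "L \<union> R = {..<g}" "L \<inter> R = {}" "\<forall>e\<in>E. \<exists>x\<in>L. \<exists>y\<in>R. ends e = {x, y}" and w: "g - 1 \<in> L" for L R
  proof -
    have fin: "finite L" "finite R" using L(1) by (metis finite_Un finite_lessThan)+
    have R': "\<forall>e\<in>E. \<exists>x\<in>R. \<exists>y\<in>L. ends e = {x, y}" "R \<inter> L = {}" using L(2,3) by (auto, metis insert_commute)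
    let ?s = "\<lambda>m v. \<Sum>e | e \<in> E \<and> v \<in> ends e. m e :: int"
    have eq: "(\<Sum>v\<in>L. ?s f v) = (\<Sum>v\<in>R. ?s f v)" for f
      using sum_over_side[OF fin(1) L(2,3)] sum_over_side[OF fin(2) R'(2,1)] by simp
    have s1: "?s (\<lambda>_. 1) v = int d" if "v < g" for v using degree[OF that] by simp
    have "(\<Sum>v\<in>L. ?s (\<lambda>_. 1) v) = (\<Sum>v\<in>L. int d)" "(\<Sum>v\<in>R. ?s (\<lambda>_. 1) v) = (\<Sum>v\<in>R. int d)"
      by (intro sum.cong refl s1; use L(1) in auto)+
    \<comment> \<open>For the constant weight 1, the equality of the side sums reads d |L| = d
      |R|.\<close>
    then have card: "card L = card R" using eq[of "\<lambda>_. 1"] d by simp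
    have sn: "?s m v = int n" if "v \<in> L \<union> R" "v \<noteq> g - 1" for v
      using m that L(1) by auto
    have "(\<Sum>v\<in>L. ?s m v) = ?s m (g - 1) + (\<Sum>v\<in>L - {g - 1}. int n)"
      using fin(1) w sn by (subst sum.remove[OF fin(1) w]) auto
    moreover have "(\<Sum>v\<in>R. ?s m v) = (\<Sum>v\<in>R. int n)"
      using sn w L(2) by (intro sum.cong) auto
    moreover have "int (card (L - {g - 1})) = int (card L) - 1"
      using fin(1) w by (metis card_Suc_Diff1 add_diff_cancel_left' of_nat_Suc)
    ultimately have "?s m (g - 1) + (int (card L) - 1) * int n = int (card L) * int n"
      using eq[of m] by (simp only: sum_constant card)
    then show ?thesis by (simp only: left_diff_distrib)
  qed
  obtain L R where LR: "L \<union> R = {..<g}" "L \<inter> R = {}" "\<forall>e\<in>E. \<exists>x\<in>L. \<exists>y\<in>R. ends e = {x, y}"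
    using bip unfolding bipartite_def by blast
  have RL: "R \<union> L = {..<g}" "R \<inter> L = {}" "\<forall>e\<in>E. \<exists>x\<in>R. \<exists>y\<in>L. ends e = {x, y}"
    using LR by (auto, metis insert_commute)
  have "g - 1 \<in> L \<union> R" using LR(1) gp by auto
  then have "(\<Sum>e | e \<in> E \<and> g - 1 \<in> ends e. m e) = int n" using main[OF LR] main[OF RL] by blast
  moreover have "v < g - 1 \<or> v = g - 1" if "v < g" for v using that by linarith
  ultimately show ?thesis using m by blast
qed

text \<open>Summing the integers n f(e) over all edges counts every vertex contribution n twice
  over, so twice an integer equals n g.\<close>

lemma admissible_even:
  assumes "admissible {..<g} E ends n"
  shows "even (n * g)"
proof -
  obtain f where f: "fractional_perfect_matching {..<g} E ends f" "\<forall>e\<in>E. real n * f e \<in> \<int>"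
    using assms by (auto simp: admissible_def)
  have "\<forall>e\<in>E. \<exists>z::int. real n * f e = of_int z" using f(2) by (auto elim: Ints_cases)
  from bchoice[OF this] obtain z :: "'e \<Rightarrow> int" where z: "\<And>e. e \<in> E \<Longrightarrow> real n * f e = of_int (z e)" by blast
  have "2 * (\<Sum>e\<in>E. real n * f e) = (\<Sum>v<g. \<Sum>e | e \<in> E \<and> v \<in> ends e. real n * f e)"
    by (rule sum_over_vertices[symmetric])
  also have "\<dots> = (\<Sum>v<g. real n * 1)"
    using f(1) by (intro sum.cong refl) (simp add: sum_distrib_left[symmetric] fractional_perfect_matching_def)
  finally have "real (n * g) = 2 * (\<Sum>e\<in>E. of_int (z e))" using z by (simp add: mult.commute)
  then have "real_of_int (int (n * g)) = real_of_int (2 * (\<Sum>e\<in>E. z e))" by simp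
  then have "int (n * g) = 2 * (\<Sum>e\<in>E. z e)" by (simp only: of_int_eq_iff)
  then show ?thesis by (metis dvd_triv_left even_of_nat)
qed

end

theorem theorem3p6:
  fixes g d :: nat and E :: "'e set" and ends :: "'e \<Rightarrow> nat set"
  assumes "loopless_multigraph {..<g} E ends"
    and "connected_multigraph {..<g} E ends"
    and "regular {..<g} E ends d"
    and "d \<ge> 3"
  defines "A \<equiv> adjacency_matrix g E ends"
    and "A' \<equiv> mat_delete (adjacency_matrix g E ends) (g - 1) (g - 1)"
    and "r \<equiv> real d"
    and "s \<equiv> real g"
  shows "(\<not> bipartite {..<g} E ends \<longrightarrow>
      expected_perfect_matchings {..<g} E ends
        \<sim>[inf sequentially (principal {n. admissible {..<g} E ends n})]
      (\<lambda>n. 2 * (r - 1) powr ((r - 1) * s / 2)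
             / ((r * (r - 2)) powr (r * s / 4 - s / 2) * sqrt (det (A + r \<cdot>\<^sub>m 1\<^sub>m g)))
           * ((r - 1) powr (r - 1) / r powr (r - 2)) powr (s * real n / 2)))
    \<and> (bipartite {..<g} E ends \<longrightarrow>
      expected_perfect_matchings {..<g} E ends
        \<sim>[inf sequentially (principal {n. admissible {..<g} E ends n})]
      (\<lambda>n. (r - 1) powr ((r - 1) * s / 2 + 1 / 2)
             / ((r * (r - 2)) powr (r * s / 4 - s / 2 + 1 / 2) * sqrt (det (A' + r \<cdot>\<^sub>m 1\<^sub>m (g - 1))))
           * (2 * pi * real n) powr (1 / 2)
           * ((r - 1) powr (r - 1) / r powr (r - 2)) powr (s * real n / 2)))"
proof -
  note G = assms(1) and conn = assms(2) and reg = assms(3) and d = assms(4)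
  let ?N = "{n. admissible {..<g} E ends n}"
  have gp: "g > 0" by (rule g_pos[OF G conn])
  show ?thesis
  proof (intro conjI impI)
    assume nb: "\<not> bipartite {..<g} E ends"
    have "expected_perfect_matchings {..<g} E ends \<sim>[inf sequentially (principal ?N)]
      (\<lambda>n. real 2 * lift_limit d g (real (g - g) / 2) (det (mat g g (\<lambda>(i, j). gram E ends i j))) n)"
    proof (rule expected_perfect_matchings_asymp_equiv[OF G conn reg d order_refl _ coercive_nonbipartite[OF G conn nb]])
      fix n \<epsilon> assume n: "n \<in> ?N" and \<epsilon>: "\<epsilon> \<in> even_shifts g E ends"
      have "even (n * g)" by (rule admissible_even[OF G conn reg d]) (use n in simp)
      then show "even (n * (\<Sum>v<g. \<epsilon> v))" using \<epsilon> unfolding even_shifts_full[OF G conn] by auto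
    next
      show "card (even_shifts g E ends) = 2"
        unfolding even_shifts_full[OF G conn] by (rule card_even_shifts_full[OF G conn])
    qed auto
    then show "expected_perfect_matchings {..<g} E ends
        \<sim>[inf sequentially (principal ?N)]
      (\<lambda>n. 2 * (r - 1) powr ((r - 1) * s / 2)
             / ((r * (r - 2)) powr (r * s / 4 - s / 2) * sqrt (det (A + r \<cdot>\<^sub>m 1\<^sub>m g)))
           * ((r - 1) powr (r - 1) / r powr (r - 2)) powr (s * real n / 2))"
    proof (rule asymp_equiv_trans[OF _ asymp_equiv_refl_ev])
      \<comment> \<open>The factor \<open>(2 * pi * real n) powr 0\<close> is 1 only for positive n,
        as \<open>0 powr 0\<close> is 0.\<close>
      have "eventually (\<lambda>n::nat. n > 0) (inf sequentially (principal ?N))"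
        by (rule filter_leD[OF inf_le1 eventually_gt_at_top])
      then show "eventually (\<lambda>n. real 2 * lift_limit d g (real (g - g) / 2) (det (mat g g (\<lambda>(i, j). gram E ends i j))) n =
        2 * (r - 1) powr ((r - 1) * s / 2)
             / ((r * (r - 2)) powr (r * s / 4 - s / 2) * sqrt (det (A + r \<cdot>\<^sub>m 1\<^sub>m g)))
           * ((r - 1) powr (r - 1) / r powr (r - 2)) powr (s * real n / 2)) (inf sequentially (principal ?N))"
        by eventually_elim
           (simp add: lift_limit_def Let_def gram_matrix_eq(1)[OF G conn reg] A_def r_def s_def)
    qed
  next
    assume bip: "bipartite {..<g} E ends"
    have "expected_perfect_matchings {..<g} E ends \<sim>[inf sequentially (principal ?N)]
      (\<lambda>n. real 1 * lift_limit d g (real (g - (g - 1)) / 2) (det (mat (g - 1) (g - 1) (\<lambda>(i, j). gram E ends i j))) n)"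
    proof (rule expected_perfect_matchings_asymp_equiv[OF G conn reg d _ bipartite_last_constraint[OF G conn reg d bip] coercive_rooted[OF G conn]])
      fix n \<epsilon> assume \<epsilon>: "\<epsilon> \<in> even_shifts (g - 1) E ends"
      then show "even (n * (\<Sum>v<g - 1. \<epsilon> v))" unfolding even_shifts_rooted[OF G conn] by auto
    next
      show "card (even_shifts (g - 1) E ends) = 1"
        unfolding even_shifts_rooted[OF G conn] by simp
    qed auto
    moreover have "real (g - (g - 1)) = 1" using gp by simp
    ultimately show "expected_perfect_matchings {..<g} E ends
        \<sim>[inf sequentially (principal ?N)]
      (\<lambda>n. (r - 1) powr ((r - 1) * s / 2 + 1 / 2)
             / ((r * (r - 2)) powr (r * s / 4 - s / 2 + 1 / 2) * sqrt (det (A' + r \<cdot>\<^sub>m 1\<^sub>m (g - 1))))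
           * (2 * pi * real n) powr (1 / 2)
           * ((r - 1) powr (r - 1) / r powr (r - 2)) powr (s * real n / 2))"
      unfolding lift_limit_def Let_def gram_matrix_eq(2)[OF G conn reg] A'_def r_def s_def by simp
  qed
qed

end
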